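(* Let $(X,\Theta)$ be a principally polarized abelian variety, and let $\pi^0$ be the commutative Heisenberg vertex algebra of level $0$ (of rank $1$), equipped with its standard conformal vector. The space of coinvariants $\mathbb{V}(X,\Theta,\pi^0)$ admits a canonical isomorphism \[ \mathbb{V}\left(X,\Theta,\pi^0\right)\cong\mathrm{Sym}\left(H^0(X,\Omega^1_X)^*\right). \] Equivalently, $\mathbb{V}(X,\Theta,\pi^0)\cong\mathrm{Fun}\left(H^0(X,\Omega^1_X)\right)$, the ring of polynomial functions on $H^0(X,\Omega^1_X)$.
   Context: Everything is over $\mathbb{C}$. **Extended PPAVs.** Let $H=\mathbb{C}((t))$ with the $t$-adic topology and Lie bracket $\langle f,g\rangle=-\mathrm{Res}_{t=0}f\,dg$, $b_i=t^i$, $H'=H/\mathbb{C}b_0$ with the induced nondegenerate symplectic form, $H'_+=t\mathbb{C}[[t]]$. An extended principally polarized abelian variety (PPAV) of dimension $g$ is a triple $a=(Z,F,L)$ with $Z\subset H'$ Lagrangian, $F\subset Z$ of codimension $g$, and $L$ a rank $2g$ lattice in $F^\perp/F$, such that: (1) $Z\cap H'_+=0$ (so $F^\perp/F=Z/F\oplus F^\perp_+$ with $F^\perp_+=F^\perp\cap H'_+$); (2) $L_{\mathbb{R}}\cap F^\perp_+=0$ in $F^\perp/F$, where $L_{\mathbb{R}}=L\otimes_{\mathbb{Z}}\mathbb{R}$ (so the real structure on $F^\perp/F$ given by $L_{\mathbb{R}}$ identifies $F^\perp_+$ with the conjugate of $Z/F$, and $B(u,v)=\frac1\pi\langle\bar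 u,v\rangle$ is Hermitian on $Z/F$); (3) $\frac{1}{2\pi i}\langle\,,\rangle$ is unimodular on $L$; (4) $B$ is positive definite. It determines a PPAV $(X,\Theta)$: $X$ is the quotient of $Z/F$ by the image of $L$ under $F^\perp/F\to Z/F$, and $\Theta$ is induced by $B$; in particular $Z/F\cong H^0(X,\Omega^1_X)^*$. For a PPAV $(X,\Theta)$, $\mathrm{Sp}(X,\Theta)$ is the infinite-dimensional complex manifold of all extended PPAVs with underlying PPAV $(X,\Theta)$ (the fiber over $(X,\Theta)$ of the forgetful map $\widehat{\mathcal{A}}_g\to\mathcal{A}_g$ from the Arbarello–De Concini moduli space of extended PPAVs). $\mathbb{F}\to\mathrm{Sp}(X,\Theta)$ is the tautological sheaf with fiber $F$ at $(Z,F,L)$. **The vertex algebra.** Let $\Gamma$ be a positive-definite even lattice of rank $d=1$ and $\mathfrak{h}_\Gamma=\Gamma\otimes_{\mathbb{Z}}\mathbb{C}$. The Heisenberg algebra $\widehat{\mathfrak h}_\Gamma$ is the central extension of $\mathfrak{h}_\Gamma((t))$ by $\mathbb{C}\mathbf 1$ with $[A\otimes f,B\otimes g]=-(A,B)(\mathrm{Res}_{t=0}f\,dg)\mathbf{1}$; write $A_n=A\otimes t^n$. $V=\pi^0$ is the Fock module of level $0$ (generated by a vector $\mathbf{1}$ killed by $\mathfrak{h}_\Gamma\otimes\mathbb{C}[[t]]$, with the central element acting by $0$), i.e. the commutative vertex algebra $\mathrm{Sym}(\mathfrak{h}_\Gamma\otimes t^{-1}\mathbb{C}[t^{-1}])$.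 Its standard conformal vector is $\omega=\frac12H^1_{-1}H^1_{-1}\mathbf{1}$ for $H^1$ a unit vector of $\mathfrak{h}_\Gamma$. Elements $A\otimes f$ with $f\in H'$ act on $V$. **Spaces of coinvariants.** For $a=(Z,F,L)$, $\widehat{\mathbb{V}}(a,V)=V/(\mathfrak{h}_\Gamma\otimes F)(V)$. Globally, with $\mathfrak{h}^{\mathrm{out}}_\Gamma(X,\Theta)=\mathfrak{h}_\Gamma\otimes\mathbb{F}$, \[\widehat{\mathbb{V}}(X,\Theta,V)=V\otimes\mathscr{O}_{\mathrm{Sp}(X,\Theta)}\,/\,\mathfrak{h}^{\mathrm{out}}_\Gamma(X,\Theta)\left(V\otimes\mathscr{O}_{\mathrm{Sp}(X,\Theta)}\right),\] a quasi-coherent sheaf on $\mathrm{Sp}(X,\Theta)$ with fibers $\widehat{\mathbb{V}}(a,V)$. Let $\mathbb{S}\mathrm{p}^+(H')$ be the identity component of the group of continuous symplectic automorphisms of $H'$ preserving $H'_+$; it acts transitively on $\mathrm{Sp}(X,\Theta)$, with Lie algebra $\mathfrak{sp}^+(H')=\{X\in\mathfrak{sp}(H'):X(H'_+)\subseteq H'_+\}$, topologically generated by $b_ib_j$ with $i,j$ not both negative. The Lie algebra $\mathfrak{sp}^+(H')$ acts on $V$ as a subalgebra of the metaplectic algebra $\mathfrak{mp}(H')$ (the universal central extension of $\mathfrak{sp}(H')$ realized by quadratic elements in the Weyl algebra of $H$, which splits over $\mathfrak{sp}^+(H')$ by normal ordering), where $\mathfrak{mp}(H')$ acts on $V$ by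 $\mathbf 1\mapsto d\,\mathrm{id}_V$, $b_mb_n\mapsto\sum_{i=1}^dH^i_mH^i_n$ for an orthonormal basis $\{H^i\}$ of $\mathfrak{h}_\Gamma$; combined with its action on $\mathrm{Sp}(X,\Theta)$ it acts on $\widehat{\mathbb{V}}(X,\Theta,V)$, and this action exponentiates to an $\mathbb{S}\mathrm{p}^+(H')$-equivariant structure, for which the stabilizer of each point $a$ acts trivially on the fiber at $a$. The space of coinvariants $\mathbb{V}(X,\Theta,V)$ is the vector space obtained by descending $\widehat{\mathbb{V}}(X,\Theta,V)$ first to $[\mathrm{Sp}(X,\Theta)/\mathbb{S}\mathrm{p}^+(H')]$ and then to $\mathrm{Spec}(\mathbb{C})$.
   Formalization: At level 0, b_m b_n ↦ H_m H_n is no Lie algebra action; it is replaced by the action with g·1=1, g(A⊗f)g⁻¹=A⊗g(f). Points of Sp(X,Θ) carry an identification with (X,Θ), and conjugation taking Z/F onto F₊^⊥ is part of the definition of extended PPAV. *)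

theory Defs
  imports
    "HOL-Analysis.Analysis"
    "HOL-Computational_Algebra.Formal_Laurent_Series"
    "HOL-Library.Poly_Mapping"
    "HOL-Library.Set_Algebras"
    "HOL-Library.Function_Algebras"
    "HOL-Library.FuncSet"
begin

section \<open>Complex vector spaces on carriers\<close>

record 'a cspace =
  carr :: "'a set"
  vadd :: "'a \<Rightarrow> 'a \<Rightarrow> 'a"
  vscale :: "complex \<Rightarrow> 'a \<Rightarrow> 'a"

definition lin_iso :: "'a cspace \<Rightarrow> 'b cspace \<Rightarrow> ('a \<Rightarrow> 'b) \<Rightarrow> bool" where
  "lin_iso S S' f \<longleftrightarrow> bij_betw f (carr S) (carr S')
     \<and> (\<forall>x\<in>carr S. \<forall>y\<in>carr S. f (vadd S x y) = vadd S' (f x) (f y))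
     \<and> (\<forall>c. \<forall>x\<in>carr S. f (vscale S c x) = vscale S' c (f x))"


section \<open>The symplectic space \<open>H' = \<complex>((t)) / \<complex>\<close>\<close>

quotient_type hp = "complex fls" / "\<lambda>f g. \<exists>c. f - g = fls_const c"
  morphisms rep_hp hclass
proof (rule equivpI)
  show "reflp (\<lambda>f g. \<exists>c. f - g = (fls_const c :: complex fls))"
    by (rule reflpI) (auto intro: exI[of _ 0])
  show "symp (\<lambda>f g. \<exists>c. f - g = (fls_const c :: complex fls))"
  proof (rule sympI)
    fix f g :: "complex fls"
    assume "\<exists>c. f - g = fls_const c"
    then obtain c where "f - g = fls_const c" by blast
    then have "g - f = fls_const (- c)" by (metis fls_const_uminus minus_diff_eq)
    then show "\<exists>c. g - f = fls_const c" by blast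
  qed
  show "transp (\<lambda>f g. \<exists>c. f - g = (fls_const c :: complex fls))"
  proof (rule transpI)
    fix f g h :: "complex fls"
    assume "\<exists>c. f - g = fls_const c" "\<exists>c. g - h = fls_const c"
    then obtain c d where "f - g = fls_const c" "g - h = fls_const d" by blast
    then have "f - h = fls_const (c + d)"
      by (metis add_diff_cancel_left' diff_add_cancel diff_add_eq fls_plus_const group_cancel.sub1)
    then show "\<exists>c. f - h = fls_const c" by blast
  qed
qed

instantiation hp :: ab_group_add
begin
lift_definition zero_hp :: hp is 0 .
lift_definition plus_hp :: "hp \<Rightarrow> hp \<Rightarrow> hp" is "(+)"
  by (metis add_diff_add fls_plus_const)
lift_definition minus_hp :: "hp \<Rightarrow> hp \<Rightarrow> hp" is "(-)"
  by (metis diff_diff_eq2 fls_minus_const add_diff_eq diff_add_eq diff_diff_add add.commute)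
lift_definition uminus_hp :: "hp \<Rightarrow> hp" is uminus
  by (metis fls_const_uminus minus_diff_minus)
instance
proof
  fix a b c :: hp
  show "a + b + c = a + (b + c)" by transfer (auto simp: algebra_simps intro!: exI[of _ 0])
  show "a + b = b + a" by transfer (auto simp: algebra_simps intro!: exI[of _ 0])
  show "0 + a = a" by transfer (auto intro!: exI[of _ 0])
  show "- a + a = 0" by transfer (auto intro!: exI[of _ 0])
  show "a - b = a + - b" by transfer (auto intro!: exI[of _ 0])
qed
end

lift_definition hscale :: "complex \<Rightarrow> hp \<Rightarrow> hp" is "\<lambda>c f. fls_const c * f"
  by (metis fls_const_mult_const right_diff_distrib')

interpretation H': vector_space hscale
proof
  fix a b :: complex and x y :: hp
  show "hscale a (x + y) = hscale a x + hscale a y"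
    by transfer (rule exI[of _ 0], simp add: distrib_left)
  show "hscale (a + b) x = hscale a x + hscale b x"
    by transfer (rule exI[of _ 0], simp add: distrib_right flip: fls_plus_const)
  show "hscale a (hscale b x) = hscale (a * b) x"
    by transfer (rule exI[of _ 0], simp add: mult.assoc[symmetric])
  show "hscale 1 x = x"
    by transfer (rule exI[of _ 0], simp)
qed

text \<open>The quotient of the \<open>t\<close>-adic topology.\<close>

instantiation hp :: topological_space
begin
definition open_hp :: "hp set \<Rightarrow> bool" where
  "open_hp U \<longleftrightarrow> open (hclass -` U)"
instance
  by standard (auto simp: open_hp_def vimage_Union)
end

lift_definition hform :: "hp \<Rightarrow> hp \<Rightarrow> complex" is "\<lambda>f g. - fls_residue (f * fls_deriv g)"
proof -
  fix f f' g g' :: "complex fls"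
  assume "\<exists>c. f - f' = fls_const c" "\<exists>c. g - g' = fls_const c"
  then obtain c d where f: "f = fls_const c + f'" and g: "g = fls_const d + g'"
    by (metis diff_add_cancel)
  have "fls_deriv g = fls_deriv g'" by (simp add: g)
  moreover have "fls_residue (fls_const c * fls_deriv g') = 0"
    by (simp add: fls_residue_fls_const_times)
  ultimately show "- fls_residue (f * fls_deriv g) = - fls_residue (f' * fls_deriv g')"
    by (simp add: f distrib_right)
qed

text \<open>The coefficient of \<open>t\<^sup>n\<close>; it is defined on \<open>H'\<close> for \<open>n \<noteq> 0\<close> only.\<close>

lift_definition hcoeff :: "hp \<Rightarrow> int \<Rightarrow> complex" is "\<lambda>f n. if n = 0 then 0 else fls_nth f n"
  by (auto simp: fun_eq_iff fls_eq_iff split: if_splits)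

definition hbasis :: "int \<Rightarrow> hp" where
  "hbasis i = hclass (fls_X_intpow i)"

definition Hplus :: "hp set" where
  "Hplus = hclass ` {f. \<forall>n\<le>0. fls_nth f n = 0}"

definition perp :: "hp set \<Rightarrow> hp set" where
  "perp S = {x. \<forall>y\<in>S. hform x y = 0}"

definition lagrangian :: "hp set \<Rightarrow> bool" where
  "lagrangian Z \<longleftrightarrow> H'.subspace Z \<and> perp Z = Z"

definition has_codim :: "hp set \<Rightarrow> hp set \<Rightarrow> nat \<Rightarrow> bool" where
  "has_codim F Z g \<longleftrightarrow> H'.subspace F \<and> F \<subseteq> Z \<and>
     (\<exists>E\<subseteq>Z. finite E \<and> card E = g \<and> \<not> H'.dependent E \<and>
        H'.span E \<inter> F = {0} \<and> Z = H'.span E + F)"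


section \<open>Extended principally polarized abelian varieties\<close>

text \<open>An integral form on an additive group that induces an isomorphism onto the dual group.\<close>

definition unimodular :: "'a::plus set \<Rightarrow> ('a \<Rightarrow> 'a \<Rightarrow> complex) \<Rightarrow> bool" where
  "unimodular L E \<longleftrightarrow> (\<forall>x\<in>L. \<forall>y\<in>L. E x y \<in> \<int>) \<and>
     (\<forall>h :: 'a \<Rightarrow> int. (\<forall>x\<in>L. \<forall>y\<in>L. h (x + y) = h x + h y) \<longrightarrow>
        (\<exists>!x. x \<in> L \<and> (\<forall>y\<in>L. E x y = of_int (h y))))"

text \<open>Elements of \<open>F\<^sup>\<bottom>/F\<close> are cosets \<open>x +o F\<close>, \<open>x \<in> F\<^sup>\<bottom>\<close>.\<close>

definition lattice_in :: "hp set \<Rightarrow> nat \<Rightarrow> hp set set \<Rightarrow> bool" where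
  "lattice_in F r L \<longleftrightarrow> (\<exists>e :: nat \<Rightarrow> hp. (\<forall>i<r. e i \<in> perp F) \<and>
     (\<forall>c :: nat \<Rightarrow> real. (\<Sum>i<r. hscale (of_real (c i)) (e i)) \<in> F \<longrightarrow> (\<forall>i<r. c i = 0)) \<and>
     L = {(\<Sum>i<r. hscale (of_int (n i)) (e i)) +o F | n :: nat \<Rightarrow> int. True})"

definition lattice_real :: "hp set \<Rightarrow> hp set set \<Rightarrow> hp set set" where
  "lattice_real F L = {(\<Sum>i<k. hscale (of_real (c i)) (x i)) +o F | (k::nat) c x. \<forall>i<k. x i +o F \<in> L}"

text \<open>\<open>w\<close> represents the complex conjugate of the class of \<open>u\<close>, for the real structure \<open>L\<^sub>\<real>\<close>
  on \<open>F\<^sup>\<bottom>/F\<close>.\<close>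

definition hconj :: "hp set \<Rightarrow> hp set set \<Rightarrow> hp \<Rightarrow> hp \<Rightarrow> bool" where
  "hconj F L u w \<longleftrightarrow> (\<exists>x y. x +o F \<in> lattice_real F L \<and> y +o F \<in> lattice_real F L \<and>
     u - (x + hscale \<i> y) \<in> F \<and> w - (x - hscale \<i> y) \<in> F)"

text \<open>\<open>B(u,v) = \<langle>u\<^sup>-,v\<rangle>/\<pi>\<close> on \<open>Z/F\<close>. The conjugate is determined modulo \<open>F\<close>, and
  \<open>F\<close> is orthogonal to \<open>Z\<close>, so the choice of a representative is immaterial.\<close>

definition hermB :: "hp set \<Rightarrow> hp set set \<Rightarrow> hp \<Rightarrow> hp \<Rightarrow> complex" where
  "hermB F L u v = hform (SOME w. hconj F L u w) v / of_real pi"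

text \<open>The form on \<open>F\<^sup>\<bottom>/F\<close>, evaluated on cosets.\<close>

definition qform :: "hp set \<Rightarrow> hp set \<Rightarrow> complex" where
  "qform A B = the_elem ((\<lambda>(x, y). hform x y) ` (A \<times> B))"

record ext_triple =
  Zof :: "hp set"
  Fof :: "hp set"
  Lof :: "hp set set"

text \<open>The equality of sets below says that conjugation carries \<open>Z/F\<close> onto
  \<open>F\<^sup>\<bottom>\<^sub>+\<close>; it is what makes \<open>B\<close> Hermitian and compatible with the torus \<open>(Z/F)/L\<close>.\<close>

definition ext_ppav :: "nat \<Rightarrow> ext_triple \<Rightarrow> bool" where
  "ext_ppav g a \<longleftrightarrow> (let Z = Zof a; F = Fof a; L = Lof a in
     lagrangian Z \<and> has_codim F Z g \<and> lattice_in F (2 * g) L \<and>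
     Z \<inter> Hplus = {0} \<and>
     (\<forall>x\<in>perp F \<inter> Hplus. x +o F \<in> lattice_real F L \<longrightarrow> x = 0) \<and>
     {w. \<exists>u\<in>Z. hconj F L u w} = (perp F \<inter> Hplus) + F \<and>
     unimodular L (\<lambda>x y. qform x y / (2 * of_real pi * \<i>)) \<and>
     (\<forall>u\<in>Z. u \<notin> F \<longrightarrow> Im (hermB F L u u) = 0 \<and> 0 < Re (hermB F L u u)))"


section \<open>The fibre \<open>Sp(X,\<Theta>)\<close>\<close>

text \<open>A principally polarized abelian variety, as a complex torus \<open>\<complex>\<^sup>g/\<Lambda>\<close> with a positive
  definite Hermitian form (antilinear in the first argument) whose imaginary part is integral
  and unimodular on \<open>\<Lambda>\<close>.\<close>

definition ppav :: "(complex^'n) set \<Rightarrow> (complex^'n \<Rightarrow> complex^'n \<Rightarrow> complex) \<Rightarrow> bool" where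
  "ppav \<Lambda> B \<longleftrightarrow>
     (\<exists>E. independent E \<and> card E = 2 * CARD('n) \<and>
        \<Lambda> = {\<Sum>e\<in>E. of_int (k e) *\<^sub>R e | k :: complex^'n \<Rightarrow> int. True}) \<and>
     (\<forall>u v w. B u (v + w) = B u v + B u w) \<and> (\<forall>c u v. B u (c *s v) = c * B u v) \<and>
     (\<forall>u v. B v u = cnj (B u v)) \<and> (\<forall>u. u \<noteq> 0 \<longrightarrow> 0 < Re (B u u)) \<and>
     unimodular \<Lambda> (\<lambda>u v. of_real (Im (B u v)))"

text \<open>A point of the fibre over \<open>(X,\<Theta>)\<close> is an extended PPAV together with an identification of
  its underlying PPAV with \<open>(X,\<Theta>)\<close>, i.e. an isometry of \<open>Z/F\<close> with \<open>\<complex>\<^sup>g\<close> carrying the image of \<open>L\<close>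
  onto \<open>\<Lambda>\<close>. It is stored as a linear map on \<open>Z\<close> with kernel \<open>F\<close>.\<close>

type_synonym ('n) pt = "ext_triple \<times> (hp \<Rightarrow> complex^'n)"

definition Sp :: "(complex^'n) set \<Rightarrow> (complex^'n \<Rightarrow> complex^'n \<Rightarrow> complex) \<Rightarrow> 'n pt set" where
  "Sp \<Lambda> B = {(a, \<phi>). ext_ppav CARD('n) a \<and> \<phi> \<in> extensional (Zof a) \<and>
     (\<forall>u\<in>Zof a. \<forall>v\<in>Zof a. \<phi> (u + v) = \<phi> u + \<phi> v) \<and>
     (\<forall>c. \<forall>u\<in>Zof a. \<phi> (hscale c u) = c *s \<phi> u) \<and>
     \<phi> ` Zof a = UNIV \<and> {u \<in> Zof a. \<phi> u = 0} = Fof a \<and>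
     \<phi> ` {u \<in> Zof a. \<exists>h\<in>perp (Fof a) \<inter> Hplus. (u + h) +o Fof a \<in> Lof a} = \<Lambda> \<and>
     (\<forall>u\<in>Zof a. \<forall>v\<in>Zof a. hermB (Fof a) (Lof a) u v = B (\<phi> u) (\<phi> v))}"

text \<open>Coordinates on \<open>Sp(X,\<Theta>)\<close>: since \<open>H' = Z \<oplus> H'\<^sub>+\<close>, each \<open>t\<^sup>-\<^sup>m\<close> (\<open>m > 0\<close>) is congruent
  modulo \<open>H'\<^sub>+\<close> to a unique \<open>z\<^sub>m \<in> Z\<close>. The coefficients of all \<open>z\<^sub>m\<close> and the components of all
  \<open>\<phi>(z\<^sub>m)\<close> determine the point (indices are shifted by one); their possible values form an open
  subset of a closed linear subspace of a countable power of \<open>\<complex>\<close>.\<close>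

definition zlift :: "hp set \<Rightarrow> nat \<Rightarrow> hp" where
  "zlift Z m = (THE z. z \<in> Z \<and> z - hbasis (- int (Suc m)) \<in> Hplus)"

fun coord :: "'n::finite pt \<Rightarrow> (nat \<times> nat) + (nat \<times> 'n) \<Rightarrow> complex" where
  "coord (a, \<phi>) (Inl (m, k)) = hcoeff (zlift (Zof a) m) (int (Suc k))"
| "coord (a, \<phi>) (Inr (m, i)) = vec_nth (\<phi> (zlift (Zof a) m)) i"

definition SpTop :: "(complex^'n) set \<Rightarrow> (complex^'n \<Rightarrow> complex^'n \<Rightarrow> complex) \<Rightarrow> 'n::finite pt topology" where
  "SpTop \<Lambda> B = pullback_topology (Sp \<Lambda> B) coord euclidean"

text \<open>Holomorphic functions on an open subset of a Frechet manifold: continuous functions that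
  are holomorphic along every complex line in coordinates.\<close>

definition holo :: "(complex^'n) set \<Rightarrow> (complex^'n \<Rightarrow> complex^'n \<Rightarrow> complex)
    \<Rightarrow> 'n pt set \<Rightarrow> ('n pt \<Rightarrow> complex) \<Rightarrow> bool" where
  "holo \<Lambda> B U f \<longleftrightarrow> openin (SpTop \<Lambda> B) U \<and>
     continuous_map (subtopology (SpTop \<Lambda> B) U) euclidean f \<and>
     (\<forall>D \<gamma> c d. open D \<and> \<gamma> ` D \<subseteq> U \<and> (\<forall>z\<in>D. \<forall>i. coord (\<gamma> z) i = c i + z * d i)
        \<longrightarrow> (\<lambda>z. f (\<gamma> z)) holomorphic_on D)"


section \<open>The group \<open>Sp\<^sup>+(H')\<close> and its action on \<open>Sp(X,\<Theta>)\<close>\<close>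

definition SpPlus_full :: "(hp \<Rightarrow> hp) set" where
  "SpPlus_full = {g. bij g \<and> (\<forall>x y. g (x + y) = g x + g y) \<and> (\<forall>c x. g (hscale c x) = hscale c (g x)) \<and>
     continuous_on UNIV g \<and> continuous_on UNIV (inv g) \<and>
     (\<forall>x y. hform (g x) (g y) = hform x y) \<and> g ` Hplus = Hplus}"

text \<open>The topology on the group comes from the complex topology on matrix entries
  (the \<open>t\<close>-adic topology would make \<open>\<complex>\<close> discrete and the group totally disconnected).\<close>

definition SpPlus :: "(hp \<Rightarrow> hp) set" where
  "SpPlus = connected_component_of_set
     (pullback_topology SpPlus_full (\<lambda>g (i::int, j::int). hcoeff (g (hbasis i)) j) euclidean) id"

definition pt_act :: "(hp \<Rightarrow> hp) \<Rightarrow> 'n pt \<Rightarrow> 'n pt" where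
  "pt_act g = (\<lambda>(a, \<phi>).
     (\<lparr>Zof = g ` Zof a, Fof = g ` Fof a, Lof = (image g) ` Lof a\<rparr>,
      restrict (\<phi> \<circ> inv g) (g ` Zof a)))"


section \<open>Polynomials\<close>

type_synonym 'v mpoly = "('v \<Rightarrow>\<^sub>0 nat) \<Rightarrow>\<^sub>0 complex"

definition PVar :: "'v \<Rightarrow> 'v mpoly" where
  "PVar v = Poly_Mapping.single (Poly_Mapping.single v 1) 1"

definition PConst :: "complex \<Rightarrow> 'v mpoly" where
  "PConst c = Poly_Mapping.single 0 c"

definition psubst :: "('v \<Rightarrow> 'w mpoly) \<Rightarrow> 'v mpoly \<Rightarrow> 'w mpoly" where
  "psubst f p = (\<Sum>m\<in>Poly_Mapping.keys p. PConst (Poly_Mapping.lookup p m) *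
     (\<Prod>v\<in>Poly_Mapping.keys m. f v ^ Poly_Mapping.lookup m v))"


lemma poly_mapping_single_induct:
  fixes p :: "'a \<Rightarrow>\<^sub>0 'b::comm_monoid_add"
  assumes "P 0" and "\<And>m c q. P q \<Longrightarrow> P (Poly_Mapping.single m c + q)"
  shows "P p"
proof (induction p rule: update_induct)
  case const
  show ?case by fact
next
  case (update f a b)
  have "Poly_Mapping.update a b f = Poly_Mapping.single a b + f"
    using update.hyps by (intro poly_mapping_eqI)
      (auto simp: lookup_update lookup_add lookup_single when_def in_keys_iff)
  then show ?case using assms(2)[OF update.IH] by simp
qed

lemma PConst_0: "PConst 0 = 0" and PConst_add: "PConst (a + b) = PConst a + PConst b"
  and PConst_mult: "PConst (a * b) = PConst a * PConst b"
  by (simp_all add: PConst_def single_add mult_single)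

lemma psubst_superset:
  assumes "finite S" "Poly_Mapping.keys p \<subseteq> S"
  shows "psubst f p = (\<Sum>m\<in>S. PConst (Poly_Mapping.lookup p m) *
    (\<Prod>v\<in>Poly_Mapping.keys m. f v ^ Poly_Mapping.lookup m v))"
  unfolding psubst_def
  by (rule sum.mono_neutral_left) (use assms in \<open>auto simp: in_keys_iff PConst_0\<close>)

lemma psubst_add: "psubst f (p + q) = psubst f p + psubst f q"
proof -
  let ?S = "Poly_Mapping.keys p \<union> Poly_Mapping.keys q"
  have "finite ?S" by simp
  then show ?thesis
    using keys_add[of p q]
    by (simp add: psubst_superset[of ?S] lookup_add PConst_add distrib_right sum.distrib)
qed

lemma psubst_0: "psubst f 0 = 0"
  by (simp add: psubst_def)

lemma psubst_sum: "psubst f (sum h A) = (\<Sum>i\<in>A. psubst f (h i))"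
  by (induction A rule: infinite_finite_induct) (simp_all add: psubst_0 psubst_add)

lemma psubst_single:
  "psubst f (Poly_Mapping.single m c) = PConst c *
    (\<Prod>v\<in>Poly_Mapping.keys m. f v ^ Poly_Mapping.lookup m v)"
  by (cases "c = 0") (simp_all add: psubst_def PConst_0)

lemma prod_monomial_add:
  fixes m m' :: "'v \<Rightarrow>\<^sub>0 nat" and f :: "'v \<Rightarrow> 'c::comm_monoid_mult"
  shows "(\<Prod>v\<in>Poly_Mapping.keys (m + m'). f v ^ Poly_Mapping.lookup (m + m') v) =
    (\<Prod>v\<in>Poly_Mapping.keys m. f v ^ Poly_Mapping.lookup m v) *
    (\<Prod>v\<in>Poly_Mapping.keys m'. f v ^ Poly_Mapping.lookup m' v)"
proof -
  let ?S = "Poly_Mapping.keys m \<union> Poly_Mapping.keys m'"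
  have *: "(\<Prod>v\<in>Poly_Mapping.keys k. f v ^ Poly_Mapping.lookup k v) =
      (\<Prod>v\<in>?S. f v ^ Poly_Mapping.lookup k v)" if "Poly_Mapping.keys k \<subseteq> ?S" for k
    by (rule prod.mono_neutral_left) (use that in \<open>auto simp: in_keys_iff\<close>)
  show ?thesis
    unfolding *[OF keys_add] *[OF Un_upper1] *[OF Un_upper2]
    by (simp add: lookup_add power_add prod.distrib)
qed

lemma psubst_mult: "psubst f (p * q) = psubst f p * psubst f q"
proof (induction p rule: poly_mapping_single_induct)
  case 1
  show ?case by (simp add: psubst_0)
next
  case (2 m c p)
  have "psubst f (Poly_Mapping.single m c * q) = psubst f (Poly_Mapping.single m c) * psubst f q"
  proof (induction q rule: poly_mapping_single_induct)
    case 1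
    show ?case by (simp add: psubst_0)
  next
    case (2 m' c' q)
    then show ?case
      by (simp add: distrib_left psubst_add mult_single psubst_single prod_monomial_add PConst_mult mult_ac)
  qed
  with 2 show ?case by (simp add: distrib_right psubst_add)
qed

lemma psubst_PConst: "psubst f (PConst c) = PConst c"
  by (simp add: PConst_def psubst_single)

lemma psubst_PVar: "psubst f (PVar v) = f v"
proof -
  have "PConst 1 * f v = f v" by (simp add: PConst_def)
  then show ?thesis by (simp add: PVar_def psubst_single)
qed


section \<open>The level \<open>0\<close> Fock module\<close>

text \<open>The lattice is \<open>\<Gamma> = \<int>\<gamma>\<close> with \<open>(\<gamma>,\<gamma>) = 2N\<close>; elements \<open>\<alpha>\<gamma>\<close> of \<open>\<h>\<^sub>\<Gamma> = \<Gamma> \<otimes> \<complex>\<close> are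
  represented by \<open>\<alpha> :: complex\<close>, and \<open>H\<^sup>1 = \<gamma>/\<surd>(2N)\<close> is a unit vector. The variable with index
  \<open>n\<close> of the polynomial ring \<open>\<pi>\<^sup>0\<close> is \<open>H\<^sup>1\<^sub>-\<^sub>(\<^sub>n\<^sub>+\<^sub>1\<^sub>)\<close>.\<close>

type_synonym fock = "nat mpoly"

definition H1 :: "nat \<Rightarrow> complex" where
  "H1 N = of_real (1 / sqrt (2 * real N))"

definition polar :: "hp \<Rightarrow> fock" where
  "polar f = (\<Sum>n | hcoeff f (- int (Suc n)) \<noteq> 0. PConst (hcoeff f (- int (Suc n))) * PVar n)"

text \<open>\<open>(\<alpha>\<gamma>) \<otimes> f\<close> acting on \<open>\<pi>\<^sup>0\<close>: since the central element acts by \<open>0\<close>, the nonnegative modes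
  commute with everything and kill the generator, hence act by \<open>0\<close>.\<close>

definition heis :: "nat \<Rightarrow> complex \<Rightarrow> hp \<Rightarrow> fock \<Rightarrow> fock" where
  "heis N \<alpha> f v = PConst (\<alpha> * of_real (sqrt (2 * real N))) * polar f * v"

definition out_span :: "nat \<Rightarrow> hp set \<Rightarrow> fock set" where
  "out_span N F = {(\<Sum>k<n. heis N (A k) (f k) (v k)) | (n::nat) A f v. \<forall>k<n. f k \<in> F}"

text \<open>The action of \<open>Sp\<^sup>+(H')\<close> on \<open>\<pi>\<^sup>0\<close> is the one determined by \<open>g\<cdot>1 = 1\<close> and the integrated
  form of the metaplectic commutation relation, \<open>g (A \<otimes> f) g\<^sup>-\<^sup>1 = A \<otimes> g f\<close>
  (see \<open>fock_act_heis\<close> below). On the Lie algebra, for \<open>m < 0 < n\<close>, \<open>b\<^sub>m b\<^sub>n\<close> acts by the derivation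
  \<open>n H\<^sub>m \<partial>/\<partial>H\<^sub>-\<^sub>n\<close>, the value of the normally ordered product \<open>H\<^sub>m H\<^sub>n\<close> at level \<open>1\<close>.
  At level \<open>0\<close> the operators \<open>H\<^sub>n\<close> themselves, \<open>n \<ge> 0\<close>, vanish, and the action of the group
  is recovered by rescaling with the level before specializing it to \<open>0\<close>.\<close>

definition fock_act :: "(hp \<Rightarrow> hp) \<Rightarrow> fock \<Rightarrow> fock" where
  "fock_act g = psubst (\<lambda>n. polar (g (hbasis (- int (Suc n)))))"


lemma hcoeff_linear [simp]:
  "hcoeff 0 n = 0" "hcoeff (x + y) n = hcoeff x n + hcoeff y n" "hcoeff (hscale c x) n = c * hcoeff x n"
  "hcoeff (x - y) n = hcoeff x n - hcoeff y n"
  by (transfer; simp)+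

lemma finite_polar: "finite {n. hcoeff f (- int (Suc n)) \<noteq> 0}"
proof (rule finite_subset)
  let ?r = "rep_hp f"
  have "f = hclass ?r" by (rule Quotient_abs_rep[OF Quotient_hp, symmetric])
  then have eq: "hcoeff f (- int (Suc n)) = fls_nth ?r (- int (Suc n))" for n
    by (metis hcoeff.abs_eq neg_equal_0_iff_equal of_nat_0_eq_iff nat.distinct(1))
  show "{n. hcoeff f (- int (Suc n)) \<noteq> 0} \<subseteq> {..nat (- fls_subdegree ?r)}"
  proof
    fix n assume "n \<in> {n. hcoeff f (- int (Suc n)) \<noteq> 0}"
    then have "\<not> - int (Suc n) < fls_subdegree ?r"
      unfolding mem_Collect_eq eq using fls_eq0_below_subdegree by blast
    then show "n \<in> {..nat (- fls_subdegree ?r)}" by simp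
  qed
qed simp

lemma polar_superset:
  assumes "finite S" "{n. hcoeff f (- int (Suc n)) \<noteq> 0} \<subseteq> S"
  shows "polar f = (\<Sum>n\<in>S. PConst (hcoeff f (- int (Suc n))) * PVar n)"
  unfolding polar_def by (rule sum.mono_neutral_left) (use assms in \<open>auto simp: PConst_0\<close>)

lemma polar_add: "polar (x + y) = polar x + polar y"
proof -
  let ?S = "{n. hcoeff x (- int (Suc n)) \<noteq> 0} \<union> {n. hcoeff y (- int (Suc n)) \<noteq> 0}"
  have fin: "finite ?S" by (intro finite_UnI finite_polar)
  have sub: "{n. hcoeff (x + y) (- int (Suc n)) \<noteq> 0} \<subseteq> ?S" by auto
  have "polar (x + y) =
      (\<Sum>n\<in>?S. PConst (hcoeff x (- int (Suc n)) + hcoeff y (- int (Suc n))) * PVar n)"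
    unfolding hcoeff_linear(2)[symmetric] by (rule polar_superset[OF fin sub])
  also have "\<dots> = (\<Sum>n\<in>?S. PConst (hcoeff x (- int (Suc n))) * PVar n) +
      (\<Sum>n\<in>?S. PConst (hcoeff y (- int (Suc n))) * PVar n)"
    unfolding PConst_add distrib_right by (rule sum.distrib)
  also have "\<dots> = polar x + polar y"
    by (intro arg_cong2[where f = "(+)"] polar_superset[symmetric] fin Un_upper1 Un_upper2)
  finally show ?thesis .
qed

lemma polar_hscale: "polar (hscale c x) = PConst c * polar x"
proof -
  have sub: "{n. hcoeff (hscale c x) (- int (Suc n)) \<noteq> 0} \<subseteq> {n. hcoeff x (- int (Suc n)) \<noteq> 0}"
    by auto
  have "polar (hscale c x) = (\<Sum>n | hcoeff x (- int (Suc n)) \<noteq> 0.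
      PConst (c * hcoeff x (- int (Suc n))) * PVar n)"
    unfolding hcoeff_linear(3)[symmetric] by (rule polar_superset[OF finite_polar sub])
  then show ?thesis
    unfolding PConst_mult mult.assoc polar_def[of x] sum_distrib_left .
qed

lemma polar_Hplus: "x \<in> Hplus \<Longrightarrow> polar x = 0"
proof -
  assume "x \<in> Hplus"
  then obtain f where f: "x = hclass f" "\<And>n. n \<le> 0 \<Longrightarrow> fls_nth f n = 0"
    by (auto simp: Hplus_def)
  then have "hcoeff x (- int (Suc n)) = 0" for n
    by (simp add: hcoeff.abs_eq del: of_nat_Suc)
  then show ?thesis unfolding polar_def by (simp only: PConst_0) simp
qed

lemma hcoeff_hbasis: "hcoeff (hbasis i) j = (if i = j \<and> j \<noteq> 0 then 1 else 0)"
  by (simp add: hbasis_def hcoeff.abs_eq)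

lemma HplusI:
  assumes "\<And>n. n < 0 \<Longrightarrow> hcoeff x n = 0"
  shows "x \<in> Hplus"
proof -
  define f where "f = rep_hp x - fls_const (fls_nth (rep_hp x) 0)"
  have x: "x = hclass (rep_hp x)" by (rule Quotient_abs_rep[OF Quotient_hp, symmetric])
  also have "\<dots> = hclass f" by (auto simp: hp.abs_eq_iff f_def)
  finally have "x = hclass f" .
  moreover have "fls_nth f n = 0" if "n \<le> 0" for n
  proof (cases "n = 0")
    case False
    then have "hcoeff x n = fls_nth f n" using \<open>x = hclass f\<close> by (simp add: hcoeff.abs_eq)
    then show ?thesis using assms[of n] that False by simp
  qed (simp add: f_def)
  ultimately show ?thesis by (auto simp: Hplus_def)
qed

lemma hcoeff_sum: "hcoeff (sum h A) n = (\<Sum>i\<in>A. hcoeff (h i) n)"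
  by (induction A rule: infinite_finite_induct) simp_all

lemma fock_act_polar:
  assumes "g \<in> SpPlus_full"
  shows "fock_act g (polar f) = polar (g f)"
proof -
  let ?S = "{n. hcoeff f (- int (Suc n)) \<noteq> 0}"
  define p where "p = (\<Sum>n\<in>?S. hscale (hcoeff f (- int (Suc n))) (hbasis (- int (Suc n))))"
  have g: "g (x + y) = g x + g y" "g (hscale c x) = hscale c (g x)" "g ` Hplus = Hplus" for x y c
    using assms by (auto simp: SpPlus_full_def)
  have g0: "g 0 = 0" using g(1)[of 0 0] by simp
  have gsum: "g (sum h A) = (\<Sum>i\<in>A. g (h i))" for h :: "nat \<Rightarrow> hp" and A
    by (induction A rule: infinite_finite_induct) (simp_all add: g g0)
  have psum: "polar (sum h A) = (\<Sum>i\<in>A. polar (h i))" for h :: "nat \<Rightarrow> hp" and A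
    by (induction A rule: infinite_finite_induct)
      (simp_all add: polar_add, simp_all add: polar_def)
  have "f - p \<in> Hplus"
  proof (rule HplusI)
    fix k :: int
    assume "k < 0"
    then have k: "k = - int (Suc n)" if "n = nat (- k) - 1" for n
      using that by simp
    define n where "n = nat (- k) - 1"
    note k = k[OF n_def]
    have "hcoeff p k = (\<Sum>m\<in>?S. if n = m then hcoeff f (- int (Suc m)) else 0)"
      unfolding p_def hcoeff_sum
    proof (rule sum.cong)
      fix m
      have "(- int (Suc m) = k) = (n = m)" "k \<noteq> 0" by (auto simp: k)
      then show "hcoeff (hscale (hcoeff f (- int (Suc m))) (hbasis (- int (Suc m)))) k =
          (if n = m then hcoeff f (- int (Suc m)) else 0)"
        by (simp only: hcoeff_linear hcoeff_hbasis) simp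
    qed simp
    also have "\<dots> = hcoeff f k"
      unfolding k sum.delta'[OF finite_polar] by simp
    finally show "hcoeff (f - p) k = 0" by simp
  qed
  then have "polar (g (f - p)) = 0" using g(3) by (intro polar_Hplus) blast
  moreover have "g f = g (f - p) + g p" using g(1)[of "f - p" p] by simp
  ultimately have "polar (g f) = polar (g p)" by (simp add: polar_add)
  also have "\<dots> = (\<Sum>n\<in>?S. PConst (hcoeff f (- int (Suc n))) * polar (g (hbasis (- int (Suc n)))))"
    by (simp only: p_def gsum psum g(2) polar_hscale)
  also have "\<dots> = fock_act g (polar f)"
    by (simp only: fock_act_def polar_def[of f] psubst_sum psubst_mult psubst_PConst psubst_PVar)
  finally show ?thesis by simp
qed

lemma fock_act_heis:
  assumes "g \<in> SpPlus_full"
  shows "fock_act g (heis N \<alpha> f v) = heis N \<alpha> (g f) (fock_act g v)"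
  by (simp add: heis_def flip: fock_act_polar[OF assms])
    (simp add: fock_act_def psubst_mult psubst_PConst)

lemma fock_act_1: "fock_act g 1 = 1"
  using psubst_PConst[of "\<lambda>n. polar (g (hbasis (- int (Suc n))))" 1]
  by (simp add: fock_act_def PConst_def)


section \<open>The sheaf of coinvariants\<close>

text \<open>Sections of \<open>\<pi>\<^sup>0 \<otimes> O\<close> over \<open>U\<close> with finitely many coefficients.\<close>

definition fock_section :: "(complex^'n) set \<Rightarrow> (complex^'n \<Rightarrow> complex^'n \<Rightarrow> complex)
    \<Rightarrow> 'n pt set \<Rightarrow> ('n pt \<Rightarrow> fock) \<Rightarrow> bool" where
  "fock_section \<Lambda> B U \<sigma> \<longleftrightarrow> (\<exists>(n::nat) v f. (\<forall>k<n. holo \<Lambda> B U (f k)) \<and>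
     (\<forall>b\<in>U. \<sigma> b = (\<Sum>k<n. PConst (f k b) * v k)))"

text \<open>Sections over \<open>U\<close> of the tautological sheaf with fibre \<open>F\<close>.\<close>

definition taut_section :: "(complex^'n) set \<Rightarrow> (complex^'n \<Rightarrow> complex^'n \<Rightarrow> complex)
    \<Rightarrow> 'n pt set \<Rightarrow> ('n pt \<Rightarrow> hp) \<Rightarrow> bool" where
  "taut_section \<Lambda> B U f \<longleftrightarrow> (\<forall>b\<in>U. f b \<in> Fof (fst b)) \<and>
     (\<forall>m. holo \<Lambda> B U (\<lambda>b. hcoeff (f b) m)) \<and> (\<exists>M. \<forall>b\<in>U. \<forall>m<M. hcoeff (f b) m = 0)"

text \<open>Representatives of germs at \<open>p\<close> of the subsheaf \<open>\<h>\<^sup>o\<^sup>u\<^sup>t(\<pi>\<^sup>0 \<otimes> O)\<close>. The set contains all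
  functions that vanish near \<open>p\<close>, so the stalk at \<open>p\<close> of the quotient sheaf is the set of cosets
  \<open>\<sigma> +o out_germs N \<Lambda> B p\<close> with \<open>\<sigma>\<close> a section of \<open>\<pi>\<^sup>0 \<otimes> O\<close> near \<open>p\<close>.\<close>

definition out_germs :: "nat \<Rightarrow> (complex^'n) set \<Rightarrow> (complex^'n \<Rightarrow> complex^'n \<Rightarrow> complex)
    \<Rightarrow> 'n pt \<Rightarrow> ('n pt \<Rightarrow> fock) set" where
  "out_germs N \<Lambda> B p = {\<tau>. \<exists>U. openin (SpTop \<Lambda> B) U \<and> p \<in> U \<and>
     (\<exists>(n::nat) A f \<sigma>. (\<forall>k<n. taut_section \<Lambda> B U (f k) \<and> fock_section \<Lambda> B U (\<sigma> k)) \<and>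
        (\<forall>b\<in>U. \<tau> b = (\<Sum>k<n. heis N (A k) (f k b) (\<sigma> k b))))}"

text \<open>Global sections of the quotient sheaf, as sections of its etale space.\<close>

definition coinv_sections :: "nat \<Rightarrow> (complex^'n) set \<Rightarrow> (complex^'n \<Rightarrow> complex^'n \<Rightarrow> complex)
    \<Rightarrow> ('n pt \<Rightarrow> ('n pt \<Rightarrow> fock) set) set" where
  "coinv_sections N \<Lambda> B = {s \<in> extensional (Sp \<Lambda> B). \<forall>p\<in>Sp \<Lambda> B.
     \<exists>U \<sigma>. openin (SpTop \<Lambda> B) U \<and> p \<in> U \<and> fock_section \<Lambda> B U \<sigma> \<and>
       (\<forall>b\<in>U. s b = \<sigma> +o out_germs N \<Lambda> B b)}"

definition section_act :: "(hp \<Rightarrow> hp) \<Rightarrow> ('n pt \<Rightarrow> fock) \<Rightarrow> ('n pt \<Rightarrow> fock)" where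
  "section_act g \<sigma> = (\<lambda>b. fock_act g (\<sigma> (pt_act (inv g) b)))"

text \<open>The descent of the sheaf to \<open>[Sp(X,\<Theta>)/Sp\<^sup>+(H')]\<close> and to the point: the space of
  \<open>Sp\<^sup>+(H')\<close>-invariant global sections.\<close>

definition coinvariants :: "nat \<Rightarrow> (complex^'n) set \<Rightarrow> (complex^'n \<Rightarrow> complex^'n \<Rightarrow> complex)
    \<Rightarrow> ('n pt \<Rightarrow> ('n pt \<Rightarrow> fock) set) cspace" where
  "coinvariants N \<Lambda> B =
     \<lparr>carr = {s \<in> coinv_sections N \<Lambda> B. \<forall>g\<in>SpPlus. \<forall>p\<in>Sp \<Lambda> B. \<forall>\<sigma>\<in>s p.
        s (pt_act g p) = section_act g \<sigma> +o out_germs N \<Lambda> B (pt_act g p)},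
      vadd = (\<lambda>s s'. restrict (\<lambda>p. s p + s' p) (Sp \<Lambda> B)),
      vscale = (\<lambda>c s. restrict (\<lambda>p. (\<lambda>\<sigma> b. PConst c * \<sigma> b) ` s p + out_germs N \<Lambda> B p) (Sp \<Lambda> B))\<rparr>"

text \<open>The value of a section in the fibre \<open>\<pi>\<^sup>0/(\<h>\<^sub>\<Gamma> \<otimes> F)\<pi>\<^sup>0\<close> at \<open>p\<close> is the class of \<open>v\<close>.\<close>

definition fibre_value :: "nat \<Rightarrow> ('n pt \<Rightarrow> ('n pt \<Rightarrow> fock) set) \<Rightarrow> 'n pt \<Rightarrow> fock \<Rightarrow> bool" where
  "fibre_value N s p v \<longleftrightarrow> (\<forall>\<sigma>\<in>s p. \<sigma> p - v \<in> out_span N (Fof (fst p)))"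


section \<open>\<open>H\<^sup>0(X,\<Omega>\<^sup>1)\<close>, symmetric algebras and polynomial functions\<close>

text \<open>Holomorphic \<open>1\<close>-forms \<open>\<Sum>\<^sub>i \<omega>\<^sub>i dz\<^sub>i\<close> on \<open>\<complex>\<^sup>g/\<Lambda>\<close>.\<close>

definition H0_Omega :: "(complex^'n) set \<Rightarrow> (complex^'n \<Rightarrow> complex^'n) set" where
  "H0_Omega \<Lambda> = {\<omega>. (\<forall>z. \<exists>D. (\<omega> has_derivative D) (at z) \<and> (\<forall>c v. D (c *s v) = c *s D v)) \<and>
     (\<forall>z. \<forall>l\<in>\<Lambda>. \<omega> (z + l) = \<omega> z)}"

definition dual_space :: "('a \<Rightarrow> complex^'n) set \<Rightarrow> (('a \<Rightarrow> complex^'n) \<Rightarrow> complex) set" where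
  "dual_space U = {\<xi>. (\<forall>x. x \<notin> U \<longrightarrow> \<xi> x = 0) \<and> (\<forall>x\<in>U. \<forall>y\<in>U. \<xi> (x + y) = \<xi> x + \<xi> y) \<and>
     (\<forall>c. \<forall>x\<in>U. \<xi> (\<lambda>a. c *s x a) = c * \<xi> x)}"

text \<open>The canonical map from the Lie algebra \<open>\<complex>\<^sup>g\<close> of \<open>X\<close> to \<open>H\<^sup>0(X,\<Omega>\<^sup>1)\<^sup>*\<close>.\<close>

definition tangent_eval :: "(complex^'n) set \<Rightarrow> complex^'n \<Rightarrow> (complex^'n \<Rightarrow> complex^'n) \<Rightarrow> complex" where
  "tangent_eval \<Lambda> v = (\<lambda>\<omega>. if \<omega> \<in> H0_Omega \<Lambda> then \<Sum>i\<in>UNIV. vec_nth (\<omega> 0) i * vec_nth v i else 0)"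

text \<open>\<open>Sym(W)\<close> for a vector space \<open>W\<close> of complex-valued functions: polynomials in variables
  \<open>X\<^sub>w\<close>, \<open>w \<in> W\<close>, modulo the ideal generated by the linear relations among the \<open>X\<^sub>w\<close>.\<close>

definition sym_polys :: "('a \<Rightarrow> complex) set \<Rightarrow> ('a \<Rightarrow> complex) mpoly set" where
  "sym_polys W = {p. \<forall>m\<in>Poly_Mapping.keys p. Poly_Mapping.keys m \<subseteq> W}"

definition sym_rels :: "('a \<Rightarrow> complex) set \<Rightarrow> ('a \<Rightarrow> complex) mpoly set" where
  "sym_rels W = {PVar (x + y) - PVar x - PVar y | x y. x \<in> W \<and> y \<in> W} \<union>
     {PVar (\<lambda>a. c * x a) - PConst c * PVar x | c x. x \<in> W}"

definition sym_ideal :: "('a \<Rightarrow> complex) set \<Rightarrow> ('a \<Rightarrow> complex) mpoly set" where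
  "sym_ideal W = {(\<Sum>k<n. q k * r k) | (n::nat) q r. \<forall>k<n. q k \<in> sym_polys W \<and> r k \<in> sym_rels W}"

definition Sym :: "('a \<Rightarrow> complex) set \<Rightarrow> ('a \<Rightarrow> complex) mpoly set cspace" where
  "Sym W = \<lparr>carr = {p +o sym_ideal W | p. p \<in> sym_polys W},
     vadd = (+), vscale = (\<lambda>c A. (\<lambda>p. PConst c * p) ` A + sym_ideal W)\<rparr>"

text \<open>Polynomial functions on \<open>U\<close>, extended by \<open>0\<close> outside \<open>U\<close>.\<close>

inductive_set polynomial_functions :: "('a \<Rightarrow> complex^'n) set \<Rightarrow> (('a \<Rightarrow> complex^'n) \<Rightarrow> complex) set"
  for U where
  const: "(\<lambda>x. if x \<in> U then c else 0) \<in> polynomial_functions U"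
| lin: "\<xi> \<in> dual_space U \<Longrightarrow> \<xi> \<in> polynomial_functions U"
| add: "f \<in> polynomial_functions U \<Longrightarrow> h \<in> polynomial_functions U \<Longrightarrow>
    (\<lambda>x. f x + h x) \<in> polynomial_functions U"
| mult: "f \<in> polynomial_functions U \<Longrightarrow> h \<in> polynomial_functions U \<Longrightarrow>
    (\<lambda>x. f x * h x) \<in> polynomial_functions U"

definition Fun :: "('a \<Rightarrow> complex^'n) set \<Rightarrow> (('a \<Rightarrow> complex^'n) \<Rightarrow> complex) cspace" where
  "Fun U = \<lparr>carr = polynomial_functions U, vadd = (\<lambda>f h x. f x + h x), vscale = (\<lambda>c f x. c * f x)\<rparr>"

end

theory Submission
  imports Defs "HOL-Complex_Analysis.Cauchy_Integral_Formula"
begin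

text \<open>At a point \<open>(Z,F,L)\<close> with marking \<open>\<phi> : Z/F \<cong> \<complex>\<^sup>g\<close>, the level \<open>0\<close> Fock module is
  \<open>Sym(H'/H'\<^sub>+) = Sym(Z)\<close>, since \<open>H' = Z \<oplus> H'\<^sub>+\<close>, and its coinvariants are \<open>Sym(Z/F) = \<complex>[X\<^sub>1,\<dots>,X\<^sub>g]\<close>. The
  quotient map is an evaluation map \<open>ev\<close> whose values on the generators are coordinates of the point; so it is
  holomorphic. Its kernel is locally generated by sections of \<open>F\<close> (\<open>out_germs_iff\<close>), because
  \<open>Z/F\<close> has local holomorphic frames (\<open>local_frame\<close>). Hence a section of the quotient sheaf is
  the same as a holomorphic family of polynomials.

  Evaluation is equivariant (\<open>ev_equivariant\<close>), so an invariant section is a family of polynomials that is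
  constant on orbits of \<open>Sp\<^sup>+(H')\<close>. The group acts transitively (\<open>Sp_transitive\<close>) and there is at least one
  point (\<open>Sp_nonempty\<close>); thus invariant sections are polynomials (\<open>carr_coinvariants\<close>). Conversely a
  constant family is an invariant section: the group acts by affine maps in coordinates
  (\<open>coord_pt_act\<close>), so it preserves holomorphy.

  For transitivity, a point has to be described by independent data. Conjugation for the real
  structure \<open>L\<^sub>\<real>\<close> exchanges the components in \<open>Z/F\<close> and \<open>F\<^sup>\<bottom>\<^sub>+\<close> of a lattice vector, and \<open>B\<close> expresses
  conjugation through the symplectic form. Therefore \<open>L\<close> is determined by \<open>Z\<close>, \<open>\<phi>\<close>, \<open>\<Lambda>\<close> and \<open>B\<close>
  (\<open>Sp_cases\<close>), and conversely every Lagrangian complement \<open>Z\<close> of \<open>H'\<^sub>+\<close> with a linear surjection \<open>\<phi>\<close> to \<open>\<complex>\<^sup>g\<close>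
  gives a point (\<open>mk_pt_in_Sp\<close>). Any two such pairs are related by a product of three exponentials \<open>1 + T\<close>
  with \<open>T \<in> sp\<^sup>+(H')\<close> and \<open>T\<^sup>2 = 0\<close> (\<open>SpPlus_transitive\<close>): the first moves the complement, the
  other two the surjection. Such products lie in the identity component.

  Finally, by Liouville's theorem holomorphic \<open>1\<close>-forms on the torus are constant (\<open>H0_Omega_eq\<close>), so that
  \<open>H\<^sup>0(X,\<Omega>\<^sup>1)\<^sup>*\<close> is \<open>\<complex>\<^sup>g\<close>, and \<open>\<complex>[X\<^sub>1,\<dots>,X\<^sub>g]\<close> is both its symmetric algebra (\<open>lin_iso_Sym\<close>) and the ring of
  polynomial functions on \<open>H\<^sup>0(X,\<Omega>\<^sup>1)\<close> (\<open>lin_iso_Fun\<close>).\<close>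

unbundle fps_syntax

section \<open>Laurent tails and the symplectic form\<close>

lemma hcoeff_uminus [simp]: "hcoeff (- x) n = - hcoeff x n"
  by transfer simp

lemma hcoeff_zero_index [simp]: "hcoeff x 0 = 0"
  by transfer simp

lemma hp_eqI:
  assumes "\<And>n. hcoeff x n = hcoeff y n"
  shows "x = y"
  using assms
proof transfer
  fix f g :: "complex fls"
  assume *: "\<And>n. (if n = 0 then 0 else fls_nth f n) = (if n = 0 then 0 else fls_nth g n)"
  have "f - g = fls_const (fls_nth f 0 - fls_nth g 0)"
  proof (rule fls_eqI)
    fix n
    show "(f - g) $$ n = fls_const (fls_nth f 0 - fls_nth g 0) $$ n"
      using *[of n] by (cases "n = 0") auto
  qed
  then show "\<exists>c. f - g = fls_const c" by blast
qed

lemma hp_rep: "\<exists>f. x = hclass f \<and> (\<forall>n. hcoeff x n = f $$ n)"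
proof -
  define f where "f = rep_hp x - fls_const (rep_hp x $$ 0)"
  have "x = hclass (rep_hp x)" by (rule Quotient_abs_rep[OF Quotient_hp, symmetric])
  also have eq: "\<dots> = hclass f" by (auto simp: hp.abs_eq_iff f_def)
  finally have x: "x = hclass f" .
  have "hcoeff (hclass f) n = f $$ n" for n
    by (simp add: hcoeff.abs_eq) (simp add: f_def)
  then show ?thesis using x by metis
qed

lemma hcoeff_bounded_below: "\<exists>M. \<forall>n<M. hcoeff x n = 0"
  by transfer (metis fls_eq0_below_subdegree)

text \<open>The neighbourhoods \<open>t\<^sup>K \<complex>[[t]]\<close> of \<open>0\<close> in \<open>H'\<close>.\<close>

definition hord :: "int \<Rightarrow> hp set" where
  "hord K = {x. \<forall>n<K. hcoeff x n = 0}"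

lemma hordD: "x \<in> hord K \<Longrightarrow> n < K \<Longrightarrow> hcoeff x n = 0"
  by (simp add: hord_def)

lemma hord_mono: "K \<le> K' \<Longrightarrow> hord K' \<subseteq> hord K"
  by (auto simp: hord_def)

lemma Hplus_eq_hord: "Hplus = hord 0"
proof
  show "Hplus \<subseteq> hord 0"
    by (auto simp: Hplus_def hord_def hcoeff.abs_eq)
  show "hord 0 \<subseteq> Hplus"
    by (auto simp: hord_def intro: HplusI)
qed

lemma hord_1: "hord 1 = Hplus"
proof -
  have "n < 1 \<longleftrightarrow> n < 0 \<or> n = 0" for n :: int by auto
  then show ?thesis by (auto simp: Hplus_eq_hord hord_def)
qed

lemma Hplus_iff: "x \<in> Hplus \<longleftrightarrow> (\<forall>n<0. hcoeff x n = 0)"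
  by (simp add: Hplus_eq_hord hord_def)

lemma Hplus_subspace: "H'.subspace Hplus"
  by (rule H'.subspaceI) (auto simp: Hplus_iff)

lemma hord_exists: "\<exists>M. x \<in> hord M"
  using hcoeff_bounded_below[of x] by (auto simp: hord_def)

lemma ex_Hplus_coeffs: "\<exists>h\<in>Hplus. \<forall>k>0. hcoeff h k = c (nat k)"
proof -
  define f where "f = fps_to_fls (Abs_fps (\<lambda>n. if n = 0 then 0 else c n))"
  have "hclass f \<in> Hplus"
    by (auto simp: Hplus_iff hcoeff.abs_eq f_def)
  moreover have "hcoeff (hclass f) k = c (nat k)" if "k > 0" for k
    using that by (auto simp: hcoeff.abs_eq f_def)
  ultimately show ?thesis by blast
qed

lemma hform_add_left: "hform (x + y) z = hform x z + hform y z"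
  by transfer (simp add: distrib_right fls_residue_add)

lemma hform_scale_left: "hform (hscale c x) z = c * hform x z"
  by transfer (simp add: mult.assoc fls_residue_fls_const_times)

lemma hform_antisym: "hform x y = - hform y x"
proof transfer
  fix f g :: "complex fls"
  have "fls_residue (f * fls_deriv g) = - fls_residue (fls_deriv f * g)"
    using fls_residue_times_deriv[of f g] by (simp add: mult.commute)
  then show "- fls_residue (f * fls_deriv g) = - (- fls_residue (g * fls_deriv f))"
    by (simp add: mult.commute)
qed

lemma hform_add_right: "hform z (x + y) = hform z x + hform z y"
  using hform_antisym[of z] hform_add_left[of x y z] by simp

lemma hform_scale_right: "hform z (hscale c x) = c * hform z x"
  using hform_antisym[of z] hform_scale_left[of c x z] by simp

lemma hform_zero [simp]: "hform 0 x = 0" "hform x 0 = 0"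
  using hform_scale_left[of 0 0 x] hform_scale_right[of x 0 0] by simp_all

lemma hform_uminus: "hform (- x) y = - hform x y" "hform x (- y) = - hform x y"
  using hform_add_left[of x "- x" y] hform_add_right[of x y "- y"] by (simp_all add: eq_neg_iff_add_eq_0 add.commute)

lemma hform_diff: "hform (x - y) z = hform x z - hform y z" "hform z (x - y) = hform z x - hform z y"
  using hform_add_left[of x "- y" z] hform_add_right[of z x "- y"] by (simp_all add: hform_uminus)

lemma hform_sum_left: "hform (sum f A) y = (\<Sum>i\<in>A. hform (f i) y)"
  by (induction A rule: infinite_finite_induct) (simp_all add: hform_add_left)

lemma hform_sum_right: "hform y (sum f A) = (\<Sum>i\<in>A. hform y (f i))"
  by (induction A rule: infinite_finite_induct) (simp_all add: hform_add_right)

lemmas hform_linear = hform_add_left hform_add_right hform_scale_left hform_scale_right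
  hform_uminus hform_diff hform_sum_left hform_sum_right

lemma hform_hbasis: "hform x (hbasis k) = - of_int k * hcoeff x (- k)"
proof -
  obtain f where x: "x = hclass f" and xf: "\<And>n. hcoeff x n = f $$ n" using hp_rep by meson
  have "fls_deriv (fls_X_intpow k :: complex fls) = fls_const (of_int k) * fls_X_intpow (k - 1)"
  proof (rule fls_eqI)
    fix n
    show "fls_deriv (fls_X_intpow k :: complex fls) $$ n = (fls_const (of_int k) * fls_X_intpow (k - 1)) $$ n"
      by (cases "n = k - 1") auto
  qed
  moreover have "fls_residue (f * (fls_const (of_int k) * fls_X_intpow (k - 1))) = of_int k * fls_nth f (- k)"
  proof -
    have "f * (fls_const (of_int k) * fls_X_intpow (k - 1)) = fls_const (of_int k) * (f * fls_X_intpow (k - 1))"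
      by (rule mult.left_commute)
    then show ?thesis
      by (simp only: fls_residue_fls_const_times fls_X_intpow_times_conv_shift(2)) simp
  qed
  ultimately have "hform x (hbasis k) = - (of_int k * fls_nth f (- k))"
    unfolding x hbasis_def hform.abs_eq by simp
  then show ?thesis by (simp add: xf)
qed

lemma hform_hord:
  assumes "x \<in> hord M" "y \<in> hord K" "M + K > 0"
  shows "hform x y = 0"
proof -
  obtain f g where x: "x = hclass f" "\<And>n. hcoeff x n = f $$ n" and y: "y = hclass g" "\<And>n. hcoeff y n = g $$ n"
    using hp_rep by meson
  have f0: "f $$ n = 0" if "n < M" for n
    using hordD[OF assms(1) that] by (simp add: x(2))
  have g0: "g $$ n = 0" if "n < K" for n
    using hordD[OF assms(2) that] by (simp add: y(2))
  have "fls_residue (f * fls_deriv g) = 0"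
  proof (cases "f = 0 \<or> fls_deriv g = 0")
    case False
    then have "M \<le> fls_subdegree f" "K - 1 \<le> fls_subdegree (fls_deriv g)"
      by (auto intro!: fls_subdegree_geI f0 g0)
    with assms(3) show ?thesis
      by (simp add: fls_residue_def fls_times_nth_eq0)
  qed auto
  then show ?thesis by (simp add: x(1) y(1) hform.abs_eq)
qed

lemma hform_Hplus: "x \<in> Hplus \<Longrightarrow> y \<in> Hplus \<Longrightarrow> hform x y = 0"
  using hform_hord[of x 1 y 1] by (simp add: hord_1)

lemma hord_truncate:
  assumes "x \<in> hord M"
  shows "x - (\<Sum>k\<in>{M..<K}. hscale (hcoeff x k) (hbasis k)) \<in> hord K"
  unfolding hord_def
proof (intro CollectI allI impI)
  fix n assume n: "n < K"
  have "(\<Sum>k\<in>{M..<K}. hcoeff x k * hcoeff (hbasis k) n) =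
      (\<Sum>k\<in>{M..<K}. if k = n then hcoeff x n else 0)"
    by (rule sum.cong) (auto simp: hcoeff_hbasis)
  also have "\<dots> = hcoeff x n"
    using n hordD[OF assms, of n] by (auto simp: sum.delta')
  finally show "hcoeff (x - (\<Sum>k\<in>{M..<K}. hscale (hcoeff x k) (hbasis k))) n = 0"
    by (simp add: hcoeff_sum)
qed

definition polar_supp :: "hp \<Rightarrow> nat set" where
  "polar_supp x = {n. hcoeff x (- int (Suc n)) \<noteq> 0}"

lemma finite_polar_supp: "finite (polar_supp x)"
  using finite_polar[of x] by (simp add: polar_supp_def)

lemma polar_part:
  "x - (\<Sum>n\<in>polar_supp x. hscale (hcoeff x (- int (Suc n))) (hbasis (- int (Suc n)))) \<in> Hplus"
  unfolding Hplus_iff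
proof (intro allI impI)
  fix k :: int assume k: "k < 0"
  define n where "n = nat (- k) - 1"
  have kn: "k = - int (Suc n)" using k by (simp add: n_def)
  have eq: "hcoeff (hscale (hcoeff x (- int (Suc m))) (hbasis (- int (Suc m)))) k =
      (if n = m then hcoeff x k else 0)" for m
    unfolding kn by (auto simp: hcoeff_hbasis)
  have "(\<Sum>m\<in>polar_supp x. if n = m then hcoeff x k else 0) = hcoeff x k"
    using finite_polar_supp[of x] by (auto simp: polar_supp_def kn)
  then show "hcoeff (x - (\<Sum>n\<in>polar_supp x. hscale (hcoeff x (- int (Suc n))) (hbasis (- int (Suc n))))) k = 0"
    by (simp only: hcoeff_linear(4) hcoeff_sum eq) simp
qed

definition hlinear :: "(hp \<Rightarrow> hp) \<Rightarrow> bool" where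
  "hlinear g \<longleftrightarrow> (\<forall>x y. g (x + y) = g x + g y) \<and> (\<forall>c x. g (hscale c x) = hscale c (g x))"

definition flinear :: "(hp \<Rightarrow> complex) \<Rightarrow> bool" where
  "flinear l \<longleftrightarrow> (\<forall>x y. l (x + y) = l x + l y) \<and> (\<forall>c x. l (hscale c x) = c * l x)"

lemma hlinearD:
  assumes "hlinear g"
  shows "g (x + y) = g x + g y" "g (hscale c x) = hscale c (g x)" "g 0 = 0" "g (- x) = - g x"
    "g (x - y) = g x - g y" "g (sum h A) = (\<Sum>i\<in>A. g (h i))"
proof -
  note lin = assms[unfolded hlinear_def]
  show add: "g (x + y) = g x + g y" and "g (hscale c x) = hscale c (g x)" for x y
    using lin by auto
  show 0: "g 0 = 0" using add[of 0 0] by simp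
  show minus: "g (- x) = - g x" for x using add[of x "- x"] 0 by (simp add: eq_neg_iff_add_eq_0 add.commute)
  show "g (x - y) = g x - g y" using add[of x "- y"] minus by simp
  show "g (sum h A) = (\<Sum>i\<in>A. g (h i))"
    by (induction A rule: infinite_finite_induct) (simp_all add: add 0)
qed

lemma flinearD:
  assumes "flinear l"
  shows "l (x + y) = l x + l y" "l (hscale c x) = c * l x" "l 0 = 0" "l (- x) = - l x"
    "l (x - y) = l x - l y" "l (sum h A) = (\<Sum>i\<in>A. l (h i))"
proof -
  note lin = assms[unfolded flinear_def]
  show add: "l (x + y) = l x + l y" and "l (hscale c x) = c * l x" for x y
    using lin by auto
  show 0: "l 0 = 0" using add[of 0 0] by simp
  show minus: "l (- x) = - l x" for x using add[of x "- x"] 0 by (simp add: eq_neg_iff_add_eq_0 add.commute)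
  show "l (x - y) = l x - l y" using add[of x "- y"] minus by simp
  show "l (sum h A) = (\<Sum>i\<in>A. l (h i))"
    by (induction A rule: infinite_finite_induct) (simp_all add: add 0)
qed

lemma flinear_eqI:
  assumes "flinear l" "flinear l'" "\<And>h. h \<in> Hplus \<Longrightarrow> l h = l' h"
    "\<And>n. l (hbasis (- int (Suc n))) = l' (hbasis (- int (Suc n)))"
  shows "l x = l' x"
proof -
  let ?s = "\<Sum>n\<in>polar_supp x. hscale (hcoeff x (- int (Suc n))) (hbasis (- int (Suc n)))"
  have "l (x - ?s) = l' (x - ?s)" by (intro assms(3) polar_part)
  moreover have "l ?s = l' ?s"
    by (simp only: flinearD(6)[OF assms(1)] flinearD(6)[OF assms(2)]
      flinearD(2)[OF assms(1)] flinearD(2)[OF assms(2)] assms(4))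
  ultimately show ?thesis
    using flinearD(5)[OF assms(1), of x ?s] flinearD(5)[OF assms(2), of x ?s] by simp
qed

text \<open>\<open>H'\<^sub>+\<close> is the full algebraic dual of \<open>H'/H'\<^sub>+\<close>: a functional on \<open>t\<^sup>-\<^sup>1\<complex>[t\<^sup>-\<^sup>1]\<close> is an arbitrary
  sequence of values on the powers of \<open>t\<close>, and a power series has arbitrary coefficients.\<close>

lemma functional_rep:
  assumes "flinear l" "\<And>h. h \<in> Hplus \<Longrightarrow> l h = 0"
  shows "\<exists>h\<in>Hplus. \<forall>x. hform h x = l x"
proof -
  obtain h where h: "h \<in> Hplus" and hc: "\<And>k. k > 0 \<Longrightarrow> hcoeff h k = l (hbasis (- int (nat k))) / of_nat (nat k)"
    using ex_Hplus_coeffs[of "\<lambda>k. l (hbasis (- int k)) / of_nat k"] by blast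
  have "hform h x = l x" for x
  proof (rule flinear_eqI[of "hform h"])
    show "flinear (hform h)" by (simp add: flinear_def hform_linear)
    show "hform h x = l x" if "x \<in> Hplus" for x
      using that assms(2) h hform_Hplus by simp
    show "hform h (hbasis (- int (Suc n))) = l (hbasis (- int (Suc n)))" for n
    proof -
      have "hcoeff h (int (Suc n)) = l (hbasis (- int (Suc n))) / of_nat (Suc n)"
        using hc[of "int (Suc n)"] by (simp only: nat_int of_nat_0_less_iff zero_less_Suc)
      moreover have "(of_nat (Suc n) :: complex) \<noteq> 0" by (simp only: of_nat_eq_0_iff)
      ultimately have "of_nat (Suc n) * hcoeff h (int (Suc n)) = l (hbasis (- int (Suc n)))"
        by (metis nonzero_mult_div_cancel_left times_divide_eq_right)
      then show ?thesis by (simp only: hform_hbasis minus_minus of_int_minus of_int_of_nat_eq)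
    qed
  qed fact
  with h show ?thesis by blast
qed

section \<open>The topology of \<open>H'\<close>\<close>

lemma dist_fls_less_imp_nth_eq:
  fixes f g :: "complex fls"
  assumes "dist f g < inverse (2 ^ m)" "k \<le> int m"
  shows "f $$ k = g $$ k"
proof (cases "f = g")
  case False
  let ?d = "fls_subdegree (f - g)"
  have "?d > int m"
  proof (cases "?d \<ge> 0")
    case True
    then have "inverse (2 ^ nat ?d) < (inverse (2 ^ m) :: real)"
      using assms(1) False by (simp add: dist_fls_def)
    then have "(2::real) ^ m < 2 ^ nat ?d" by (simp add: inverse_less_iff_less)
    then have "m < nat ?d" by simp
    then show ?thesis by linarith
  next
    case neg: False
    then have "(2::real) ^ nat (- ?d) < inverse (2 ^ m)"
      using assms(1) False by (simp add: dist_fls_def)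
    moreover have "(1::real) \<le> 2 ^ nat (- ?d)" "inverse (2 ^ m) \<le> (1::real)"
      by (simp_all add: inverse_le_1_iff)
    ultimately show ?thesis by linarith
  qed
  then have "(f - g) $$ k = 0" using assms(2) by (intro fls_eq0_below_subdegree) simp
  then show ?thesis by simp
qed simp

lemma dist_fls_lessI:
  fixes f g :: "complex fls"
  assumes "\<And>k. k < int m \<Longrightarrow> f $$ k = g $$ k" "inverse (2 ^ m) < e"
  shows "dist f g < e"
proof (cases "f = g")
  case True
  have "(0::real) < inverse (2 ^ m)" by simp
  then have "0 < e" using assms(2) by (rule less_trans)
  with True show ?thesis by simp
next
  case False
  then have "int m \<le> fls_subdegree (f - g)"
    by (intro fls_subdegree_geI) (auto simp: assms(1))
  moreover then have "inverse (2 ^ nat (fls_subdegree (f - g))) \<le> (inverse (2 ^ m) :: real)"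
    by (intro le_imp_inverse_le power_increasing) auto
  ultimately have "inverse (2 ^ nat (fls_subdegree (f - g))) < e" using assms(2) by linarith
  with False \<open>int m \<le> _\<close> show ?thesis by (simp add: dist_fls_def)
qed

lemma open_hp_nbhd:
  fixes V :: "hp set"
  assumes "open V" "x \<in> V"
  shows "\<exists>K. \<forall>y\<in>hord K. x + y \<in> V"
proof -
  have "open (hclass -` V)" using assms(1) by (simp add: open_hp_def)
  moreover have x: "hclass (rep_hp x) = x" by (rule Quotient_abs_rep[OF Quotient_hp])
  ultimately obtain e where e: "e > 0" "\<And>f. dist f (rep_hp x) < e \<Longrightarrow> hclass f \<in> V"
    using assms(2) unfolding open_dist by (metis vimageD vimageI)
  obtain m where m: "inverse (2 ^ m) < e"
    using real_arch_pow_inv[of e "1/2"] e(1) by (auto simp: power_one_over inverse_eq_divide)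
  have "x + y \<in> V" if y: "y \<in> hord (int m)" for y
  proof -
    obtain f where yf: "y = hclass f" "\<And>n. hcoeff y n = f $$ n" using hp_rep by meson
    have f0: "f $$ k = 0" if "k < int m" for k
      using hordD[OF y that] by (simp add: yf(2))
    have "dist (rep_hp x + f) (rep_hp x) < e"
      by (rule dist_fls_lessI[OF _ m]) (simp add: f0)
    then have "hclass (rep_hp x + f) \<in> V" by (rule e(2))
    then show ?thesis unfolding plus_hp.abs_eq[symmetric] x yf(1)[symmetric] .
  qed
  then show ?thesis by blast
qed

lemma open_hord: "open (hord K)"
  unfolding open_hp_def open_dist
proof (intro ballI)
  fix f assume f: "f \<in> hclass -` hord K"
  have "g \<in> hclass -` hord K" if "dist g f < inverse (2 ^ nat K)" for g
  proof -
    have "g $$ k = f $$ k" if "k < K" for k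
      using dist_fls_less_imp_nth_eq[OF \<open>dist g f < _\<close>, of k] that by linarith
    then show ?thesis using f by (auto simp: hord_def hcoeff.abs_eq)
  qed
  then show "\<exists>e>0. \<forall>y. dist y f < e \<longrightarrow> y \<in> hclass -` hord K"
    by (intro exI[of _ "inverse (2 ^ nat K)"]) auto
qed

text \<open>For linear maps continuity is a condition at \<open>0\<close>.\<close>

definition tcont :: "(hp \<Rightarrow> hp) \<Rightarrow> bool" where
  "tcont g \<longleftrightarrow> (\<forall>J. \<exists>K. g ` hord K \<subseteq> hord J)"

lemma hord_zero [simp]: "0 \<in> hord K"
  by (simp add: hord_def)

lemma continuous_imp_tcont:
  assumes "continuous_on UNIV g" "hlinear g"
  shows "tcont g"
  unfolding tcont_def
proof
  fix J
  have "open (g -` hord J)"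
    using assms(1) open_hord[of J] by (simp add: continuous_on_open_vimage)
  moreover have "0 \<in> g -` hord J" using hlinearD(3)[OF assms(2)] by simp
  ultimately obtain K where "\<forall>y\<in>hord K. 0 + y \<in> g -` hord J" using open_hp_nbhd by blast
  then show "\<exists>K. g ` hord K \<subseteq> hord J" by auto
qed

lemma open_hp_iff: "open V \<longleftrightarrow> (\<forall>x\<in>V. \<exists>K. \<forall>y\<in>hord K. x + y \<in> V)"
proof
  show "\<forall>x\<in>V. \<exists>K. \<forall>y\<in>hord K. x + y \<in> V" if "open V"
    using open_hp_nbhd[OF that] by blast
next
  assume V: "\<forall>x\<in>V. \<exists>K. \<forall>y\<in>hord K. x + y \<in> V"
  show "open V"
    unfolding open_hp_def open_dist
  proof (intro ballI)
    fix f assume "f \<in> hclass -` V"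
    then have "hclass f \<in> V" by simp
    with V obtain K where K: "\<And>y. y \<in> hord K \<Longrightarrow> hclass f + y \<in> V" by meson
    have "g \<in> hclass -` V" if "dist g f < inverse (2 ^ nat K)" for g
    proof -
      have "g $$ k = f $$ k" if "k < K" for k
        using dist_fls_less_imp_nth_eq[OF \<open>dist g f < _\<close>, of k] that by linarith
      then have "hclass (g - f) \<in> hord K" by (auto simp: hord_def hcoeff.abs_eq)
      then have "hclass f + hclass (g - f) \<in> V" by (rule K)
      then show ?thesis by (simp add: plus_hp.abs_eq)
    qed
    then show "\<exists>e>0. \<forall>y. dist y f < e \<longrightarrow> y \<in> hclass -` V"
      by (intro exI[of _ "inverse (2 ^ nat K)"]) auto
  qed
qed

lemma tcont_imp_continuous:
  assumes "tcont g" "hlinear g"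
  shows "continuous_on UNIV g"
  unfolding continuous_on_open_vimage[OF open_UNIV]
proof (intro allI impI)
  fix V :: "hp set" assume "open V"
  have *: "\<exists>K. \<forall>y\<in>hord K. x + y \<in> g -` V" if gx: "g x \<in> V" for x
  proof -
    obtain J where J: "\<And>y. y \<in> hord J \<Longrightarrow> g x + y \<in> V"
      using open_hp_nbhd[OF \<open>open V\<close> gx] by blast
    obtain K where K: "g ` hord K \<subseteq> hord J" using assms(1) unfolding tcont_def by meson
    have "x + y \<in> g -` V" if "y \<in> hord K" for y
      using J[of "g y"] K that hlinearD(1)[OF assms(2), of x y] by auto
    then show ?thesis by blast
  qed
  show "open (g -` V \<inter> UNIV)"
    unfolding Int_UNIV_right
  proof (rule open_hp_iff[THEN iffD2], rule ballI)
    fix x assume "x \<in> g -` V"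
    then show "\<exists>K. \<forall>y\<in>hord K. x + y \<in> g -` V" by (intro *) simp
  qed
qed

unbundle no fps_syntax

section \<open>Lagrangian complements of \<open>H'\<^sub>+\<close>\<close>

definition lagrangian_complement :: "hp set \<Rightarrow> bool" where
  "lagrangian_complement Z \<longleftrightarrow> lagrangian Z \<and> Z \<inter> Hplus = {0}"

lemma lagrangian_complementD:
  assumes "lagrangian_complement Z"
  shows "H'.subspace Z" "perp Z = Z" "\<And>x. x \<in> Z \<Longrightarrow> x \<in> Hplus \<Longrightarrow> x = 0"
    "\<And>x y. x \<in> Z \<Longrightarrow> y \<in> Z \<Longrightarrow> hform x y = 0"
proof -
  show "H'.subspace Z" and pZ: "perp Z = Z" and "\<And>x. x \<in> Z \<Longrightarrow> x \<in> Hplus \<Longrightarrow> x = 0"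
    using assms by (auto simp: lagrangian_complement_def lagrangian_def)
  show "hform x y = 0" if "x \<in> Z" "y \<in> Z" for x y
    using that pZ by (auto simp: perp_def)
qed

lemmas hp_subspace_closed = H'.subspace_add H'.subspace_scale H'.subspace_0 H'.subspace_neg
  H'.subspace_diff H'.subspace_sum

text \<open>A Lagrangian subspace that meets \<open>H'\<^sub>+\<close> trivially is a complement: a functional that
  vanishes on \<open>Z + H'\<^sub>+\<close> is the pairing with an element of \<open>H'\<^sub>+\<close> by \<open>functional_rep\<close>, and this
  element is orthogonal to \<open>Z\<close>, hence lies in \<open>Z \<inter> H'\<^sub>+\<close>.\<close>

lemma complement_spans:
  assumes "lagrangian_complement Z"
  shows "\<exists>z\<in>Z. x - z \<in> Hplus"
proof (rule ccontr)
  assume no: "\<not> (\<exists>z\<in>Z. x - z \<in> Hplus)"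
  note Z = lagrangian_complementD[OF assms]
  define W where "W = {z + h |z h. z \<in> Z \<and> h \<in> Hplus}"
  have W: "H'.subspace W"
  proof (rule H'.subspaceI)
    show "0 \<in> W" unfolding W_def
      by (intro CollectI exI[of _ 0]) (simp add: H'.subspace_0 Z(1) Hplus_subspace)
    fix u v assume "u \<in> W" "v \<in> W"
    then obtain z h z' h' where *: "u = z + h" "v = z' + h'" "z \<in> Z" "z' \<in> Z" "h \<in> Hplus" "h' \<in> Hplus"
      by (auto simp: W_def)
    then have "u + v = (z + z') + (h + h')" by simp
    with * show "u + v \<in> W" unfolding W_def
      using H'.subspace_add[OF Z(1)] H'.subspace_add[OF Hplus_subspace] by blast
    fix c
    have "hscale c u = hscale c z + hscale c h" by (simp add: * H'.scale_right_distrib)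
    with * show "hscale c u \<in> W" unfolding W_def
      using H'.subspace_scale[OF Z(1)] H'.subspace_scale[OF Hplus_subspace] by blast
  qed
  have xW: "x \<notin> W"
    using no by (auto simp: W_def)
  obtain C where C: "C \<subseteq> W" "\<not> H'.dependent C" "W \<subseteq> H'.span C"
    using H'.basis_exists[of W] by metis
  then have span: "H'.span C = W" by (simp add: W H'.span_subspace)
  then have ind: "\<not> H'.dependent (insert x C)"
    using C xW by (intro H'.independent_insertI) auto
  interpret VP: vector_space_pair hscale "(*) :: complex \<Rightarrow> complex \<Rightarrow> complex"
    by unfold_locales
  obtain l where l: "Vector_Spaces.linear hscale (*) l" "\<And>y. y \<in> insert x C \<Longrightarrow> l y = (if y = x then 1 else 0)"
    using VP.linear_independent_extend[OF ind, of "\<lambda>y. if y = x then 1 else 0"] by blast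
  then have flin: "flinear l"
    by (simp add: flinear_def VP.linear_add VP.linear_scale)
  have "l y = 0" if "y \<in> W" for y
    using VP.linear_eq_0_on_span[OF l(1), of C y] that l(2) C(1) xW span by (metis in_mono insertCI)
  moreover have "Z \<subseteq> W" "Hplus \<subseteq> W"
    unfolding W_def using H'.subspace_0[OF Z(1)] H'.subspace_0[OF Hplus_subspace] by force+
  ultimately have lZ: "l y = 0" if "y \<in> Z \<or> y \<in> Hplus" for y
    using that by blast
  obtain h where h: "h \<in> Hplus" "\<And>y. hform h y = l y"
    using functional_rep[OF flin] lZ by blast
  then have "h \<in> perp Z" by (simp add: perp_def lZ)
  then have "h = 0" using Z h(1) by simp
  then have "l x = 0" using h(2)[of x] by simp
  then show False using l(2)[of x] by simp
qed

definition prj :: "hp set \<Rightarrow> hp \<Rightarrow> hp" where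
  "prj Z x = (THE z. z \<in> Z \<and> x - z \<in> Hplus)"

lemma prj_unique:
  assumes "lagrangian_complement Z" "z \<in> Z" "x - z \<in> Hplus"
  shows "prj Z x = z"
  unfolding prj_def
proof (rule the_equality)
  note Z = lagrangian_complementD[OF assms(1)]
  fix z' assume z': "z' \<in> Z \<and> x - z' \<in> Hplus"
  have "z' - z \<in> Z" using z' assms by (intro H'.subspace_diff Z) auto
  moreover have "z' - z = (x - z) - (x - z')" by simp
  then have "z' - z \<in> Hplus" using z' assms by (metis H'.subspace_diff Hplus_subspace)
  ultimately show "z' = z" using Z(3) by force
qed (use assms in auto)

lemma prj:
  assumes "lagrangian_complement Z"
  shows "prj Z x \<in> Z" "x - prj Z x \<in> Hplus"
  using complement_spans[OF assms, of x] prj_unique[OF assms] by auto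

lemma prj_same: "lagrangian_complement Z \<Longrightarrow> x \<in> Z \<Longrightarrow> prj Z x = x"
  by (rule prj_unique) (simp_all add: H'.subspace_0 Hplus_subspace)

lemma prj_Hplus: "lagrangian_complement Z \<Longrightarrow> x \<in> Hplus \<Longrightarrow> prj Z x = 0"
  by (rule prj_unique) (simp_all add: H'.subspace_0 lagrangian_complementD)

lemma hlinear_prj:
  assumes "lagrangian_complement Z"
  shows "hlinear (prj Z)"
  unfolding hlinear_def
proof (intro conjI allI)
  note Z = lagrangian_complementD(1)[OF assms]
  show "prj Z (x + y) = prj Z x + prj Z y" for x y
  proof (rule prj_unique[OF assms])
    have "x + y - (prj Z x + prj Z y) = (x - prj Z x) + (y - prj Z y)" by simp
    then show "x + y - (prj Z x + prj Z y) \<in> Hplus"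
      using prj[OF assms] by (simp only: H'.subspace_add Hplus_subspace)
  qed (intro H'.subspace_add Z prj assms)
  show "prj Z (hscale c x) = hscale c (prj Z x)" for c x
  proof (rule prj_unique[OF assms])
    have "hscale c x - hscale c (prj Z x) = hscale c (x - prj Z x)"
      by (simp add: H'.scale_right_diff_distrib)
    then show "hscale c x - hscale c (prj Z x) \<in> Hplus"
      using prj[OF assms] by (simp only: H'.subspace_scale Hplus_subspace)
  qed (intro H'.subspace_scale Z prj assms)
qed

lemma zlift_eq_prj:
  assumes "lagrangian_complement Z"
  shows "zlift Z m = prj Z (hbasis (- int (Suc m)))"
proof -
  have "z - b \<in> Hplus \<longleftrightarrow> b - z \<in> Hplus" for z b
    using H'.subspace_neg[OF Hplus_subspace, of "z - b"] H'.subspace_neg[OF Hplus_subspace, of "b - z"] by auto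
  then show ?thesis by (simp add: zlift_def prj_def del: of_nat_Suc)
qed

lemma zlift:
  assumes "lagrangian_complement Z"
  shows "zlift Z m \<in> Z" "zlift Z m - hbasis (- int (Suc m)) \<in> Hplus"
proof -
  let ?b = "hbasis (- int (Suc m))"
  show "zlift Z m \<in> Z" by (simp only: zlift_eq_prj[OF assms] prj[OF assms])
  have "- (?b - prj Z ?b) \<in> Hplus"
    by (intro H'.subspace_neg Hplus_subspace prj assms)
  then show "zlift Z m - ?b \<in> Hplus"
    by (simp add: zlift_eq_prj[OF assms])
qed

lemma hcoeff_zlift:
  assumes "lagrangian_complement Z" "n < 0"
  shows "hcoeff (zlift Z m) n = (if n = - int (Suc m) then 1 else 0)"
proof -
  have "hcoeff (zlift Z m - hbasis (- int (Suc m))) n = 0"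
    using zlift(2)[OF assms(1)] assms(2) by (auto simp: Hplus_iff)
  then show ?thesis using assms(2) by (auto simp: hcoeff_hbasis)
qed

lemma prj_expand:
  assumes "lagrangian_complement Z"
  shows "prj Z x = (\<Sum>n\<in>polar_supp x. hscale (hcoeff x (- int (Suc n))) (zlift Z n))"
proof -
  note lin = hlinearD[OF hlinear_prj[OF assms]]
  let ?s = "\<Sum>n\<in>polar_supp x. hscale (hcoeff x (- int (Suc n))) (hbasis (- int (Suc n)))"
  have "prj Z (x - ?s) = 0" by (intro prj_Hplus assms polar_part)
  then have "prj Z x = prj Z ?s" by (simp add: lin)
  also have "\<dots> = (\<Sum>n\<in>polar_supp x. hscale (hcoeff x (- int (Suc n))) (zlift Z n))"
    unfolding lin zlift_eq_prj[OF assms] ..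
  finally show ?thesis .
qed

lemma Hplus_orth_eq_0:
  assumes "lagrangian_complement Z" "h \<in> Hplus" "\<And>v. v \<in> Z \<Longrightarrow> hform h v = 0"
  shows "h = 0"
proof (rule lagrangian_complementD(3)[OF assms(1)])
  have "h \<in> perp Z" unfolding perp_def using assms(3) by simp
  then show "h \<in> Z" by (simp only: lagrangian_complementD(2)[OF assms(1)])
qed fact

text \<open>Projection along \<open>H'\<^sub>+\<close> identifies \<open>Z\<close> with \<open>H'/H'\<^sub>+\<close>, so that \<open>functional_rep\<close> applies to functionals on \<open>Z\<close>.\<close>

lemma functional_on_complement:
  assumes Z: "lagrangian_complement Z"
    and l: "\<And>u v. u \<in> Z \<Longrightarrow> v \<in> Z \<Longrightarrow> l (u + v) = l u + l v" "\<And>c u. u \<in> Z \<Longrightarrow> l (hscale c u) = c * l u"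
  shows "\<exists>h\<in>Hplus. \<forall>v\<in>Z. hform h v = l v"
proof -
  note lin = hlinearD[OF hlinear_prj[OF Z]]
  have l0: "l 0 = 0" using l(2)[of 0 0] lagrangian_complementD(1)[OF Z] H'.subspace_0 by simp
  have "flinear (\<lambda>x. l (prj Z x))"
    by (simp add: flinear_def lin l prj[OF Z])
  then have "\<exists>h\<in>Hplus. \<forall>x. hform h x = l (prj Z x)"
    by (rule functional_rep) (simp add: prj_Hplus[OF Z] l0)
  then show ?thesis by (metis prj_same[OF Z])
qed

section \<open>The group \<open>Sp\<^sup>+(H')\<close>\<close>

lemma SpPlus_fullD:
  assumes "g \<in> SpPlus_full"
  shows "bij g" "hlinear g" "tcont g" "tcont (inv g)" "\<And>x y. hform (g x) (g y) = hform x y"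
    "g ` Hplus = Hplus" "hlinear (inv g)" "\<And>x. inv g (g x) = x" "\<And>x. g (inv g x) = x"
proof -
  show b: "bij g" and l: "hlinear g" and "\<And>x y. hform (g x) (g y) = hform x y" "g ` Hplus = Hplus"
    using assms by (auto simp: SpPlus_full_def hlinear_def)
  show i: "\<And>x. inv g (g x) = x" "\<And>x. g (inv g x) = x"
    using b by (auto simp: bij_def inv_f_f surj_f_inv_f)
  show li: "hlinear (inv g)"
    unfolding hlinear_def using hlinearD[OF l] i by metis
  show "tcont g" "tcont (inv g)"
    using assms l li by (auto simp: SpPlus_full_def intro: continuous_imp_tcont)
qed

lemma SpPlus_fullI:
  assumes "hlinear g" "hlinear g'" "\<And>x. g (g' x) = x" "\<And>x. g' (g x) = x" "tcont g" "tcont g'"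
    "\<And>x y. hform (g x) (g y) = hform x y" "g ` Hplus \<subseteq> Hplus" "g' ` Hplus \<subseteq> Hplus"
  shows "g \<in> SpPlus_full" "inv g = g'"
proof -
  have b: "bij g" using assms(3,4) by (rule_tac o_bij[of g']) (auto simp: fun_eq_iff)
  show i: "inv g = g'" using assms(3,4) by (intro inv_unique_comp) (simp_all add: fun_eq_iff)
  have "g ` Hplus = Hplus"
  proof
    show "Hplus \<subseteq> g ` Hplus"
    proof
      fix x assume "x \<in> Hplus"
      then have "g' x \<in> Hplus" using assms(9) by blast
      then have "g (g' x) \<in> g ` Hplus" by (rule imageI)
      then show "x \<in> g ` Hplus" by (simp only: assms(3))
    qed
  qed fact
  then show "g \<in> SpPlus_full"
    using b assms(7) tcont_imp_continuous[OF assms(5,1)] tcont_imp_continuous[OF assms(6,2)]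
      assms(1)[unfolded hlinear_def]
    unfolding SpPlus_full_def mem_Collect_eq i by (intro conjI) simp_all
qed

lemma inv_SpPlus_full:
  assumes "g \<in> SpPlus_full"
  shows "inv g \<in> SpPlus_full"
proof (rule SpPlus_fullI(1)[where g' = g])
  note g = SpPlus_fullD[OF assms]
  show "hform (inv g x) (inv g y) = hform x y" for x y
    using g(5)[of "inv g x" "inv g y"] by (simp add: g)
  show "inv g ` Hplus \<subseteq> Hplus"
  proof
    fix x assume "x \<in> inv g ` Hplus"
    then obtain h where h: "h \<in> Hplus" "x = inv g h" by blast
    then obtain h' where "h' \<in> Hplus" "h = g h'" using g(6) by blast
    then show "x \<in> Hplus" by (simp add: h(2) g(8))
  qed
qed (use SpPlus_fullD[OF assms] in auto)

lemma hlinear_comp: "hlinear g \<Longrightarrow> hlinear g' \<Longrightarrow> hlinear (g \<circ> g')"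
  by (simp add: hlinear_def)

lemma tcont_comp:
  assumes "tcont g" "tcont g'"
  shows "tcont (g \<circ> g')"
  unfolding tcont_def
proof
  fix J
  obtain K where K: "g ` hord K \<subseteq> hord J" using assms(1) unfolding tcont_def by meson
  obtain L where "g' ` hord L \<subseteq> hord K" using assms(2) unfolding tcont_def by meson
  with K have "(g \<circ> g') ` hord L \<subseteq> hord J" by (simp add: image_subset_iff)
  then show "\<exists>K. (g \<circ> g') ` hord K \<subseteq> hord J" ..
qed

lemma comp_SpPlus_full:
  assumes "g \<in> SpPlus_full" "g' \<in> SpPlus_full"
  shows "g \<circ> g' \<in> SpPlus_full"
proof (rule SpPlus_fullI(1)[where g' = "inv g' \<circ> inv g"])
  note g = SpPlus_fullD[OF assms(1)] and g' = SpPlus_fullD[OF assms(2)]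
  note i = SpPlus_fullD[OF inv_SpPlus_full[OF assms(1)]] SpPlus_fullD[OF inv_SpPlus_full[OF assms(2)]]
  show "(inv g' \<circ> inv g) ` Hplus \<subseteq> Hplus"
    using i(6) i(15) by (simp only: image_comp[symmetric] order_refl)
  show "(g \<circ> g') ` Hplus \<subseteq> Hplus"
    using g(6) g'(6) by (simp only: image_comp[symmetric] order_refl)
  show "hlinear (g \<circ> g')" "hlinear (inv g' \<circ> inv g)" by (intro hlinear_comp g g')+
  show "tcont (g \<circ> g')" "tcont (inv g' \<circ> inv g)" by (intro tcont_comp g g')+
qed (simp_all add: SpPlus_fullD[OF assms(1)] SpPlus_fullD[OF assms(2)])

lemma subspace_image:
  assumes "hlinear g" "H'.subspace S"
  shows "H'.subspace (g ` S)"
proof (rule H'.subspaceI)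
  note lin = hlinearD[OF assms(1)]
  show "0 \<in> g ` S" using lin(3) H'.subspace_0[OF assms(2)] by force
  show "x + y \<in> g ` S" if "x \<in> g ` S" "y \<in> g ` S" for x y
    using that lin(1) H'.subspace_add[OF assms(2)] by (auto simp flip: lin(1))
  show "hscale c x \<in> g ` S" if "x \<in> g ` S" for c x
    using that H'.subspace_scale[OF assms(2)] by (auto simp flip: lin(2))
qed

lemma perp_image:
  assumes "g \<in> SpPlus_full"
  shows "perp (g ` S) = g ` perp S"
proof -
  note g = SpPlus_fullD[OF assms]
  have "x \<in> perp (g ` S) \<longleftrightarrow> inv g x \<in> perp S" for x
    using g(5)[of "inv g x"] by (auto simp: perp_def g)
  moreover have "x \<in> g ` perp S \<longleftrightarrow> inv g x \<in> perp S" for x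
  proof
    assume "inv g x \<in> perp S"
    then have "g (inv g x) \<in> g ` perp S" by (rule imageI)
    then show "x \<in> g ` perp S" by (simp only: g(9))
  qed (auto simp: g(8))
  ultimately show ?thesis by blast
qed

lemma lagrangian_complement_image:
  assumes "g \<in> SpPlus_full" "lagrangian_complement Z"
  shows "lagrangian_complement (g ` Z)"
proof -
  note g = SpPlus_fullD[OF assms(1)] and Z = lagrangian_complementD[OF assms(2)]
  have "g ` Z \<inter> Hplus = g ` (Z \<inter> Hplus)"
    using g(1,6) by (metis bij_is_inj image_Int)
  also have "\<dots> = {0}"
    using assms(2) hlinearD(3)[OF g(2)] by (simp add: lagrangian_complement_def)
  finally show ?thesis
    by (simp add: lagrangian_complement_def lagrangian_def perp_image[OF assms(1)] Z subspace_image g)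
qed

text \<open>Group elements preserve \<open>H'\<^sub>+\<close>, hence commute with projections along it.\<close>

lemma prj_image:
  assumes "g \<in> SpPlus_full" "lagrangian_complement Z"
  shows "prj (g ` Z) (g x) = g (prj Z x)"
proof (rule prj_unique[OF lagrangian_complement_image[OF assms]])
  note g = SpPlus_fullD[OF assms(1)]
  show "g (prj Z x) \<in> g ` Z" using prj[OF assms(2)] by simp
  have "g (x - prj Z x) \<in> Hplus" using g(6) prj[OF assms(2)] by blast
  then show "g x - g (prj Z x) \<in> Hplus" by (simp add: hlinearD[OF g(2)])
qed

section \<open>Unipotent elements and paths in \<open>Sp\<^sup>+(H')\<close>\<close>

text \<open>For an element \<open>T\<close> of \<open>sp\<^sup>+(H')\<close> with \<open>T\<^sup>2 = 0\<close> the exponential is \<open>1 + T\<close>, and the segment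
  \<open>1 + sT\<close> joins it to the identity inside the group. All group elements needed for transitivity
  are products of such exponentials.\<close>

definition sqzero :: "(hp \<Rightarrow> hp) \<Rightarrow> bool" where
  "sqzero T \<longleftrightarrow> hlinear T \<and> tcont T \<and> (\<forall>x. T (T x) = 0) \<and> (\<forall>x y. hform (T x) y + hform x (T y) = 0)
     \<and> T ` Hplus \<subseteq> Hplus"

definition unip :: "(hp \<Rightarrow> hp) \<Rightarrow> complex \<Rightarrow> hp \<Rightarrow> hp" where
  "unip T s x = x + hscale s (T x)"

lemma hlinear_unip: "hlinear T \<Longrightarrow> hlinear (unip T s)"
  by (simp add: hlinear_def unip_def H'.scale_right_distrib mult.commute)

lemma unip_hord:
  assumes "hlinear T" "T ` hord K \<subseteq> hord J" "J \<le> K"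
  shows "unip T s ` hord K \<subseteq> hord J"
  using assms by (fastforce simp: unip_def hord_def)

lemma unip_unip: "sqzero T \<Longrightarrow> unip T s (unip T (- s) x) = x"
  by (simp add: sqzero_def unip_def hlinearD)

lemma unip_SpPlus_full:
  assumes "sqzero T"
  shows "unip T s \<in> SpPlus_full"
proof (rule SpPlus_fullI(1)[where g' = "unip T (- s)"])
  have T: "hlinear T" "tcont T" "\<And>x. T (T x) = 0" "\<And>x y. hform (T x) y + hform x (T y) = 0"
    "T ` Hplus \<subseteq> Hplus" using assms by (auto simp: sqzero_def)
  show "hlinear (unip T s)" "hlinear (unip T (- s))" by (auto intro: hlinear_unip T)
  show "unip T s (unip T (- s) x) = x" "unip T (- s) (unip T s x) = x" for x
    using unip_unip[OF assms, of s] unip_unip[OF assms, of "- s"] by simp_all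
  show "tcont (unip T s)" for s
    unfolding tcont_def
  proof
    fix J
    obtain K where K: "T ` hord K \<subseteq> hord J" using T(2) unfolding tcont_def by meson
    have "T ` hord (max J K) \<subseteq> hord J" using K hord_mono[of K "max J K"] by force
    then have "unip T s ` hord (max J K) \<subseteq> hord J" by (intro unip_hord T) auto
    then show "\<exists>K. unip T s ` hord K \<subseteq> hord J" ..
  qed
  then show "tcont (unip T (- s))" .
  show "unip T s ` Hplus \<subseteq> Hplus" for s
    using T(5) Hplus_subspace by (auto simp: unip_def intro!: H'.subspace_add H'.subspace_scale)
  then show "unip T (- s) ` Hplus \<subseteq> Hplus" .
  show "hform (unip T s x) (unip T s y) = hform x y" for x y
  proof -
    have "hform (T x) (T y) = 0" using T(4)[of x "T y"] T(3) by simp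
    moreover have "hform (T x) y = - hform x (T y)" using T(4)[of x y] by (simp add: eq_neg_iff_add_eq_0)
    ultimately show ?thesis by (simp add: unip_def hform_linear)
  qed
qed

text \<open>Families of group elements along which the identity is connected to an element. Composition is
  not jointly continuous for the topology of matrix entries; the uniform bounds make all
  the sums involved finite, so that products of such families are again continuous.\<close>

definition bounded_family :: "(real \<Rightarrow> hp \<Rightarrow> hp) \<Rightarrow> bool" where
  "bounded_family G \<longleftrightarrow> (\<forall>s. G s \<in> SpPlus_full) \<and> (\<forall>x. \<exists>M. \<forall>s. G s x \<in> hord M) \<and>
     (\<forall>J. \<exists>K. \<forall>s. G s ` hord K \<subseteq> hord J) \<and> (\<forall>x j. continuous_on UNIV (\<lambda>s. hcoeff (G s x) j))"

lemma hord_scale: "x \<in> hord K \<Longrightarrow> hscale c x \<in> hord K"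
  and hord_add: "x \<in> hord K \<Longrightarrow> y \<in> hord K \<Longrightarrow> x + y \<in> hord K"
  by (auto simp: hord_def)

lemma hord_sum: "(\<And>i. i \<in> A \<Longrightarrow> f i \<in> hord K) \<Longrightarrow> sum f A \<in> hord K"
  by (induction A rule: infinite_finite_induct) (auto intro: hord_add)

text \<open>Along a segment \<open>1 + sT\<close> the bounds are uniform because \<open>x\<close> and \<open>T x\<close> span a space that does not
  depend on \<open>s\<close>.\<close>

lemma bounded_family_unip:
  assumes "sqzero T"
  shows "bounded_family (\<lambda>s. unip T (of_real s))"
  unfolding bounded_family_def
proof (intro conjI allI)
  have T: "hlinear T" "tcont T" using assms by (auto simp: sqzero_def)
  show "unip T (of_real s) \<in> SpPlus_full" for s by (rule unip_SpPlus_full[OF assms])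
  show "\<exists>M. \<forall>s::real. unip T (of_real s) x \<in> hord M" for x
  proof -
    obtain M N where "x \<in> hord M" "T x \<in> hord N" using hord_exists by meson
    then have "x \<in> hord (min M N)" "T x \<in> hord (min M N)" by (auto simp: hord_def)
    then show ?thesis unfolding unip_def by (blast intro: hord_add hord_scale)
  qed
  show "\<exists>K. \<forall>s::real. unip T (of_real s) ` hord K \<subseteq> hord J" for J
  proof -
    obtain K where K: "T ` hord K \<subseteq> hord J" using T(2) unfolding tcont_def by meson
    have "T ` hord (max J K) \<subseteq> hord J" using K hord_mono[of K "max J K"] by force
    then have "unip T s ` hord (max J K) \<subseteq> hord J" for s by (intro unip_hord T) auto
    then show ?thesis by blast
  qed
  show "continuous_on UNIV (\<lambda>s::real. hcoeff (unip T (of_real s) x) j)" for x j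
    unfolding unip_def by (auto intro!: continuous_intros)
qed

lemma bounded_family_comp:
  assumes "bounded_family G" "bounded_family G'"
  shows "bounded_family (\<lambda>s. G s \<circ> G' s)"
proof -
  have G: "\<And>s. G s \<in> SpPlus_full" "\<And>x. \<exists>M. \<forall>s. G s x \<in> hord M"
    "\<And>J. \<exists>K. \<forall>s. G s ` hord K \<subseteq> hord J" "\<And>x j. continuous_on UNIV (\<lambda>s. hcoeff (G s x) j)"
    and G': "\<And>s. G' s \<in> SpPlus_full" "\<And>x. \<exists>M. \<forall>s. G' s x \<in> hord M"
    "\<And>J. \<exists>K. \<forall>s. G' s ` hord K \<subseteq> hord J" "\<And>x j. continuous_on UNIV (\<lambda>s. hcoeff (G' s x) j)"
    using assms by (auto simp: bounded_family_def)
  \<comment> \<open>Splitting \<open>G' s x\<close> into a finite combination of powers of \<open>t\<close> and a remainder that \<open>G s\<close> sends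
    to high order.\<close>
  have split: "\<exists>M K r. (\<forall>s. G s (G' s x) = (\<Sum>k\<in>{M..<K}. hscale (hcoeff (G' s x) k) (G s (hbasis k))) + r s)
      \<and> (\<forall>s. r s \<in> hord J)" for x J
  proof -
    obtain M where M: "\<And>s. G' s x \<in> hord M" using G'(2) by blast
    obtain K where K: "\<And>s. G s ` hord K \<subseteq> hord J" using G(3) by blast
    define p where "p = (\<lambda>s. \<Sum>k\<in>{M..<K}. hscale (hcoeff (G' s x) k) (hbasis k))"
    have "G s (G' s x) = G s (p s) + G s (G' s x - p s)" for s
      using hlinearD(1)[OF SpPlus_fullD(2)[OF G(1)], of s "p s" "G' s x - p s"] by simp
    moreover have "G s (p s) = (\<Sum>k\<in>{M..<K}. hscale (hcoeff (G' s x) k) (G s (hbasis k)))" for s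
      by (simp add: p_def hlinearD[OF SpPlus_fullD(2)[OF G(1)]])
    moreover have "G s (G' s x - p s) \<in> hord J" for s
      using K[of s] hord_truncate[OF M, of s K] unfolding p_def by (meson image_subset_iff)
    ultimately show ?thesis by (intro exI[of _ M] exI[of _ K] exI[of _ "\<lambda>s. G s (G' s x - p s)"]) auto
  qed
  show ?thesis
    unfolding bounded_family_def o_def
  proof (intro conjI allI)
    show "(\<lambda>x. G s (G' s x)) \<in> SpPlus_full" for s
      using comp_SpPlus_full[OF G(1) G'(1)] by (simp add: o_def)
    show "\<exists>M. \<forall>s. G s (G' s x) \<in> hord M" for x
    proof -
      obtain M K r where *: "\<And>s. G s (G' s x) = (\<Sum>k\<in>{M..<K}. hscale (hcoeff (G' s x) k) (G s (hbasis k))) + r s"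
        "\<And>s. r s \<in> hord 0" using split[of x 0] by metis
      have "\<forall>k. \<exists>N. \<forall>s. G s (hbasis k) \<in> hord N" using G(2) by blast
      then obtain N where N: "\<And>k s. G s (hbasis k) \<in> hord (N k)" by (rule choice[THEN exE]) blast
      define L where "L = Min (insert 0 (N ` {M..<K}))"
      have "G s (hbasis k) \<in> hord L" if "k \<in> {M..<K}" for s k
      proof -
        have "L \<le> N k" unfolding L_def using that by (intro Min_le) auto
        then show ?thesis using N[of s k] hord_mono by blast
      qed
      moreover have "r s \<in> hord L" for s
      proof -
        have "L \<le> 0" unfolding L_def by (intro Min_le) auto
        then show ?thesis using *(2)[of s] hord_mono by blast
      qed
      ultimately have "G s (G' s x) \<in> hord L" for s
        unfolding * by (intro hord_add hord_sum hord_scale) auto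
      then show ?thesis by blast
    qed
    show "\<exists>K. \<forall>s. (\<lambda>x. G s (G' s x)) ` hord K \<subseteq> hord J" for J
    proof -
      obtain K where "\<And>s. G s ` hord K \<subseteq> hord J" using G(3) by blast
      moreover obtain L where "\<And>s. G' s ` hord L \<subseteq> hord K" using G'(3) by blast
      ultimately have "(\<lambda>x. G s (G' s x)) ` hord L \<subseteq> hord J" for s by (simp add: image_subset_iff)
      then show ?thesis by blast
    qed
    show "continuous_on UNIV (\<lambda>s. hcoeff (G s (G' s x)) j)" for x j
    proof -
      obtain M K r where *: "\<And>s. G s (G' s x) = (\<Sum>k\<in>{M..<K}. hscale (hcoeff (G' s x) k) (G s (hbasis k))) + r s"
        "\<And>s. r s \<in> hord (j + 1)" using split[of x "j + 1"] by metis
      have "hcoeff (G s (G' s x)) j = (\<Sum>k\<in>{M..<K}. hcoeff (G' s x) k * hcoeff (G s (hbasis k)) j)" for s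
        using hordD[OF *(2)[of s], of j] by (simp add: * hcoeff_sum)
      then show ?thesis by (auto intro!: continuous_intros G(4) G'(4))
    qed
  qed
qed

text \<open>The image of \<open>[0,1]\<close> is connected for the topology of matrix entries, and contains the identity.\<close>

lemma bounded_family_SpPlus:
  assumes "bounded_family G" "G 0 = id"
  shows "G 1 \<in> SpPlus"
proof -
  let ?E = "\<lambda>g (i::int, j::int). hcoeff (g (hbasis i)) j"
  let ?X = "pullback_topology SpPlus_full ?E euclidean"
  have "continuous_map (top_of_set {0..1}) ?X G"
  proof (rule continuous_map_pullback')
    have "continuous_on {0..1} (?E \<circ> G)"
    proof (rule continuous_on_coordinatewise_then_product)
      fix ij :: "int \<times> int"
      have "continuous_on UNIV (\<lambda>s. hcoeff (G s (hbasis (fst ij))) (snd ij))"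
        using assms(1) by (simp add: bounded_family_def)
      then have "continuous_on {0..1} (\<lambda>s. hcoeff (G s (hbasis (fst ij))) (snd ij))"
        by (rule continuous_on_subset) simp
      then show "continuous_on {0..1} (\<lambda>s. (?E \<circ> G) s ij)"
        by (simp add: case_prod_beta)
    qed
    then show "continuous_map (top_of_set {0..1}) euclidean (?E \<circ> G)" by simp
    show "topspace (top_of_set {0..1}) \<subseteq> G -` SpPlus_full"
      using assms(1) by (auto simp: bounded_family_def)
  qed
  then have "connectedin ?X (G ` {0..1})"
    by (rule connectedin_continuous_map_image) simp
  moreover have "id \<in> G ` {0..1}" "G 1 \<in> G ` {0..1}"
    using assms(2) by (force simp: image_iff)+
  ultimately show ?thesis
    unfolding SpPlus_def by (auto simp: connected_component_of_def)
qed

lemma SpPlus_subset: "SpPlus \<subseteq> SpPlus_full"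
  using connected_component_of_subset_topspace
  unfolding SpPlus_def by (force simp: topspace_pullback_topology)

section \<open>Transitivity on Lagrangian complements with a surjection to \<open>\<complex>\<^sup>g\<close>\<close>

text \<open>On \<open>Z\<close> the map \<open>1 + (prj Z' - prj Z)\<close> is the projection to \<open>Z'\<close> along \<open>H'\<^sub>+\<close>, so it carries \<open>Z\<close> to \<open>Z'\<close>.
  The difference of projections maps \<open>H'\<close> to \<open>H'\<^sub>+\<close> and kills \<open>H'\<^sub>+\<close>; it is skew because \<open>Z\<close>, \<open>Z'\<close> and
  \<open>H'\<^sub>+\<close> are all isotropic.\<close>

lemma sqzero_prj_diff:
  assumes Z: "lagrangian_complement Z" and Z': "lagrangian_complement Z'"
  shows "sqzero (\<lambda>x. prj Z' x - prj Z x)"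
proof -
  let ?T = "\<lambda>x. prj Z' x - prj Z x"
  note lin = hlinearD[OF hlinear_prj[OF Z]] and lin' = hlinearD[OF hlinear_prj[OF Z']]
  have TH: "?T x \<in> Hplus" for x
  proof -
    have "?T x = (x - prj Z x) - (x - prj Z' x)" by simp
    then show ?thesis using prj(2)[OF Z] prj(2)[OF Z'] by (metis H'.subspace_diff Hplus_subspace)
  qed
  have T0: "?T x = 0" if "x \<in> Hplus" for x
    using that by (simp add: prj_Hplus Z Z')
  have "?T ` hord 0 \<subseteq> hord J" for J
    using T0 by (auto simp: Hplus_eq_hord[symmetric])
  then have "tcont ?T" unfolding tcont_def by blast
  moreover have "hform (?T x) y + hform x (?T y) = 0" for x y
  proof -
    \<comment> \<open>Both arguments may be replaced by their projections to \<open>Z'\<close>, since \<open>H'\<^sub>+\<close> is isotropic.\<close>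
    have "hform (?T x) (y - prj Z' y) = 0" "hform (x - prj Z' x) (?T y) = 0" "hform (?T x) (?T y) = 0"
      by (intro hform_Hplus TH prj(2)[OF Z'])+
    moreover have "hform (prj Z' x) (prj Z' y) = 0" "hform (prj Z x) (prj Z y) = 0"
      using lagrangian_complementD(4)[OF Z] lagrangian_complementD(4)[OF Z'] prj(1)[OF Z] prj(1)[OF Z'] by simp_all
    ultimately show ?thesis unfolding hform_diff by algebra
  qed
  ultimately show ?thesis
    using TH T0[OF TH]
    unfolding sqzero_def hlinear_def
    by (auto simp: lin lin' H'.scale_right_diff_distrib)
qed

lemma hord_exists_family: "\<exists>N. \<forall>i. x i \<in> hord (N i)"
  by (rule choice) (simp add: hord_exists)

lemma ex_section:
  assumes "f ` S = UNIV"
  shows "\<exists>s. \<forall>v. s v \<in> S \<and> f (s v) = v"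
proof (rule choice, rule allI)
  fix v
  have "v \<in> f ` S" by (simp add: assms)
  then show "\<exists>x. x \<in> S \<and> f x = v" by (metis imageE)
qed

definition zlin :: "hp set \<Rightarrow> (hp \<Rightarrow> complex^'n) \<Rightarrow> bool" where
  "zlin Z \<phi> \<longleftrightarrow> (\<forall>u\<in>Z. \<forall>v\<in>Z. \<phi> (u + v) = \<phi> u + \<phi> v) \<and> (\<forall>c. \<forall>u\<in>Z. \<phi> (hscale c u) = c *s \<phi> u)"

lemma zlinD:
  assumes "zlin Z \<phi>" "H'.subspace Z"
  shows "u \<in> Z \<Longrightarrow> v \<in> Z \<Longrightarrow> \<phi> (u + v) = \<phi> u + \<phi> v" "u \<in> Z \<Longrightarrow> \<phi> (hscale c u) = c *s \<phi> u"
    "\<phi> 0 = 0" "u \<in> Z \<Longrightarrow> v \<in> Z \<Longrightarrow> \<phi> (u - v) = \<phi> u - \<phi> v"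
    "(\<And>i. i \<in> A \<Longrightarrow> f i \<in> Z) \<Longrightarrow> \<phi> (sum f A) = (\<Sum>i\<in>A. \<phi> (f i))"
proof -
  show add: "u \<in> Z \<Longrightarrow> v \<in> Z \<Longrightarrow> \<phi> (u + v) = \<phi> u + \<phi> v"
    and sc: "u \<in> Z \<Longrightarrow> \<phi> (hscale c u) = c *s \<phi> u" for u v c
    using assms by (auto simp: zlin_def)
  show 0: "\<phi> 0 = 0" using add[of 0 0] H'.subspace_0[OF assms(2)] by simp
  show "\<phi> (u - v) = \<phi> u - \<phi> v" if "u \<in> Z" "v \<in> Z"
    using add[of "u - v" v] that H'.subspace_diff[OF assms(2)] by simp
  show "(\<And>i. i \<in> A \<Longrightarrow> f i \<in> Z) \<Longrightarrow> \<phi> (sum f A) = (\<Sum>i\<in>A. \<phi> (f i))"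
  proof (induction A rule: infinite_finite_induct)
    case (insert i A)
    have "sum f A \<in> Z" using insert.prems by (intro H'.subspace_sum assms) auto
    with insert show ?case by (simp add: add)
  qed (simp_all add: 0)
qed

text \<open>If \<open>\<psi>\<close> and \<open>\<theta>\<close> take the standard basis as values at common vectors \<open>a\<^sub>i\<close>, then
  \<open>z \<mapsto> z + \<Sum>\<^sub>i (\<psi>(z) - \<theta>(z))\<^sub>i a\<^sub>i\<close> pulls \<open>\<theta>\<close> back to \<open>\<psi>\<close>. On \<open>Z\<close> this is \<open>1 + T\<close> for the
  quadratic element \<open>T = \<Sum>\<^sub>i \<rho>\<^sub>i a\<^sub>i\<close> of \<open>sp\<^sup>+(H')\<close>, where \<open>\<rho>\<^sub>i \<in> H'\<^sub>+\<close> represents \<open>(\<psi> - \<theta>)\<^sub>i\<close>;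
  it squares to zero because \<open>\<rho>\<^sub>i\<close> is orthogonal to all \<open>a\<^sub>j\<close>.\<close>

lemma sqzero_transport:
  fixes \<psi> \<theta> :: "hp \<Rightarrow> complex^'n"
  assumes Z: "lagrangian_complement Z" and \<psi>: "zlin Z \<psi>" and \<theta>: "zlin Z \<theta>"
    and a: "\<And>i. a i \<in> Z" "\<And>i. \<psi> (a i) = axis i 1" "\<And>i. \<theta> (a i) = axis i 1"
  shows "\<exists>T. sqzero T \<and> (\<forall>z\<in>Z. T z \<in> Z \<and> \<theta> (z + T z) = \<psi> z)"
proof -
  note Zs = lagrangian_complementD[OF Z]
  note \<psi>l = zlinD[OF \<psi> Zs(1)] and \<theta>l = zlinD[OF \<theta> Zs(1)]
  have "\<exists>h\<in>Hplus. \<forall>z\<in>Z. hform h z = (\<psi> z - \<theta> z) $ i" for i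
    by (rule functional_on_complement[OF Z]) (simp_all add: \<psi>l \<theta>l algebra_simps)
  then obtain \<rho> where \<rho>: "\<And>i. \<rho> i \<in> Hplus" "\<And>i z. z \<in> Z \<Longrightarrow> hform (\<rho> i) z = (\<psi> z - \<theta> z) $ i"
    by metis
  define T where "T x = (\<Sum>i\<in>UNIV. hscale (hform (\<rho> i) x) (a i) + hscale (hform (a i) x) (\<rho> i))" for x
  have \<rho>a: "hform (\<rho> i) (a j) = 0" "hform (a j) (\<rho> i) = 0" for i j
    using \<rho>(2)[OF a(1)] hform_antisym[of "a j"] by (simp_all add: a)
  have \<rho>T: "hform (\<rho> i) (T x) = 0" "hform (a i) (T x) = 0" for i x
    by (simp_all add: T_def hform_linear \<rho>a hform_Hplus \<rho> Zs(4) a)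
  have Tz: "T z = (\<Sum>i\<in>UNIV. hscale ((\<psi> z - \<theta> z) $ i) (a i))" if "z \<in> Z" for z
    using that by (simp add: T_def \<rho> Zs(4) a)
  have "sqzero T"
    unfolding sqzero_def
  proof (intro conjI allI)
    show "hlinear T"
      by (auto simp: hlinear_def T_def hform_linear H'.scale_left_distrib sum.distrib[symmetric]
          H'.scale_sum_right H'.scale_right_distrib intro!: sum.cong)
    show "T (T x) = 0" for x unfolding T_def[of "T x"] by (simp add: \<rho>T)
    show "hform (T x) y + hform x (T y) = 0" for x y
    proof -
      have "hform x (a i) = - hform (a i) x" "hform x (\<rho> i) = - hform (\<rho> i) x" for i
        using hform_antisym by blast+
      then show ?thesis
        by (simp add: T_def hform_linear sum.distrib[symmetric] algebra_simps)
    qed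
    show "T ` Hplus \<subseteq> Hplus"
      using \<rho>(1) by (auto simp: T_def hform_Hplus intro!: H'.subspace_sum H'.subspace_scale Hplus_subspace)
    obtain N where N: "\<And>i. a i \<in> hord (N i)" using hord_exists_family[of a] by blast
    define K where "K = Max (insert 1 ((\<lambda>i. 1 - N i) ` UNIV))"
    have "T x = 0" if "x \<in> hord K" for x
    proof -
      have "hform (a i) x = 0" for i
        using N[of i] that by (rule hform_hord) (use Max_ge[of "insert 1 ((\<lambda>i. 1 - N i) ` UNIV)" "1 - N i"] in \<open>simp add: K_def\<close>)
      moreover have "x \<in> Hplus" using that hord_mono[of 1 K] by (auto simp: K_def hord_1[symmetric])
      ultimately show ?thesis by (simp add: T_def hform_Hplus \<rho>)
    qed
    then have "T ` hord K \<subseteq> hord J" for J by auto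
    then show "tcont T" unfolding tcont_def by blast
  qed
  moreover have "T z \<in> Z \<and> \<theta> (z + T z) = \<psi> z" if z: "z \<in> Z" for z
  proof
    show "T z \<in> Z" unfolding Tz[OF z] by (intro H'.subspace_sum H'.subspace_scale Zs a)
    then have "\<theta> (z + T z) = \<theta> z + (\<Sum>i\<in>UNIV. \<theta> (hscale ((\<psi> z - \<theta> z) $ i) (a i)))"
      using z by (simp add: \<theta>l Tz a Zs H'.subspace_scale)
    also have "\<dots> = \<theta> z + (\<Sum>i\<in>UNIV. (\<psi> z - \<theta> z) $ i *s axis i 1)"
      by (simp add: \<theta>l a)
    also have "\<dots> = \<psi> z" by (simp add: basis_expansion del: vector_minus_component)
    finally show "\<theta> (z + T z) = \<psi> z" .
  qed
  ultimately show ?thesis by blast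
qed

text \<open>Two surjections need not admit common vectors as in \<open>sqzero_transport\<close>, but each of them does with a
  third surjection \<open>\<theta>\<close> that reads off coefficients of large pole order. Preimages \<open>v\<^sub>j\<close> of the
  standard basis under the given surjections have smaller pole order, so \<open>\<theta>\<close> vanishes on them and they can be
  used to correct \<open>z\<^sub>i\<close>, on which \<open>\<theta>\<close> takes the standard basis as values.\<close>

lemma intermediate_surjection:
  fixes \<psi> \<phi> :: "hp \<Rightarrow> complex^'n"
  assumes Z: "lagrangian_complement Z" and \<psi>: "zlin Z \<psi>" "\<psi> ` Z = UNIV" and \<phi>: "zlin Z \<phi>" "\<phi> ` Z = UNIV"
  shows "\<exists>\<theta> a b. zlin Z \<theta> \<and> (\<forall>i. a i \<in> Z \<and> \<psi> (a i) = axis i 1 \<and> \<theta> (a i) = (axis i 1 :: complex^'n)) \<and>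
    (\<forall>i. b i \<in> Z \<and> \<phi> (b i) = axis i 1 \<and> \<theta> (b i) = axis i 1)"
proof -
  note Zs = lagrangian_complementD[OF Z]
  obtain s s' where s: "\<And>v. s v \<in> Z" "\<And>v. \<psi> (s v) = v" and s': "\<And>v. s' v \<in> Z" "\<And>v. \<phi> (s' v) = v"
    using ex_section[OF \<psi>(2)] ex_section[OF \<phi>(2)] by blast
  define w w' where "w i = s (axis i 1)" and "w' i = s' (axis i 1)" for i
  have w: "\<And>i. w i \<in> Z" "\<And>i. \<psi> (w i) = axis i 1" by (simp_all add: w_def s)
  have w': "\<And>i. w' i \<in> Z" "\<And>i. \<phi> (w' i) = axis i 1" by (simp_all add: w'_def s')
  obtain N N' where N: "\<And>i. w i \<in> hord (N i)" "\<And>i. w' i \<in> hord (N' i)"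
    using hord_exists_family[of w] hord_exists_family[of w'] by blast
  define M where "M = nat (Max (range (\<lambda>i. max (- N i) (- N' i))))"
  have "max (- N i) (- N' i) \<le> Max (range (\<lambda>i. max (- N i) (- N' i)))" for i
    by (rule Max_ge) auto
  then have M: "- int M \<le> N i" "- int M \<le> N' i" for i
    by (smt (verit) M_def nat_eq_iff2 int_nat_eq)+
  obtain idx :: "'n \<Rightarrow> nat" where idx: "inj idx"
    using finite_imp_inj_to_nat_seg[of "UNIV :: 'n set"] by auto
  define \<theta> :: "hp \<Rightarrow> complex^'n" where "\<theta> x = (\<chi> i. hcoeff x (- int (Suc (M + idx i))))" for x
  have \<theta>: "zlin Z \<theta>"
    by (auto simp: zlin_def \<theta>_def vec_eq_iff simp del: of_nat_Suc)
  note \<theta>l = zlinD[OF \<theta> Zs(1)]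
  define z where "z i = zlift Z (M + idx i)" for i
  have zZ: "z i \<in> Z" for i by (simp add: z_def zlift[OF Z])
  have \<theta>z: "\<theta> (z i) = axis i 1" for i
    by (auto simp: \<theta>_def z_def vec_eq_iff hcoeff_zlift[OF Z] axis_def inj_eq[OF idx])
  \<comment> \<open>The same correction serves both sides.\<close>
  have *: "\<exists>a. \<forall>i. a i \<in> Z \<and> \<eta> (a i) = axis i 1 \<and> \<theta> (a i) = (axis i 1 :: complex^'n)"
    if \<eta>: "zlin Z \<eta>" and v: "\<And>i. v i \<in> Z" "\<And>i. \<eta> (v i) = axis i 1" "\<And>i. v i \<in> hord (- int M)"
    for \<eta> :: "hp \<Rightarrow> complex^'n" and v
  proof -
    note \<eta>l = zlinD[OF \<eta> Zs(1)]
    define c where "c i = (\<Sum>j\<in>UNIV. hscale ((axis i 1 - \<eta> (z i)) $ j) (v j))" for i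
    have cZ: "c i \<in> Z" for i unfolding c_def by (intro H'.subspace_sum H'.subspace_scale Zs v)
    have "\<eta> (c i) = axis i 1 - \<eta> (z i)" for i
      unfolding c_def by (simp add: \<eta>l v H'.subspace_scale Zs basis_expansion del: vector_minus_component)
    moreover have "\<theta> (v j) = 0" for j
      using v(3)[of j] by (auto simp: \<theta>_def vec_eq_iff hord_def)
    then have "\<theta> (c i) = 0" for i
      unfolding c_def by (simp add: \<theta>l v H'.subspace_scale Zs)
    ultimately show ?thesis
      by (intro exI[of _ "\<lambda>i. z i + c i"]) (simp add: \<theta>l \<eta>l zZ cZ \<theta>z H'.subspace_add Zs)
  qed
  have "w i \<in> hord (- int M)" "w' i \<in> hord (- int M)" for i
    using N[of i] M[of i] hord_mono by blast+
  then obtain a b where "\<forall>i. a i \<in> Z \<and> \<psi> (a i) = axis i 1 \<and> \<theta> (a i) = (axis i 1 :: complex^'n)"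
    "\<forall>i. b i \<in> Z \<and> \<phi> (b i) = axis i 1 \<and> \<theta> (b i) = (axis i 1 :: complex^'n)"
    using *[OF \<psi>(1) w] *[OF \<phi>(1) w'] by blast
  with \<theta> show ?thesis by blast
qed

lemma unip_image:
  assumes "sqzero T" "H'.subspace Z" "\<And>z. z \<in> Z \<Longrightarrow> T z \<in> Z"
  shows "unip T s ` Z = Z"
proof
  have *: "unip T s ` Z \<subseteq> Z" for s
    using assms by (auto simp: unip_def intro!: H'.subspace_add H'.subspace_scale)
  show "unip T s ` Z \<subseteq> Z" by (rule *)
  show "Z \<subseteq> unip T s ` Z"
  proof
    fix z assume "z \<in> Z"
    then have "unip T (- s) z \<in> Z" using *[of "- s"] by blast
    moreover have "z = unip T s (unip T (- s) z)" by (simp add: unip_unip[OF assms(1)])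
    ultimately show "z \<in> unip T s ` Z" by blast
  qed
qed

text \<open>One step moves \<open>Z\<close> to \<open>Z'\<close>, two further steps carry the transported surjection to \<open>\<phi>'\<close> through an
  intermediate one. Each step is \<open>1 + T\<close> with \<open>T\<^sup>2 = 0\<close>, and scaling the three elements \<open>T\<close> simultaneously
  gives a path to the identity.\<close>

proposition SpPlus_transitive:
  fixes \<phi> \<phi>' :: "hp \<Rightarrow> complex^'n"
  assumes Z: "lagrangian_complement Z" and \<phi>: "zlin Z \<phi>" "\<phi> ` Z = UNIV"
    and Z': "lagrangian_complement Z'" and \<phi>': "zlin Z' \<phi>'" "\<phi>' ` Z' = UNIV"
  shows "\<exists>g\<in>SpPlus. g ` Z = Z' \<and> (\<forall>z\<in>Z. \<phi>' (g z) = \<phi> z)"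
proof -
  note Zs = lagrangian_complementD[OF Z] and Zs' = lagrangian_complementD[OF Z']
  define T1 where "T1 x = prj Z' x - prj Z x" for x
  have T1: "sqzero T1" unfolding T1_def by (rule sqzero_prj_diff[OF Z Z'])
  have g1: "unip T1 1 z = prj Z' z" if "z \<in> Z" for z
    using that by (simp add: unip_def T1_def prj_same[OF Z])
  have g1': "unip T1 (- 1) z = prj Z z" if "z \<in> Z'" for z
    using that by (simp add: unip_def T1_def prj_same[OF Z'])
  have pp: "prj Z' (prj Z z) = z" if "z \<in> Z'" for z
    using unip_unip[OF T1, of 1 z] g1'[OF that] g1[OF prj(1)[OF Z]] by simp
  have pp': "prj Z (prj Z' z) = z" if "z \<in> Z" for z
    using unip_unip[OF T1, of "-1" z] g1[OF that] g1'[OF prj(1)[OF Z']] by simp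
  define \<psi> where "\<psi> z = \<phi> (prj Z z)" for z
  have \<psi>: "zlin Z' \<psi>"
    using zlinD[OF \<phi>(1) Zs(1)] prj(1)[OF Z] by (simp add: zlin_def \<psi>_def hlinearD[OF hlinear_prj[OF Z]])
  have "\<psi> ` Z' = UNIV"
  proof -
    have "\<phi> ` Z \<subseteq> \<psi> ` Z'"
    proof
      fix v assume "v \<in> \<phi> ` Z"
      then obtain z where "z \<in> Z" "v = \<phi> z" by blast
      then have "v = \<psi> (prj Z' z)" by (simp only: \<psi>_def pp')
      then show "v \<in> \<psi> ` Z'" using prj(1)[OF Z'] by blast
    qed
    then show ?thesis unfolding \<phi>(2) by blast
  qed
  from intermediate_surjection[OF Z' \<psi> this \<phi>']
  obtain \<theta> a b where \<theta>: "zlin Z' \<theta>" and a: "\<And>i. a i \<in> Z'" "\<And>i. \<psi> (a i) = axis i 1" "\<And>i. \<theta> (a i) = axis i 1"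
    and b: "\<And>i. b i \<in> Z'" "\<And>i. \<phi>' (b i) = axis i 1" "\<And>i. \<theta> (b i) = axis i 1" by blast
  obtain T2 where T2: "sqzero T2" "\<And>z. z \<in> Z' \<Longrightarrow> T2 z \<in> Z'" "\<And>z. z \<in> Z' \<Longrightarrow> \<theta> (z + T2 z) = \<psi> z"
    using sqzero_transport[OF Z' \<psi> \<theta> a] by blast
  obtain T3 where T3: "sqzero T3" "\<And>z. z \<in> Z' \<Longrightarrow> T3 z \<in> Z'" "\<And>z. z \<in> Z' \<Longrightarrow> \<phi>' (z + T3 z) = \<theta> z"
    using sqzero_transport[OF Z' \<theta> \<phi>'(1) b(1,3,2)] by blast
  define G where "G s = unip T3 (of_real s) \<circ> (unip T2 (of_real s) \<circ> unip T1 (of_real s))" for s :: real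
  have "bounded_family G"
    unfolding G_def by (intro bounded_family_comp bounded_family_unip T1 T2 T3)
  moreover have "G 0 = id" by (simp add: G_def fun_eq_iff unip_def)
  ultimately have "G 1 \<in> SpPlus" by (rule bounded_family_SpPlus)
  moreover have "G 1 ` Z = Z'"
  proof -
    have "unip T1 1 ` Z = Z'"
    proof
      show "unip T1 1 ` Z \<subseteq> Z'" using g1 prj(1)[OF Z'] by auto
      show "Z' \<subseteq> unip T1 1 ` Z"
      proof
        fix z assume "z \<in> Z'"
        then have "z = unip T1 1 (prj Z z)" by (simp only: g1[OF prj(1)[OF Z]] pp)
        then show "z \<in> unip T1 1 ` Z" using prj(1)[OF Z] by blast
      qed
    qed
    then show ?thesis
      by (simp only: G_def image_comp[symmetric] of_real_1 unip_image[OF T2(1) Zs'(1) T2(2)]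
          unip_image[OF T3(1) Zs'(1) T3(2)])
  qed
  moreover have "\<phi>' (G 1 z) = \<phi> z" if "z \<in> Z" for z
  proof -
    have z': "prj Z' z \<in> Z'" by (rule prj(1)[OF Z'])
    then have "unip T2 1 (prj Z' z) \<in> Z'" using unip_image[OF T2(1) Zs'(1) T2(2)] by blast
    with z' have "\<phi>' (unip T3 1 (unip T2 1 (prj Z' z))) = \<psi> (prj Z' z)"
      using T2(3) T3(3) by (simp add: unip_def)
    then show ?thesis by (simp add: G_def g1 that \<psi>_def pp')
  qed
  ultimately show ?thesis by blast
qed

section \<open>Lattices in \<open>F\<^sup>\<bottom>/F\<close>\<close>

lemma mem_coset: "(y::hp) \<in> x +o F \<longleftrightarrow> y - x \<in> F"
  using set_minus_plus[of y x F] by auto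

lemma coset_eq_iff:
  assumes "H'.subspace F"
  shows "x +o F = y +o F \<longleftrightarrow> x - y \<in> F"
proof
  assume "x +o F = y +o F"
  moreover have "x \<in> x +o F" using H'.subspace_0[OF assms] by (simp add: mem_coset)
  ultimately show "x - y \<in> F" by (simp add: mem_coset)
next
  assume xy: "x - y \<in> F"
  have "z - x \<in> F \<longleftrightarrow> z - y \<in> F" for z
  proof -
    have "z - y = (z - x) + (x - y)" "z - x = (z - y) - (x - y)" by simp_all
    then show ?thesis using xy by (metis H'.subspace_add H'.subspace_diff assms)
  qed
  then show "x +o F = y +o F" by (auto simp: mem_coset)
qed

lemma subspace_perp: "H'.subspace (perp S)"
  by (rule H'.subspaceI) (auto simp: perp_def hform_linear)

lemma qform_coset:
  assumes "F \<subseteq> perp F" "H'.subspace F" "x \<in> perp F" "y \<in> perp F"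
  shows "qform (x +o F) (y +o F) = hform x y"
proof -
  have "hform (x + f) (y + f') = hform x y" if "f \<in> F" "f' \<in> F" for f f'
  proof -
    have "hform f f' = 0" "hform x f' = 0" "hform y f = 0"
      using that assms by (auto simp: perp_def)
    then show ?thesis using hform_antisym[of f y] by (simp add: hform_linear)
  qed
  then have "(\<lambda>(x, y). hform x y) ` ((x +o F) \<times> (y +o F)) \<subseteq> {hform x y}"
    by (auto simp: elt_set_plus_def)
  moreover have "(x, y) \<in> (x +o F) \<times> (y +o F)"
    using H'.subspace_0[OF assms(2)] by (simp add: mem_coset)
  ultimately have "(\<lambda>(x, y). hform x y) ` ((x +o F) \<times> (y +o F)) = {hform x y}"
    by (intro subset_antisym) force+
  then show ?thesis by (simp add: qform_def)
qed

text \<open>The condition in \<open>lattice_in\<close> with the basis made explicit.\<close>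

definition lattice_basis :: "hp set \<Rightarrow> nat \<Rightarrow> hp set set \<Rightarrow> (nat \<Rightarrow> hp) \<Rightarrow> bool" where
  "lattice_basis F r L e \<longleftrightarrow> (\<forall>i<r. e i \<in> perp F) \<and>
     (\<forall>c :: nat \<Rightarrow> real. (\<Sum>i<r. hscale (of_real (c i)) (e i)) \<in> F \<longrightarrow> (\<forall>i<r. c i = 0)) \<and>
     L = {(\<Sum>i<r. hscale (of_int (n i)) (e i)) +o F | n :: nat \<Rightarrow> int. True}"

lemma lattice_in_iff: "lattice_in F r L \<longleftrightarrow> (\<exists>e. lattice_basis F r L e)"
  by (simp add: lattice_in_def lattice_basis_def)

lemma lattice_basis_mem:
  assumes "lattice_basis F r L e" "j < r"
  shows "e j +o F \<in> L"
proof -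
  have "(\<Sum>i<r. hscale (of_int (if i = j then 1 else 0)) (e i)) = (\<Sum>i<r. if i = j then e j else 0)"
    by (intro sum.cong) auto
  also have "\<dots> = e j" using assms(2) by simp
  finally have "e j +o F = (\<Sum>i<r. hscale (of_int (if i = j then 1 else 0)) (e i)) +o F" by simp
  then show ?thesis
    using assms(1) unfolding lattice_basis_def
    by (auto intro!: exI[of _ "\<lambda>i. if i = j then 1 else 0"])
qed

lemma lattice_real_iff:
  assumes F: "H'.subspace F" and e: "lattice_basis F r L e"
  shows "x +o F \<in> lattice_real F L \<longleftrightarrow> (\<exists>c :: nat \<Rightarrow> real. x - (\<Sum>i<r. hscale (of_real (c i)) (e i)) \<in> F)"
proof
  assume "x +o F \<in> lattice_real F L"
  then obtain k and c :: "nat \<Rightarrow> real" and y where y: "x - (\<Sum>i<k. hscale (of_real (c i)) (y i)) \<in> F"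
    "\<And>i. i < k \<Longrightarrow> y i +o F \<in> L"
    unfolding lattice_real_def mem_Collect_eq coset_eq_iff[OF F] by blast
  have "\<exists>n. y i - (\<Sum>j<r. hscale (of_int (n j)) (e j)) \<in> F" if "i < k" for i
    using y(2)[OF that] e unfolding lattice_basis_def by (auto simp only: mem_Collect_eq coset_eq_iff[OF F])
  then obtain n where n: "\<And>i. i < k \<Longrightarrow> y i - (\<Sum>j<r. hscale (of_int (n i j)) (e j)) \<in> F" by metis
  define d where "d j = (\<Sum>i<k. c i * of_int (n i j))" for j
  have "(\<Sum>j<r. hscale (of_real (d j)) (e j)) =
      (\<Sum>j<r. \<Sum>i<k. hscale (of_real (c i)) (hscale (of_int (n i j)) (e j)))"
    by (simp add: d_def H'.scale_sum_left)
  also have "\<dots> = (\<Sum>i<k. hscale (of_real (c i)) (\<Sum>j<r. hscale (of_int (n i j)) (e j)))"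
    by (subst sum.swap) (simp add: H'.scale_sum_right)
  finally have d: "(\<Sum>j<r. hscale (of_real (d j)) (e j)) =
      (\<Sum>i<k. hscale (of_real (c i)) (\<Sum>j<r. hscale (of_int (n i j)) (e j)))" .
  have "(\<Sum>i<k. hscale (of_real (c i)) (y i - (\<Sum>j<r. hscale (of_int (n i j)) (e j)))) \<in> F"
    by (intro H'.subspace_sum H'.subspace_scale F n) simp
  then have "(\<Sum>i<k. hscale (of_real (c i)) (y i)) - (\<Sum>j<r. hscale (of_real (d j)) (e j)) \<in> F"
    by (simp add: d H'.scale_right_diff_distrib sum_subtractf)
  from H'.subspace_add[OF F y(1) this]
  show "\<exists>c :: nat \<Rightarrow> real. x - (\<Sum>i<r. hscale (of_real (c i)) (e i)) \<in> F"
    by (intro exI[of _ d]) simp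
next
  assume "\<exists>c :: nat \<Rightarrow> real. x - (\<Sum>i<r. hscale (of_real (c i)) (e i)) \<in> F"
  then show "x +o F \<in> lattice_real F L"
    unfolding lattice_real_def mem_Collect_eq coset_eq_iff[OF F] using lattice_basis_mem[OF e] by blast
qed

lemma lattice_real_closed:
  assumes F: "H'.subspace F" and e: "lattice_basis F r L e"
  shows "x +o F \<in> lattice_real F L \<Longrightarrow> y +o F \<in> lattice_real F L \<Longrightarrow> (x + y) +o F \<in> lattice_real F L"
    and "x +o F \<in> lattice_real F L \<Longrightarrow> hscale (of_real a) x +o F \<in> lattice_real F L"
    and "x +o F \<in> lattice_real F L \<Longrightarrow> y +o F \<in> lattice_real F L \<Longrightarrow> (x - y) +o F \<in> lattice_real F L"
proof -
  note iff = lattice_real_iff[OF F e]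
  show add: "(x + y) +o F \<in> lattice_real F L" if "x +o F \<in> lattice_real F L" "y +o F \<in> lattice_real F L" for x y
  proof -
    obtain c d :: "nat \<Rightarrow> real" where "x - (\<Sum>i<r. hscale (of_real (c i)) (e i)) \<in> F"
      "y - (\<Sum>i<r. hscale (of_real (d i)) (e i)) \<in> F" using \<open>x +o F \<in> _\<close> \<open>y +o F \<in> _\<close> iff by blast
    from H'.subspace_add[OF F this]
    have "x + y - (\<Sum>i<r. hscale (of_real (c i + d i)) (e i)) \<in> F"
      by (simp add: H'.scale_left_distrib sum.distrib algebra_simps)
    then show ?thesis unfolding iff by (rule exI[of _ "\<lambda>i. c i + d i"])
  qed
  show sc: "hscale (of_real a) x +o F \<in> lattice_real F L" if "x +o F \<in> lattice_real F L" for x a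
  proof -
    obtain c :: "nat \<Rightarrow> real" where "x - (\<Sum>i<r. hscale (of_real (c i)) (e i)) \<in> F"
      using \<open>x +o F \<in> _\<close> iff by blast
    from H'.subspace_scale[OF F this, of "of_real a"]
    have "hscale (of_real a) x - (\<Sum>i<r. hscale (of_real (a * c i)) (e i)) \<in> F"
      by (simp add: H'.scale_right_diff_distrib H'.scale_sum_right)
    then show ?thesis unfolding iff by (rule exI[of _ "\<lambda>i. a * c i"])
  qed
  show "(x - y) +o F \<in> lattice_real F L" if "x +o F \<in> lattice_real F L" "y +o F \<in> lattice_real F L"
    using add[OF that(1) sc[OF that(2), of "-1"]] by simp
qed

text \<open>A unimodular form has a dual basis, which separates real and imaginary parts:
  \<open>L\<^sub>\<real>\<close> and \<open>i L\<^sub>\<real>\<close> meet trivially in \<open>F\<^sup>\<bottom>/F\<close>.\<close>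

lemma lattice_real_Int_imag:
  assumes F: "H'.subspace F" "F \<subseteq> perp F" and e: "lattice_basis F r L e"
    and uni: "unimodular L (\<lambda>x y. qform x y / (2 * of_real pi * \<i>))"
    and x: "x +o F \<in> lattice_real F L" and y: "y +o F \<in> lattice_real F L" and xy: "x - hscale \<i> y \<in> F"
  shows "x \<in> F" "y \<in> F"
proof -
  have eperp: "\<And>i. i < r \<Longrightarrow> e i \<in> perp F"
    and eind: "\<And>c :: nat \<Rightarrow> real. (\<Sum>i<r. hscale (of_real (c i)) (e i)) \<in> F \<Longrightarrow> (\<forall>i<r. c i = 0)"
    and L: "L = {(\<Sum>i<r. hscale (of_int (n i)) (e i)) +o F | n :: nat \<Rightarrow> int. True}"
    using e by (auto simp: lattice_basis_def)
  define s where "s n = (\<Sum>i<r. hscale (of_int (n i)) (e i))" for n :: "nat \<Rightarrow> int"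
  have sadd: "s n + s m = s (\<lambda>i. n i + m i)" for n m
    by (simp add: s_def H'.scale_left_distrib sum.distrib)
  have sinj: "n i = m i" if "s n +o F = s m +o F" "i < r" for n m i
  proof -
    have "s n - s m \<in> F" using that by (simp add: coset_eq_iff F)
    then have "(\<Sum>i<r. hscale (of_real (of_int (n i - m i))) (e i)) \<in> F"
      by (simp add: s_def H'.scale_left_diff_distrib sum_subtractf)
    from eind[OF this] that(2) have "of_int (n i - m i) = (0::real)" by blast
    then show ?thesis by simp
  qed
  have FF: "F + F = F"
    using H'.subspace_add[OF F(1)] H'.subspace_0[OF F(1)] by (force simp: set_plus_def)
  define crd where "crd A = (SOME n. A = s n +o F)" for A
  have crd: "crd (s n +o F) i = n i" if "i < r" for n i
  proof (rule sinj[symmetric, OF _ that])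
    show "s n +o F = s (crd (s n +o F)) +o F" 
      unfolding crd_def by (rule someI[of "\<lambda>m. s n +o F = s m +o F" n]) (rule refl)
  qed
  have Ls: "A \<in> L \<longleftrightarrow> (\<exists>n. A = s n +o F)" for A by (auto simp: L s_def)
  \<comment> \<open>The vector dual to \<open>e j\<close>, from unimodularity applied to the \<open>j\<close>-th coordinate.\<close>
  have dual: "\<exists>a\<in>perp F. \<forall>k<r. hform a (e k) = (if k = j then 2 * of_real pi * \<i> else 0)" if j: "j < r" for j
  proof -
    have "\<forall>x\<in>L. \<forall>y\<in>L. crd (x + y) j = crd x j + crd y j"
      using j by (auto simp: Ls set_plus_rearrange FF sadd crd)
    with uni have "\<exists>!A. A \<in> L \<and> (\<forall>y\<in>L. qform A y / (2 * of_real pi * \<i>) = of_int (crd y j))"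
      unfolding unimodular_def by (elim conjE allE[of _ "\<lambda>A. crd A j"] mp)
    then obtain A where A: "A \<in> L" "\<And>y. y \<in> L \<Longrightarrow> qform A y / (2 * of_real pi * \<i>) = of_int (crd y j)"
      by blast
    obtain n where n: "A = s n +o F" using A(1) Ls by blast
    have "s n \<in> perp F" unfolding s_def
      by (intro H'.subspace_sum H'.subspace_scale subspace_perp eperp) simp
    have "hform (s n) (e k) = (if k = j then 2 * of_real pi * \<i> else 0)" if k: "k < r" for k
    proof -
      have "s (\<lambda>i. if i = k then 1 else 0) = (\<Sum>i<r. if i = k then e k else 0)"
        unfolding s_def by (intro sum.cong) auto
      then have ek: "e k = s (\<lambda>i. if i = k then 1 else 0)" using k by simp
      have "qform A (e k +o F) / (2 * of_real pi * \<i>) = of_int (crd (e k +o F) j)"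
        by (intro A(2) lattice_basis_mem[OF e] k)
      moreover have "qform A (e k +o F) = hform (s n) (e k)"
        unfolding n by (intro qform_coset F \<open>s n \<in> perp F\<close> eperp k)
      moreover have "crd (e k +o F) j = (if j = k then 1 else 0)"
        unfolding ek by (rule crd[OF j])
      ultimately show ?thesis by (auto simp: field_simps split: if_splits)
    qed
    then show ?thesis using \<open>s n \<in> perp F\<close> by blast
  qed
  obtain c where c: "x - (\<Sum>i<r. hscale (of_real (c i)) (e i)) \<in> F" using x lattice_real_iff[OF F(1) e] by blast
  obtain d where d: "y - (\<Sum>i<r. hscale (of_real (d i)) (e i)) \<in> F" using y lattice_real_iff[OF F(1) e] by blast
  have "(x - hscale \<i> y) - (x - (\<Sum>i<r. hscale (of_real (c i)) (e i))) + hscale \<i> (y - (\<Sum>i<r. hscale (of_real (d i)) (e i))) \<in> F"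
    by (intro H'.subspace_add H'.subspace_diff H'.subspace_scale F xy c d)
  then have cd: "(\<Sum>i<r. hscale (of_real (c i) - \<i> * of_real (d i)) (e i)) \<in> F"
    by (simp add: H'.scale_left_diff_distrib H'.scale_right_diff_distrib sum_subtractf H'.scale_sum_right algebra_simps)
  have cd0: "c j = 0 \<and> d j = 0" if j: "j < r" for j
  proof -
    obtain a where aF: "a \<in> perp F" and a: "\<And>k. k < r \<Longrightarrow> hform a (e k) = (if k = j then 2 * of_real pi * \<i> else 0)"
      using dual[OF j] by blast
    have "hform a (\<Sum>i<r. hscale (of_real (c i) - \<i> * of_real (d i)) (e i)) =
        (\<Sum>i<r. if i = j then (of_real (c j) - \<i> * of_real (d j)) * (2 * of_real pi * \<i>) else 0)"
      unfolding hform_linear by (intro sum.cong) (auto simp: a)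
    also have "\<dots> = (of_real (c j) - \<i> * of_real (d j)) * (2 * of_real pi * \<i>)" using j by simp
    finally have "hform a (\<Sum>i<r. hscale (of_real (c i) - \<i> * of_real (d i)) (e i)) =
        (of_real (c j) - \<i> * of_real (d j)) * (2 * of_real pi * \<i>)" .
    moreover have "hform a (\<Sum>i<r. hscale (of_real (c i) - \<i> * of_real (d i)) (e i)) = 0"
      using aF cd by (simp add: perp_def)
    ultimately have "of_real (c j) - \<i> * of_real (d j) = 0" by simp
    then show ?thesis by (auto simp: complex_eq_iff)
  qed
  show "x \<in> F" using c cd0 by simp
  show "y \<in> F" using d cd0 by simp
qed

section \<open>Conjugation on a marked complement\<close>

lemma scaleR_eq_scalar: "c *\<^sub>R v = of_real c *s (v :: complex^'n)"
proof (rule vec_eq_iff[THEN iffD2], rule allI)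
  fix i
  have "(c *\<^sub>R v) $ i = of_real c * v $ i"
    unfolding vector_scaleR_component by (rule scaleR_conv_of_real)
  then show "(c *\<^sub>R v) $ i = (of_real c *s v) $ i" by simp
qed

lemma ppavD:
  assumes "ppav \<Lambda> B"
  shows "B u (v + w) = B u v + B u w" "B u (c *s v) = c * B u v" "B v u = cnj (B u v)"
    "u \<noteq> 0 \<Longrightarrow> 0 < Re (B u u)" "unimodular \<Lambda> (\<lambda>u v. of_real (Im (B u v)))"
    "B (v + w) u = B v u + B w u" "B (c *s v) u = cnj c * B v u" "B u 0 = 0" "B 0 u = 0"
    "B u (v - w) = B u v - B u w"
proof -
  show a: "B u (v + w) = B u v + B u w" and c: "B u (c *s v) = c * B u v" and h: "B v u = cnj (B u v)"
    and "u \<noteq> 0 \<Longrightarrow> 0 < Re (B u u)" and "unimodular \<Lambda> (\<lambda>u v. of_real (Im (B u v)))" for u v w c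
    using assms[unfolded ppav_def] by blast+
  show "B (v + w) u = B v u + B w u" "B (c *s v) u = cnj c * B v u"
    unfolding h[of "v + w" u] h[of "c *s v" u] h[of v u] h[of w u] by (simp_all add: a c)
  show z: "B u 0 = 0" for u using a[of u 0 0] by simp
  show "B 0 u = 0" unfolding h[of 0 u] z by simp
  show "B u (v - w) = B u v - B u w" using a[of u "v - w" w] by simp
qed

text \<open>A lattice basis, enumerated; it spans \<open>\<complex>\<^sup>g\<close> over \<open>\<real>\<close> because \<open>2g\<close> is the real dimension.\<close>

lemma ppav_basis:
  fixes \<Lambda> :: "(complex^'n) set"
  assumes "ppav \<Lambda> B"
  shows "\<exists>E :: nat \<Rightarrow> complex^'n.
    (\<forall>c. (\<Sum>i<2 * CARD('n). c i *\<^sub>R E i) = 0 \<longrightarrow> (\<forall>i<2 * CARD('n). c i = 0)) \<and>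
    (\<forall>v. \<exists>c. v = (\<Sum>i<2 * CARD('n). c i *\<^sub>R E i)) \<and>
    \<Lambda> = {\<Sum>i<2 * CARD('n). of_int (k i) *\<^sub>R E i | k :: nat \<Rightarrow> int. True}"
proof -
  let ?r = "2 * CARD('n)"
  obtain E where E: "independent E" "card E = ?r"
    "\<Lambda> = {\<Sum>e\<in>E. of_int (k e) *\<^sub>R e | k :: complex^'n \<Rightarrow> int. True}"
    using assms unfolding ppav_def by blast
  have fin: "finite E" using E(2) card_ge_0_finite[of E] by simp
  obtain f where f: "bij_betw f {..<?r} E"
    using ex_bij_betw_nat_finite[OF fin] E(2) by (auto simp: atLeast0LessThan)
  define f' where "f' = the_inv_into {..<?r} f"
  have f': "f' (f i) = i" if "i < ?r" for i
    using that f by (simp add: f'_def the_inv_into_f_f bij_betw_def)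
  have re: "(\<Sum>i<?r. g (f i)) = sum g E" for g :: "complex^'n \<Rightarrow> complex^'n"
    by (rule sum.reindex_bij_betw[OF f])
  have re': "(\<Sum>i<?r. c i *\<^sub>R f i) = (\<Sum>e\<in>E. c (f' e) *\<^sub>R e)" for c :: "nat \<Rightarrow> real"
    unfolding re[symmetric] by (rule sum.cong) (auto simp: f')
  show ?thesis
  proof (intro exI[of _ f] conjI allI impI)
    fix c :: "nat \<Rightarrow> real" and i
    assume "(\<Sum>i<?r. c i *\<^sub>R f i) = 0" "i < ?r"
    then have "c (f' e) = 0" if "e \<in> E" for e
      using independentD[OF E(1) fin order_refl, of "\<lambda>e. c (f' e)" e] that unfolding re' by blast
    moreover have "f i \<in> E" using f \<open>i < ?r\<close> by (auto simp: bij_betw_def)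
    ultimately show "c i = 0" using f'[OF \<open>i < ?r\<close>] by metis
  next
    fix v
    have "span E = UNIV"
      using E(1,2) card_eq_dim[of E UNIV] fin by auto
    then obtain u where "v = (\<Sum>e\<in>E. u e *\<^sub>R e)"
      using span_finite[OF fin] by blast
    then show "\<exists>c. v = (\<Sum>i<?r. c i *\<^sub>R f i)"
      using re[of "\<lambda>e. u e *\<^sub>R e"] by (intro exI[of _ "\<lambda>i. u (f i)"]) simp
  next
    show "\<Lambda> = {\<Sum>i<?r. of_int (k i) *\<^sub>R f i | k :: nat \<Rightarrow> int. True}"
    proof (rule set_eqI, rule iffI)
      fix l assume "l \<in> \<Lambda>"
      then obtain k :: "complex^'n \<Rightarrow> int" where "l = (\<Sum>e\<in>E. of_int (k e) *\<^sub>R e)" using E(3) by blast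
      then have "l = (\<Sum>i<?r. of_int (k (f i)) *\<^sub>R f i)"
        using re[of "\<lambda>e. of_int (k e) *\<^sub>R e"] by simp
      then show "l \<in> {\<Sum>i<?r. of_int (k i) *\<^sub>R f i | k :: nat \<Rightarrow> int. True}"
        by (intro CollectI exI[of _ "\<lambda>i. k (f i)"] conjI TrueI)
    next
      fix l assume "l \<in> {\<Sum>i<?r. of_int (k i) *\<^sub>R f i | k :: nat \<Rightarrow> int. True}"
      then obtain k :: "nat \<Rightarrow> int" where "l = (\<Sum>i<?r. of_int (k i) *\<^sub>R f i)" by blast
      then have "l = (\<Sum>e\<in>E. of_int (k (f' e)) *\<^sub>R e)" using re'[of "\<lambda>i. of_int (k i)"] by simp
      then show "l \<in> \<Lambda>"
        unfolding E(3) by (intro CollectI exI[of _ "\<lambda>e. k (f' e)"] conjI TrueI)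
    qed
  qed
qed

definition zker :: "hp set \<Rightarrow> (hp \<Rightarrow> complex^'n) \<Rightarrow> hp set" where
  "zker Z \<phi> = {u \<in> Z. \<phi> u = 0}"

text \<open>The element of \<open>H'\<^sub>+\<close> that represents \<open>\<pi> B(\<phi>(u), \<phi>(\<cdot>))\<close> on \<open>Z\<close>. Since \<open>B\<close> is
  \<open>\<langle>u\<^sup>-,v\<rangle>/\<pi>\<close>, this is what the conjugate of \<open>u\<close> has to be.\<close>

definition conj_lift :: "(complex^'n \<Rightarrow> complex^'n \<Rightarrow> complex) \<Rightarrow> hp set \<Rightarrow> (hp \<Rightarrow> complex^'n) \<Rightarrow> hp \<Rightarrow> hp" where
  "conj_lift B Z \<phi> u = (THE h. h \<in> Hplus \<and> (\<forall>v\<in>Z. hform h v = of_real pi * B (\<phi> u) (\<phi> v)))"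

text \<open>A real vector of \<open>F\<^sup>\<bottom>/F = Z/F \<oplus> F\<^sup>\<bottom>\<^sub>+\<close> has the form \<open>u + u\<^sup>-\<close>, hence a lattice vector is recovered from
  its component in \<open>Z/F\<close>.\<close>

definition canonical_lattice :: "(complex^'n) set \<Rightarrow> (complex^'n \<Rightarrow> complex^'n \<Rightarrow> complex)
    \<Rightarrow> hp set \<Rightarrow> (hp \<Rightarrow> complex^'n) \<Rightarrow> hp set set" where
  "canonical_lattice \<Lambda> B Z \<phi> = {(u + conj_lift B Z \<phi> u) +o zker Z \<phi> | u. u \<in> Z \<and> \<phi> u \<in> \<Lambda>}"

text \<open>The data \<open>(Z, \<phi>)\<close> of a point from which \<open>F\<close> and \<open>L\<close> are reconstructed.\<close>

locale marked_complement =
  fixes \<Lambda> :: "(complex^'n) set" and B :: "complex^'n \<Rightarrow> complex^'n \<Rightarrow> complex"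
    and Z :: "hp set" and \<phi> :: "hp \<Rightarrow> complex^'n"
  assumes ppav: "ppav \<Lambda> B" and Z: "lagrangian_complement Z"
    and phi: "zlin Z \<phi>" and phi_surj: "\<phi> ` Z = UNIV"
begin

abbreviation "F \<equiv> zker Z \<phi>"
abbreviation "hl \<equiv> conj_lift B Z \<phi>"

lemmas Zs = lagrangian_complementD[OF Z]
lemmas phil = zlinD[OF phi Zs(1)]
lemmas Bs = ppavD[OF ppav]
lemmas Bs' = Bs(1,2,6-10)

lemma F_subspace: "H'.subspace F"
  by (rule H'.subspaceI) (auto simp: zker_def phil intro: hp_subspace_closed[OF Zs(1)])

lemma F_Z: "F \<subseteq> Z"
  by (auto simp: zker_def)

lemma Z_perp_F: "Z \<subseteq> perp F"
  using F_Z Zs(4) by (auto simp: perp_def)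

lemma F_perp_F: "F \<subseteq> perp F"
  using F_Z Z_perp_F by blast

lemma diff_in_F: "u \<in> Z \<Longrightarrow> v \<in> Z \<Longrightarrow> u - v \<in> F \<longleftrightarrow> \<phi> u = \<phi> v"
  by (simp add: zker_def phil H'.subspace_diff[OF Zs(1)])

lemma hl_unique:
  assumes "h \<in> Hplus" "\<And>v. v \<in> Z \<Longrightarrow> hform h v = of_real pi * B (\<phi> u) (\<phi> v)"
  shows "hl u = h"
  unfolding conj_lift_def
proof (rule the_equality)
  fix h' assume h': "h' \<in> Hplus \<and> (\<forall>v\<in>Z. hform h' v = of_real pi * B (\<phi> u) (\<phi> v))"
  have "h' - h = 0"
    by (rule Hplus_orth_eq_0[OF Z]) (use assms h' Hplus_subspace in \<open>auto simp: hform_diff H'.subspace_diff\<close>)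
  then show "h' = h" by simp
qed (use assms in auto)

lemma hl:
  shows "hl u \<in> Hplus" and "v \<in> Z \<Longrightarrow> hform (hl u) v = of_real pi * B (\<phi> u) (\<phi> v)"
proof -
  have "\<exists>h\<in>Hplus. \<forall>v\<in>Z. hform h v = of_real pi * B (\<phi> u) (\<phi> v)"
    by (rule functional_on_complement[OF Z]) (simp_all add: phil Bs' algebra_simps)
  then obtain h where h: "h \<in> Hplus" "\<And>v. v \<in> Z \<Longrightarrow> hform h v = of_real pi * B (\<phi> u) (\<phi> v)" by blast
  then have "hl u = h" by (rule hl_unique)
  with h show "hl u \<in> Hplus" "v \<in> Z \<Longrightarrow> hform (hl u) v = of_real pi * B (\<phi> u) (\<phi> v)" by auto
qed

lemma hl_cong: "\<phi> u = \<phi> v \<Longrightarrow> hl u = hl v"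
  by (simp add: conj_lift_def)

lemma hl_add: "u \<in> Z \<Longrightarrow> v \<in> Z \<Longrightarrow> hl (u + v) = hl u + hl v"
  by (rule hl_unique) (simp_all add: hl H'.subspace_add[OF Hplus_subspace] hform_linear phil Bs' algebra_simps)

lemma hl_scale: "u \<in> Z \<Longrightarrow> hl (hscale c u) = hscale (cnj c) (hl u)"
  by (rule hl_unique) (simp_all add: hl H'.subspace_scale[OF Hplus_subspace] hform_linear phil Bs' algebra_simps)

lemma hl_0: "hl 0 = 0"
  by (rule hl_unique) (simp_all add: H'.subspace_0 Hplus_subspace phil Bs')

lemma hl_sum: "(\<And>i. i \<in> A \<Longrightarrow> f i \<in> Z) \<Longrightarrow> hl (sum f A) = (\<Sum>i\<in>A. hl (f i))"
proof (induction A rule: infinite_finite_induct)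
  case (insert i A)
  have "sum f A \<in> Z" using insert.prems by (intro H'.subspace_sum Zs) auto
  with insert show ?case by (simp add: hl_add)
qed (simp_all add: hl_0)

lemma hl_perp: "hl u \<in> perp F"
  unfolding perp_def by (auto simp: zker_def hl Bs')

text \<open>Nondegeneracy of \<open>B\<close>: every element of \<open>F\<^sup>\<bottom>\<^sub>+\<close> is the conjugate of some \<open>u \<in> Z\<close>.\<close>

lemma hl_onto:
  assumes "h \<in> Hplus" "h \<in> perp F"
  shows "\<exists>u\<in>Z. hl u = h"
proof -
  obtain s where s: "\<And>v. s v \<in> Z" "\<And>v. \<phi> (s v) = v" using ex_section[OF phi_surj] by blast
  define w where "w i = s (axis i 1)" for i
  have w: "\<And>i. w i \<in> Z" "\<And>i. \<phi> (w i) = axis i 1" by (simp_all add: w_def s)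
  define f where "f x = (\<chi> i. B (axis i 1) x)" for x
  have lin: "Vector_Spaces.linear (*s) (*s) f"
    by (unfold_locales) (auto simp: f_def vec_eq_iff Bs' algebra_simps)
  have expand: "B y x = (\<Sum>i\<in>UNIV. cnj (y $ i) * B (axis i 1) x)" for x y
  proof -
    have "B (\<Sum>i\<in>A. y $ i *s axis i 1) x = (\<Sum>i\<in>A. cnj (y $ i) * B (axis i 1) x)" for A :: "'n set"
      by (induction A rule: infinite_finite_induct) (simp_all add: Bs')
    from this[of UNIV] show ?thesis by (simp add: basis_expansion)
  qed
  have "inj f"
  proof (rule injI)
    fix x y assume "f x = f y"
    then have "B (axis i 1) x = B (axis i 1) y" for i by (simp add: f_def vec_eq_iff)
    then have "B (x - y) x = B (x - y) y" by (simp add: expand[of "x - y"])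
    then have "B (x - y) (x - y) = 0" by (simp add: Bs')
    then show "x = y" using Bs(4)[of "x - y"] by force
  qed
  then have "surj f" by (rule vec.linear_inj_imp_surj[OF lin])
  then obtain x where x: "f x = (\<chi> i. cnj (hform h (w i) / of_real pi))" by (metis surjD)
  obtain u where u: "u \<in> Z" "\<phi> u = x" using phi_surj by (metis UNIV_I imageE)
  have "hl u = h"
  proof (rule hl_unique)
    fix v assume v: "v \<in> Z"
    define v' where "v' = (\<Sum>i\<in>UNIV. hscale (\<phi> v $ i) (w i))"
    have v'Z: "v' \<in> Z" unfolding v'_def by (intro H'.subspace_sum H'.subspace_scale Zs w)
    have "\<phi> v' = \<phi> v" unfolding v'_def by (simp add: phil w H'.subspace_scale Zs basis_expansion)
    then have "v' - v \<in> F" using v v'Z by (simp add: diff_in_F)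
    then have "hform h v = hform h v'" using assms(2) by (auto simp: perp_def hform_diff)
    also have "\<dots> = (\<Sum>i\<in>UNIV. \<phi> v $ i * hform h (w i))" by (simp add: v'_def hform_linear)
    also have "\<dots> = of_real pi * B x (\<phi> v)"
    proof -
      have "B (axis i 1) x = cnj (hform h (w i)) / of_real pi" for i
        using x by (simp add: f_def vec_eq_iff)
      then have "cnj (B x (\<phi> v)) * of_real pi = (\<Sum>i\<in>UNIV. cnj (\<phi> v $ i) * cnj (hform h (w i)))"
        using Bs(3)[of "\<phi> v" x] expand[of "\<phi> v" x] by (simp add: sum_divide_distrib[symmetric] divide_eq_eq)
      then have "cnj (cnj (B x (\<phi> v)) * of_real pi) = (\<Sum>i\<in>UNIV. \<phi> v $ i * hform h (w i))"
        by (simp add: cnj_sum)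
      then show ?thesis by (simp add: mult.commute)
    qed
    finally show "hform h v = of_real pi * B (\<phi> u) (\<phi> v)" by (simp add: u)
  qed fact
  with u show ?thesis by blast
qed

text \<open>The real vector with component \<open>u\<close> in \<open>Z/F\<close>.\<close>

definition rl :: "hp \<Rightarrow> hp" where "rl u = u + hl u"

lemma rl_perp: "u \<in> Z \<Longrightarrow> rl u \<in> perp F"
  unfolding rl_def using Z_perp_F hl_perp by (intro H'.subspace_add subspace_perp) auto

lemma rl_add: "u \<in> Z \<Longrightarrow> v \<in> Z \<Longrightarrow> rl (u + v) = rl u + rl v"
  by (simp add: rl_def hl_add)

lemma rl_scale: "u \<in> Z \<Longrightarrow> rl (hscale (of_real c) u) = hscale (of_real c) (rl u)"
  by (simp add: rl_def hl_scale H'.scale_right_distrib)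

lemma rl_sum: "(\<And>i. i \<in> A \<Longrightarrow> f i \<in> Z) \<Longrightarrow> rl (sum f A) = (\<Sum>i\<in>A. rl (f i))"
  by (simp add: rl_def hl_sum sum.distrib)

lemma rl_diff_F: "u \<in> Z \<Longrightarrow> v \<in> Z \<Longrightarrow> rl u - rl v \<in> F \<longleftrightarrow> \<phi> u = \<phi> v"
proof
  assume uv: "u \<in> Z" "v \<in> Z"
  { assume "rl u - rl v \<in> F"
    then have "(u - v) + (hl u - hl v) \<in> Z" using F_Z by (auto simp: rl_def algebra_simps)
    then have "hl u - hl v \<in> Z"
      using H'.subspace_diff[OF Zs(1) _ H'.subspace_diff[OF Zs(1) uv]] by force
    then have "hl u - hl v = 0" using Zs(3) H'.subspace_diff[OF Hplus_subspace hl(1) hl(1)] by blast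
    with \<open>rl u - rl v \<in> F\<close> have "u - v \<in> F" by (simp add: rl_def)
    then show "\<phi> u = \<phi> v" using uv by (simp add: diff_in_F) }
  assume "\<phi> u = \<phi> v"
  then show "rl u - rl v \<in> F" using uv hl_cong[of u v] by (simp add: rl_def diff_in_F)
qed

text \<open>On real vectors the symplectic form is \<open>2\<pi>i\<close> times the imaginary part of \<open>B\<close>, which is how
  unimodularity passes between \<open>\<Lambda>\<close> and \<open>L\<close>.\<close>

lemma hform_rl:
  assumes "u \<in> Z" "v \<in> Z"
  shows "hform (rl u) (rl v) = 2 * of_real pi * \<i> * of_real (Im (B (\<phi> u) (\<phi> v)))"
proof -
  have "hform (rl u) (rl v) = hform u (hl v) + hform (hl u) v"
    using assms by (simp add: rl_def hform_linear Zs hform_Hplus hl(1))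
  also have "\<dots> = of_real pi * (B (\<phi> u) (\<phi> v) - cnj (B (\<phi> u) (\<phi> v)))"
    using assms hform_antisym[of u "hl v"] Bs(3)[of "\<phi> v" "\<phi> u"] by (simp add: hl algebra_simps)
  finally show ?thesis by (simp add: complex_diff_cnj)
qed

end

section \<open>The canonical lattice\<close>

lemma coset_add:
  assumes "H'.subspace F"
  shows "(x +o F) + (y +o F) = (x + y) +o F"
proof -
  have "F + F = F"
    using H'.subspace_add[OF assms] H'.subspace_0[OF assms] by (force simp: set_plus_def)
  then show ?thesis by (simp add: set_plus_rearrange)
qed

context marked_complement
begin

abbreviation "L \<equiv> canonical_lattice \<Lambda> B Z \<phi>"

lemma L_iff: "A \<in> L \<longleftrightarrow> (\<exists>u\<in>Z. \<phi> u \<in> \<Lambda> \<and> A = rl u +o F)"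
  by (auto simp: canonical_lattice_def rl_def)

text \<open>By definiteness of \<open>B\<close>, a vector of \<open>Z/F\<close> is determined by its conjugate.\<close>

lemma hl_inj:
  assumes "u \<in> Z" "v \<in> Z" "hl u = hl v"
  shows "\<phi> u = \<phi> v"
proof -
  have *: "B (\<phi> u) (\<phi> w) = B (\<phi> v) (\<phi> w)" if "w \<in> Z" for w
    using that hl(2)[of w u] hl(2)[of w v] assms(3) by simp
  have "u - v \<in> Z" using assms by (intro H'.subspace_diff Zs)
  then have "B (\<phi> u) (\<phi> u - \<phi> v) = B (\<phi> v) (\<phi> u - \<phi> v)"
    using *[of "u - v"] assms by (simp add: phil)
  moreover have "B (\<phi> u - \<phi> v + \<phi> v) (\<phi> u - \<phi> v) = B (\<phi> u - \<phi> v) (\<phi> u - \<phi> v) + B (\<phi> v) (\<phi> u - \<phi> v)"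
    by (rule Bs(6))
  ultimately have "B (\<phi> u - \<phi> v) (\<phi> u - \<phi> v) = 0" by simp
  then show ?thesis using Bs(4)[of "\<phi> u - \<phi> v"] by force
qed

lemma canonical_lattice_basis:
  shows "\<exists>e u. lattice_basis F (2 * CARD('n)) L e \<and> (\<forall>i. u i \<in> Z \<and> e i = rl (u i)) \<and>
    (\<forall>v\<in>Z. \<exists>c :: nat \<Rightarrow> real. \<phi> v = \<phi> (\<Sum>i<2 * CARD('n). hscale (of_real (c i)) (u i)))"
proof -
  let ?r = "2 * CARD('n)"
  obtain E where E0: "\<forall>c. (\<Sum>i<?r. c i *\<^sub>R E i) = 0 \<longrightarrow> (\<forall>i<?r. c i = 0)"
    "\<forall>v. \<exists>c. v = (\<Sum>i<?r. c i *\<^sub>R E i)"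
    "\<Lambda> = {\<Sum>i<?r. of_int (k i) *\<^sub>R E i | k :: nat \<Rightarrow> int. True}"
    using ppav_basis[OF ppav] by (elim exE conjE)
  have E: "c i = 0" if "(\<Sum>i<?r. c i *\<^sub>R E i) = 0" "i < ?r" for c i
    using E0(1) that by blast
  obtain r where r: "\<And>v. r v \<in> Z" "\<And>v. \<phi> (r v) = v" using ex_section[OF phi_surj] by blast
  define u where "u i = r (E i)" for i
  have u: "\<And>i. u i \<in> Z" "\<And>i. \<phi> (u i) = E i" by (simp_all add: u_def r)
  define s where "s c = (\<Sum>i<?r. hscale (of_real (c i)) (u i))" for c :: "nat \<Rightarrow> real"
  have sZ: "s c \<in> Z" for c unfolding s_def by (intro H'.subspace_sum H'.subspace_scale Zs u)
  have \<phi>s: "\<phi> (s c) = (\<Sum>i<?r. c i *\<^sub>R E i)" for c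
    unfolding s_def by (simp add: phil u H'.subspace_scale Zs scaleR_eq_scalar)
  have rls: "rl (s c) = (\<Sum>i<?r. hscale (of_real (c i)) (rl (u i)))" for c
    unfolding s_def by (simp add: rl_sum rl_scale u H'.subspace_scale Zs)
  have rl0: "rl 0 = 0" by (simp add: rl_def hl_0)
  have "lattice_basis F ?r L (\<lambda>i. rl (u i))"
    unfolding lattice_basis_def
  proof (intro conjI allI impI)
    show "rl (u i) \<in> perp F" for i by (rule rl_perp[OF u(1)])
    show "c i = 0" if "(\<Sum>i<?r. hscale (of_real (c i)) (rl (u i))) \<in> F" "i < ?r" for c :: "nat \<Rightarrow> real" and i
    proof -
      have "rl (s c) - rl 0 \<in> F" using that(1) by (simp add: rls rl0)
      then have "\<phi> (s c) = \<phi> 0" by (subst (asm) rl_diff_F) (auto simp: sZ H'.subspace_0 Zs)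
      then have "(\<Sum>i<?r. c i *\<^sub>R E i) = 0" by (simp add: \<phi>s phil)
      then show ?thesis using that(2) by (rule E)
    qed
    show "L = {(\<Sum>i<?r. hscale (of_int (n i)) (rl (u i))) +o F | n :: nat \<Rightarrow> int. True}"
    proof (rule set_eqI, rule iffI)
      fix A assume "A \<in> L"
      then obtain v where v: "v \<in> Z" "\<phi> v \<in> \<Lambda>" "A = rl v +o F" by (auto simp: L_iff)
      then obtain k :: "nat \<Rightarrow> int" where "\<phi> v = (\<Sum>i<?r. of_int (k i) *\<^sub>R E i)" using E0(3) by blast
      then have "\<phi> v = \<phi> (s (\<lambda>i. of_int (k i)))" by (simp add: \<phi>s)
      then have "rl v - rl (s (\<lambda>i. of_int (k i))) \<in> F" using v(1) sZ by (simp add: rl_diff_F)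
      then have "A = rl (s (\<lambda>i. of_int (k i))) +o F" by (simp add: v(3) coset_eq_iff F_subspace)
      then have "A = (\<Sum>i<?r. hscale (of_int (k i)) (rl (u i))) +o F" by (simp add: rls)
      then show "A \<in> {(\<Sum>i<?r. hscale (of_int (n i)) (rl (u i))) +o F | n :: nat \<Rightarrow> int. True}" by blast
    next
      fix A assume "A \<in> {(\<Sum>i<?r. hscale (of_int (n i)) (rl (u i))) +o F | n :: nat \<Rightarrow> int. True}"
      then obtain k :: "nat \<Rightarrow> int" where k: "A = (\<Sum>i<?r. hscale (of_int (k i)) (rl (u i))) +o F" by blast
      have "\<phi> (s (\<lambda>i. of_int (k i))) \<in> \<Lambda>" unfolding \<phi>s E0(3) by blast
      moreover have "A = rl (s (\<lambda>i. of_int (k i))) +o F" by (simp add: k rls)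
      ultimately show "A \<in> L" using sZ by (auto simp: L_iff)
    qed
  qed
  moreover have "\<exists>c :: nat \<Rightarrow> real. \<phi> v = \<phi> (\<Sum>i<?r. hscale (of_real (c i)) (u i))" for v
  proof -
    obtain c where "\<phi> v = (\<Sum>i<?r. c i *\<^sub>R E i)" using E0(2) by blast
    then have "\<phi> v = \<phi> (s c)" by (simp only: \<phi>s)
    then show ?thesis unfolding s_def by blast
  qed
  ultimately show ?thesis
    using u(1) by (intro exI[of _ "\<lambda>i. rl (u i)"] exI[of _ u]) simp
qed

lemma lattice_real_canonical: "x +o F \<in> lattice_real F L \<longleftrightarrow> (\<exists>u\<in>Z. x - rl u \<in> F)"
proof -
  let ?r = "2 * CARD('n)"
  obtain e u where e: "lattice_basis F ?r L e" and u: "\<And>i. u i \<in> Z" "\<And>i. e i = rl (u i)"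
    and span: "\<And>v. v \<in> Z \<Longrightarrow> \<exists>c :: nat \<Rightarrow> real. \<phi> v = \<phi> (\<Sum>i<?r. hscale (of_real (c i)) (u i))"
    using canonical_lattice_basis by blast
  define s where "s c = (\<Sum>i<?r. hscale (of_real (c i)) (u i))" for c :: "nat \<Rightarrow> real"
  have sZ: "s c \<in> Z" for c unfolding s_def by (intro H'.subspace_sum H'.subspace_scale Zs u)
  have rls: "rl (s c) = (\<Sum>i<?r. hscale (of_real (c i)) (e i))" for c
  proof -
    have "rl (s c) = (\<Sum>i<?r. rl (hscale (of_real (c i)) (u i)))"
      unfolding s_def by (intro rl_sum H'.subspace_scale Zs u)
    then show ?thesis by (simp only: rl_scale[OF u(1)] u(2))
  qed
  have "(\<exists>c. x - rl (s c) \<in> F) \<longleftrightarrow> (\<exists>u\<in>Z. x - rl u \<in> F)"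
  proof
    assume "\<exists>u\<in>Z. x - rl u \<in> F"
    then obtain v where v: "v \<in> Z" "x - rl v \<in> F" by blast
    obtain c where "\<phi> v = \<phi> (s c)" using span[OF v(1)] by (auto simp: s_def)
    then have "rl v - rl (s c) \<in> F" using v sZ by (simp add: rl_diff_F)
    from H'.subspace_add[OF F_subspace v(2) this] show "\<exists>c. x - rl (s c) \<in> F" by (intro exI[of _ c]) simp
  qed (use sZ in blast)
  then show ?thesis by (simp add: lattice_real_iff[OF F_subspace e] rls)
qed

text \<open>The sum \<open>F\<^sup>\<bottom>/F = Z/F \<oplus> F\<^sup>\<bottom>\<^sub>+\<close> is direct because \<open>Z \<inter> H'\<^sub>+ = 0\<close>.\<close>

lemma decompose_unique:
  assumes "u \<in> Z" "h \<in> Hplus" "u' \<in> Z" "h' \<in> Hplus" "(u + h) - (u' + h') \<in> F"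
  shows "h = h'" "u - u' \<in> F"
proof -
  have "(u + h) - (u' + h') - (u - u') \<in> Z"
    using assms(5) F_Z by (intro H'.subspace_diff[OF Zs(1) _ H'.subspace_diff[OF Zs(1) assms(1,3)]]) blast
  then have "h - h' \<in> Z" by (simp add: algebra_simps)
  then show "h = h'" using Zs(3) H'.subspace_diff[OF Hplus_subspace assms(2,4)] by force
  then show "u - u' \<in> F" using assms(5) by simp
qed

text \<open>The decomposition of \<open>u \<in> Z\<close> into real and imaginary parts is \<open>u = x + iy\<close> with
  \<open>x = (u + u\<^sup>-)/2\<close> and \<open>y = (u - u\<^sup>-)/(2i)\<close>, both of which are of the form \<open>rl v\<close>.\<close>

lemma hconj_canonical:
  assumes u: "u \<in> Z"
  shows "hconj F L u w \<longleftrightarrow> w - hl u \<in> F"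
proof
  assume w: "w - hl u \<in> F"
  define x where "x = rl (hscale (1/2) u)"
  define y where "y = rl (hscale (- (\<i>/2)) u)"
  have half: "hscale (1/2) v + hscale (1/2) v = v" for v
    by (simp flip: H'.scale_left_distrib)
  have x: "x = hscale (1/2) u + hscale (1/2) (hl u)"
    using u by (simp add: x_def rl_def hl_scale)
  have "hl (hscale (- (\<i>/2)) u) = hscale (\<i>/2) (hl u)"
    by (subst hl_scale[OF u]) simp
  then have "hscale \<i> y = hscale (\<i> * (- (\<i>/2))) u + hscale (\<i> * (\<i>/2)) (hl u)"
    by (simp only: y_def rl_def H'.scale_right_distrib H'.scale_scale)
  then have y: "hscale \<i> y = hscale (1/2) u - hscale (1/2) (hl u)" by simp
  have "x + hscale \<i> y = u" "x - hscale \<i> y = hl u"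
    using half[of u] half[of "hl u"] by (simp_all add: x y algebra_simps)
  moreover have "x +o F \<in> lattice_real F L" "y +o F \<in> lattice_real F L"
    unfolding lattice_real_canonical x_def y_def
    using u H'.subspace_scale[OF Zs(1)] H'.subspace_0[OF F_subspace] by (metis diff_self)+
  ultimately show "hconj F L u w"
    unfolding hconj_def using w H'.subspace_0[OF F_subspace] by (metis diff_self)
next
  assume "hconj F L u w"
  then obtain x y where xy: "x +o F \<in> lattice_real F L" "y +o F \<in> lattice_real F L"
    "u - (x + hscale \<i> y) \<in> F" "w - (x - hscale \<i> y) \<in> F" by (auto simp: hconj_def)
  then obtain a b where a: "a \<in> Z" "x - rl a \<in> F" and b: "b \<in> Z" "y - rl b \<in> F"
    by (auto simp: lattice_real_canonical)
  note cl = H'.subspace_add[OF Zs(1)] H'.subspace_diff[OF Zs(1)] H'.subspace_scale[OF Zs(1)]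
    H'.subspace_add[OF Hplus_subspace] H'.subspace_diff[OF Hplus_subspace] H'.subspace_scale[OF Hplus_subspace]
    H'.subspace_0[OF Hplus_subspace]
  have "(u - (x + hscale \<i> y)) + (x - rl a) + hscale \<i> (y - rl b) \<in> F"
    by (intro H'.subspace_add H'.subspace_scale F_subspace xy a b)
  then have "(u + 0) - ((a + hscale \<i> b) + (hl a + hscale \<i> (hl b))) \<in> F"
    by (simp add: rl_def algebra_simps)
  from decompose_unique[OF _ _ _ _ this]
  have 1: "0 = hl a + hscale \<i> (hl b)" "u - (a + hscale \<i> b) \<in> F"
    by (simp_all add: u a(1) b(1) hl(1) cl)
  have "hl a = hl (hscale \<i> b)"
    using 1(1) b(1) by (simp add: hl_scale eq_neg_iff_add_eq_0)
  then have "\<phi> a = \<phi> (hscale \<i> b)" by (intro hl_inj a b cl)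
  then have 2: "a - hscale \<i> b \<in> F" using a b cl by (simp add: diff_in_F)
  have "\<phi> u = \<phi> (a + hscale \<i> b)" using 1(2) u a b cl by (simp add: diff_in_F)
  then have 3: "hl u = hl a - hscale \<i> (hl b)"
    using a b cl hl_cong[of u "a + hscale \<i> b"] by (simp add: hl_add hl_scale)
  have "(w - (x - hscale \<i> y)) + (x - rl a) - hscale \<i> (y - rl b) + (a - hscale \<i> b) \<in> F"
    by (intro H'.subspace_add H'.subspace_diff H'.subspace_scale F_subspace xy a b 2)
  moreover have "(w - (x - hscale \<i> y)) + (x - rl a) - hscale \<i> (y - rl b) + (a - hscale \<i> b) = w - hl u"
    by (simp add: rl_def 3 algebra_simps)
  ultimately show "w - hl u \<in> F" by (simp only:)
qed

lemma hermB_canonical: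
  assumes "u \<in> Z" "v \<in> Z"
  shows "hermB F L u v = B (\<phi> u) (\<phi> v)"
proof -
  define w where "w = (SOME w. hconj F L u w)"
  have "hconj F L u w"
    unfolding w_def by (rule someI[of _ "hl u"]) (simp add: hconj_canonical assms H'.subspace_0 F_subspace)
  then have "w - hl u \<in> F" using assms by (simp add: hconj_canonical)
  then have "hform (w - hl u) v = 0" using F_Z assms Zs(4) by blast
  then have "hform w v = of_real pi * B (\<phi> u) (\<phi> v)" using assms by (simp add: hform_diff hl)
  then show ?thesis by (simp add: hermB_def w_def)
qed

lemma has_codim_kernel: "has_codim F Z CARD('n)"
proof -
  obtain r where r: "\<And>v. r v \<in> Z" "\<And>v. \<phi> (r v) = v" using ex_section[OF phi_surj] by blast
  define w where "w i = r (axis i 1)" for i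
  have w: "\<And>i. w i \<in> Z" "\<And>i. \<phi> (w i) = axis i 1" by (simp_all add: w_def r)
  have inj: "inj w"
    using w(2) by (metis axis_eq_axis injI zero_neq_one)
  define s where "s c = (\<Sum>i\<in>UNIV. hscale (c $ i) (w i))" for c :: "complex^'n"
  have sZ: "s c \<in> Z" for c unfolding s_def by (intro H'.subspace_sum H'.subspace_scale Zs w)
  have \<phi>s: "\<phi> (s c) = c" for c
    unfolding s_def by (simp add: phil w H'.subspace_scale Zs basis_expansion)
  have sum_s: "(\<Sum>x\<in>range w. hscale (f x) x) = s (\<chi> i. f (w i))" for f
    by (simp add: s_def sum.reindex[OF inj])
  have span: "H'.span (range w) = range s"
  proof -
    have "range (\<lambda>u. \<Sum>v\<in>range w. hscale (u v) v) = range s"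
    proof
      show "range s \<subseteq> range (\<lambda>u. \<Sum>v\<in>range w. hscale (u v) v)"
      proof
        fix x assume "x \<in> range s"
        then obtain c where "x = s c" by blast
        then have "x = (\<Sum>v\<in>range w. hscale (c $ (inv w v)) v)" by (simp add: sum_s inj)
        then show "x \<in> range (\<lambda>u. \<Sum>v\<in>range w. hscale (u v) v)"
          by (rule range_eqI[where f = "\<lambda>u. \<Sum>v\<in>range w. hscale (u v) v" and x = "\<lambda>v. c $ (inv w v)"])
      qed
    qed (auto simp: sum_s)
    then show ?thesis by (simp add: H'.span_finite)
  qed
  show ?thesis
    unfolding has_codim_def
  proof (intro conjI exI[of _ "range w"])
    show "\<not> H'.dependent (range w)"
    proof (rule H'.independent_if_scalars_zero)
      fix f x assume 0: "(\<Sum>x\<in>range w. hscale (f x) x) = 0" and "x \<in> range w"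
      then obtain i where "x = w i" by blast
      moreover have "(\<chi> i. f (w i)) = 0" using 0 \<phi>s[of "\<chi> i. f (w i)"] by (simp add: sum_s phil)
      ultimately show "f x = 0" by (simp add: vec_eq_iff)
    qed simp
    show "H'.span (range w) \<inter> F = {0}"
    proof -
      have "s c \<in> F \<longleftrightarrow> c = 0" for c by (simp add: zker_def sZ \<phi>s)
      moreover have "s 0 = 0" by (simp add: s_def)
      ultimately have "range s \<inter> F = s ` {0}" by blast
      then show ?thesis by (simp add: span \<open>s 0 = 0\<close>)
    qed
    show "Z = H'.span (range w) + F"
    proof
      show "Z \<subseteq> H'.span (range w) + F"
      proof
        fix z assume z: "z \<in> Z"
        then have "z - s (\<phi> z) \<in> F" by (simp add: diff_in_F sZ \<phi>s)
        moreover have "z = s (\<phi> z) + (z - s (\<phi> z))" by simp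
        ultimately show "z \<in> H'.span (range w) + F" unfolding span by (metis rangeI set_plus_intro)
      qed
      show "H'.span (range w) + F \<subseteq> Z"
        unfolding span using sZ F_Z H'.subspace_add[OF Zs(1)] by (auto simp: set_plus_def)
    qed
    show "card (range w) = CARD('n)" by (rule card_image[OF inj])
  qed (use w F_Z F_subspace in auto)
qed

text \<open>The map from \<open>\<Lambda>\<close> to \<open>L\<close> is an additive bijection under which the form becomes \<open>Im B\<close>.\<close>

lemma unimodular_canonical: "unimodular L (\<lambda>x y. qform x y / (2 * of_real pi * \<i>))"
proof -
  have uni: "\<And>x y. x \<in> \<Lambda> \<Longrightarrow> y \<in> \<Lambda> \<Longrightarrow> complex_of_real (Im (B x y)) \<in> \<int>"
    "\<And>h :: complex^'n \<Rightarrow> int. (\<forall>x\<in>\<Lambda>. \<forall>y\<in>\<Lambda>. h (x + y) = h x + h y) \<Longrightarrow>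
      \<exists>!x. x \<in> \<Lambda> \<and> (\<forall>y\<in>\<Lambda>. complex_of_real (Im (B x y)) = of_int (h y))"
    using Bs(5) unfolding unimodular_def by blast+
  have q: "qform (rl u +o F) (rl v +o F) / (2 * of_real pi * \<i>) = of_real (Im (B (\<phi> u) (\<phi> v)))"
    if "u \<in> Z" "v \<in> Z" for u v
    using that by (simp add: qform_coset F_perp_F F_subspace rl_perp hform_rl)
  obtain s where s: "\<And>v. s v \<in> Z" "\<And>v. \<phi> (s v) = v" using ex_section[OF phi_surj] by blast
  have cs: "rl u +o F = rl (s (\<phi> u)) +o F" if "u \<in> Z" for u
    using that by (simp add: coset_eq_iff F_subspace rl_diff_F s)
  show ?thesis
    unfolding unimodular_def
  proof (intro conjI allI impI ballI)
    fix x y assume "x \<in> L" "y \<in> L"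
    then show "qform x y / (2 * of_real pi * \<i>) \<in> \<int>"
      using q uni(1) by (auto simp: L_iff)
  next
    fix h :: "hp set \<Rightarrow> int" assume h: "\<forall>x\<in>L. \<forall>y\<in>L. h (x + y) = h x + h y"
    define k where "k v = h (rl (s v) +o F)" for v
    have sL: "rl (s v) +o F \<in> L" if "v \<in> \<Lambda>" for v
    unfolding L_iff by (rule bexI[of _ "s v"]) (simp_all add: s that)
    have "k (x + y) = k x + k y" if "x \<in> \<Lambda>" "y \<in> \<Lambda>" for x y
    proof -
      have "rl (s (x + y)) +o F = rl (s x + s y) +o F"
        using s H'.subspace_add[OF Zs(1)] by (simp add: coset_eq_iff F_subspace rl_diff_F phil)
      also have "\<dots> = (rl (s x) +o F) + (rl (s y) +o F)"
        by (simp add: coset_add F_subspace rl_add s)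
      finally show ?thesis using h sL that by (simp add: k_def)
    qed
    then obtain l where l: "l \<in> \<Lambda>" "\<And>y. y \<in> \<Lambda> \<Longrightarrow> complex_of_real (Im (B l y)) = of_int (k y)"
      and lu: "\<And>x. x \<in> \<Lambda> \<Longrightarrow> (\<And>y. y \<in> \<Lambda> \<Longrightarrow> complex_of_real (Im (B x y)) = of_int (k y)) \<Longrightarrow> x = l"
      using uni(2)[of k] by (metis (no_types, lifting))
    show "\<exists>!x. x \<in> L \<and> (\<forall>y\<in>L. qform x y / (2 * of_real pi * \<i>) = of_int (h y))"
    proof (rule ex1I[of _ "rl (s l) +o F"], intro conjI ballI)
      show "rl (s l) +o F \<in> L" by (rule sL[OF l(1)])
      fix y assume "y \<in> L"
      then obtain v where v: "v \<in> Z" "\<phi> v \<in> \<Lambda>" "y = rl v +o F" by (auto simp: L_iff)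
      then have "h y = k (\<phi> v)" by (simp add: k_def cs)
      then show "qform (rl (s l) +o F) y / (2 * of_real pi * \<i>) = of_int (h y)"
        using v l(2) by (simp add: q s)
    next
      fix x assume x: "x \<in> L \<and> (\<forall>y\<in>L. qform x y / (2 * of_real pi * \<i>) = of_int (h y))"
      then obtain u where u: "u \<in> Z" "\<phi> u \<in> \<Lambda>" "x = rl u +o F" by (auto simp: L_iff)
      have "\<phi> u = l"
      proof (rule lu)
        fix y assume "y \<in> \<Lambda>"
        then have "qform x (rl (s y) +o F) / (2 * of_real pi * \<i>) = of_int (k y)"
          using x sL by (simp add: k_def)
        then show "complex_of_real (Im (B (\<phi> u) y)) = of_int (k y)" using u s q by simp
      qed fact
      then show "x = rl (s l) +o F" using u cs by simp
    qed
  qed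
qed

end

section \<open>Points are marked complements\<close>

definition marked :: "hp set \<Rightarrow> (hp \<Rightarrow> complex^'n) \<Rightarrow> bool" where
  "marked Z \<phi> \<longleftrightarrow> lagrangian_complement Z \<and> \<phi> \<in> extensional Z \<and> zlin Z \<phi> \<and> \<phi> ` Z = UNIV"

text \<open>The point with given \<open>Z\<close> and \<open>\<phi>\<close>; its remaining components are forced.\<close>

definition mk_pt :: "(complex^'n) set \<Rightarrow> (complex^'n \<Rightarrow> complex^'n \<Rightarrow> complex)
    \<Rightarrow> hp set \<Rightarrow> (hp \<Rightarrow> complex^'n) \<Rightarrow> 'n pt" where
  "mk_pt \<Lambda> B Z \<phi> = (\<lparr>Zof = Z, Fof = zker Z \<phi>, Lof = canonical_lattice \<Lambda> B Z \<phi>\<rparr>, \<phi>)"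

lemma marked_complementI: "ppav \<Lambda> B \<Longrightarrow> marked Z \<phi> \<Longrightarrow> marked_complement \<Lambda> B Z \<phi>"
  by (simp add: marked_def marked_complement_def)

lemma mk_pt_in_Sp:
  fixes \<Lambda> :: "(complex^'n) set"
  assumes "ppav \<Lambda> B" "marked Z \<phi>"
  shows "mk_pt \<Lambda> B Z \<phi> \<in> Sp \<Lambda> B"
proof -
  interpret marked_complement \<Lambda> B Z \<phi> using assms by (rule marked_complementI)
  obtain e u where e: "lattice_basis F (2 * CARD('n)) L e" using canonical_lattice_basis by blast
  have "ext_ppav CARD('n) \<lparr>Zof = Z, Fof = F, Lof = L\<rparr>"
    unfolding ext_ppav_def Let_def ext_triple.simps
  proof (intro conjI ballI impI)
    show "lagrangian Z" "Z \<inter> Hplus = {0}" using Z by (auto simp: lagrangian_complement_def)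
    show "has_codim F Z CARD('n)" by (rule has_codim_kernel)
    show "lattice_in F (2 * CARD('n)) L" using e by (auto simp: lattice_in_iff)
    show "unimodular L (\<lambda>x y. qform x y / (2 * of_real pi * \<i>))" by (rule unimodular_canonical)
    show "x = 0" if xF: "x \<in> perp F \<inter> Hplus" and xL: "x +o F \<in> lattice_real F L" for x
    proof -
      obtain v where v: "v \<in> Z" "(0 + x) - (v + hl v) \<in> F"
        using xL by (auto simp: lattice_real_canonical rl_def)
      have "x = hl v" "0 - v \<in> F"
        using decompose_unique[OF _ _ v(1) hl(1) v(2)] xF H'.subspace_0[OF Zs(1)] by auto
      then have "\<phi> 0 = \<phi> v" using v(1) diff_in_F[of 0 v] H'.subspace_0[OF Zs(1)] by simp
      then have "hl v = hl 0" by (intro hl_cong) simp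
      then show "x = 0" using \<open>x = hl v\<close> hl_0 by simp
    qed
    show "{w. \<exists>u\<in>Z. hconj F L u w} = (perp F \<inter> Hplus) + F"
    proof (rule set_eqI, rule iffI)
      fix w assume "w \<in> {w. \<exists>u\<in>Z. hconj F L u w}"
      then obtain u where u: "u \<in> Z" "w - hl u \<in> F" by (auto simp: hconj_canonical)
      have "w = hl u + (w - hl u)" by simp
      then show "w \<in> (perp F \<inter> Hplus) + F" using u hl(1) hl_perp by (metis IntI set_plus_intro)
    next
      fix w assume "w \<in> (perp F \<inter> Hplus) + F"
      then obtain h f where h: "w = h + f" "h \<in> perp F" "h \<in> Hplus" "f \<in> F" by (auto simp: set_plus_def)
      then obtain u where "u \<in> Z" "hl u = h" using hl_onto by blast
      with h have "hconj F L u w" by (simp add: hconj_canonical)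
      with \<open>u \<in> Z\<close> show "w \<in> {w. \<exists>u\<in>Z. hconj F L u w}" by blast
    qed
    fix u assume u: "u \<in> Z" "u \<notin> F"
    then have "\<phi> u \<noteq> 0" by (simp add: zker_def)
    then show "0 < Re (hermB F L u u)" using u by (simp add: hermB_canonical Bs(4))
    have "B (\<phi> u) (\<phi> u) = cnj (B (\<phi> u) (\<phi> u))" by (rule Bs(3))
    then show "Im (hermB F L u u) = 0" using u by (simp add: hermB_canonical complex_eq_iff)
  qed
  moreover have "\<phi> ` {u \<in> Z. \<exists>h\<in>perp F \<inter> Hplus. (u + h) +o F \<in> L} = \<Lambda>"
  proof (rule set_eqI, rule iffI)
    fix l assume "l \<in> \<phi> ` {u \<in> Z. \<exists>h\<in>perp F \<inter> Hplus. (u + h) +o F \<in> L}"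
    then obtain u h where u: "l = \<phi> u" "u \<in> Z" "h \<in> Hplus" "(u + h) +o F \<in> L" by blast
    then obtain v where v: "v \<in> Z" "\<phi> v \<in> \<Lambda>" "(u + h) +o F = (v + hl v) +o F" by (auto simp: L_iff rl_def)
    then have "(u + h) - (v + hl v) \<in> F" by (simp add: coset_eq_iff F_subspace)
    from decompose_unique(2)[OF u(2,3) v(1) hl(1) this] show "l \<in> \<Lambda>"
      using u v by (simp add: diff_in_F)
  next
    fix l assume l: "l \<in> \<Lambda>"
    have "l \<in> \<phi> ` Z" by (simp add: phi_surj)
    then obtain u where u: "u \<in> Z" "\<phi> u = l" by blast
    then have "(u + hl u) +o F \<in> L" using l by (auto simp: L_iff rl_def)
    then show "l \<in> \<phi> ` {u \<in> Z. \<exists>h\<in>perp F \<inter> Hplus. (u + h) +o F \<in> L}"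
      using u hl(1) hl_perp by blast
  qed
  moreover have "\<phi> \<in> extensional Z" using assms(2) by (simp add: marked_def)
  moreover have "{u \<in> Z. \<phi> u = 0} = F" by (simp add: zker_def)
  ultimately show ?thesis
    unfolding Sp_def mk_pt_def using phi phi_surj
    by (simp add: hermB_canonical zlin_def)
qed

text \<open>A point of \<open>Sp(X,\<Theta>)\<close> is determined by \<open>Z\<close> and \<open>\<phi>\<close>: conjugation exchanges the components \<open>u\<close> and
  \<open>h\<close> of a real vector \<open>u + h\<close>, so that the Hermitian form, which is transported from \<open>B\<close>,
  determines \<open>h\<close> from \<open>u\<close>.\<close>

lemma Sp_cases:
  fixes \<Lambda> :: "(complex^'n) set"
  assumes pp: "ppav \<Lambda> B" and p: "p \<in> Sp \<Lambda> B"
  shows "\<exists>Z \<phi>. marked Z \<phi> \<and> p = mk_pt \<Lambda> B Z \<phi>"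
proof -
  obtain a \<phi> where p_eq: "p = (a, \<phi>)" by (cases p)
  define Z where "Z = Zof a"
  define L where "L = Lof a"
  have ker: "Fof a = zker Z \<phi>" and ext: "\<phi> \<in> extensional Z" and lin: "zlin Z \<phi>" and surj: "\<phi> ` Z = UNIV"
    and \<Lambda>: "\<phi> ` {u \<in> Z. \<exists>h\<in>perp (Fof a) \<inter> Hplus. (u + h) +o Fof a \<in> L} = \<Lambda>"
    and herm: "\<And>u v. u \<in> Z \<Longrightarrow> v \<in> Z \<Longrightarrow> hermB (Fof a) L u v = B (\<phi> u) (\<phi> v)"
    and ext_ppav: "ext_ppav CARD('n) a"
    using p by (auto simp: Sp_def p_eq Z_def L_def zlin_def zker_def)
  note E = ext_ppav[unfolded ext_ppav_def Let_def, folded Z_def L_def, unfolded ker]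
  have lc: "lagrangian_complement Z" using E by (simp add: lagrangian_complement_def)
  interpret marked_complement \<Lambda> B Z \<phi> using pp lc lin surj by unfold_locales
  note herm = herm[unfolded ker] and \<Lambda> = \<Lambda>[unfolded ker]
  have "lattice_in F (2 * CARD('n)) L" using E by blast
  then obtain e where e: "lattice_basis F (2 * CARD('n)) L e" unfolding lattice_in_iff by blast
  have uni: "unimodular L (\<lambda>x y. qform x y / (2 * of_real pi * \<i>))" using E by blast
  have conj_set: "{w. \<exists>u\<in>Z. hconj F L u w} = (perp F \<inter> Hplus) + F" using E by blast
  note clF = H'.subspace_add[OF F_subspace] H'.subspace_diff[OF F_subspace] H'.subspace_scale[OF F_subspace]
  note R = lattice_real_closed[OF F_subspace e]
  note triv = lattice_real_Int_imag[OF F_subspace F_perp_F e uni]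
  have L_R: "x +o F \<in> lattice_real F L" if "x +o F \<in> L" for x
    unfolding lattice_real_def
    by (rule CollectI, rule exI[of _ 1], rule exI[of _ "\<lambda>_. 1"], rule exI[of _ "\<lambda>_. x"]) (simp add: that)
  \<comment> \<open>Conjugation is well defined and injective on \<open>F\<^sup>\<bottom>/F\<close>, since \<open>L\<^sub>\<real>\<close> meets \<open>i L\<^sub>\<real>\<close> trivially.\<close>
  have conj_unique: "w - w' \<in> F" if c: "hconj F L u w" "hconj F L u' w'" "u - u' \<in> F" for u u' w w'
  proof -
    obtain x y where xy: "x +o F \<in> lattice_real F L" "y +o F \<in> lattice_real F L"
      "u - (x + hscale \<i> y) \<in> F" "w - (x - hscale \<i> y) \<in> F" using c(1) by (auto simp: hconj_def)
    obtain x' y' where xy': "x' +o F \<in> lattice_real F L" "y' +o F \<in> lattice_real F L"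
      "u' - (x' + hscale \<i> y') \<in> F" "w' - (x' - hscale \<i> y') \<in> F" using c(2) by (auto simp: hconj_def)
    from clF(1)[OF clF(2)[OF c(3) xy(3)] xy'(3)]
    have "(x - x') - hscale \<i> (y' - y) \<in> F" by (simp add: algebra_simps)
    note t = triv[OF R(3)[OF xy(1) xy'(1)] R(3)[OF xy'(2) xy(2)] this]
    from clF(1)[OF clF(1)[OF clF(2)[OF xy(4) xy'(4)] t(1)] clF(3)[OF t(2), of \<i>]]
    have "(w - (x - hscale \<i> y)) - (w' - (x' - hscale \<i> y')) + (x - x') + hscale \<i> (y' - y) \<in> F" .
    then show ?thesis by (simp add: algebra_simps)
  qed
  have conj_unique': "u - u' \<in> F" if c: "hconj F L u w" "hconj F L u' w'" "w - w' \<in> F" for u u' w w'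
  proof -
    obtain x y where xy: "x +o F \<in> lattice_real F L" "y +o F \<in> lattice_real F L"
      "u - (x + hscale \<i> y) \<in> F" "w - (x - hscale \<i> y) \<in> F" using c(1) by (auto simp: hconj_def)
    obtain x' y' where xy': "x' +o F \<in> lattice_real F L" "y' +o F \<in> lattice_real F L"
      "u' - (x' + hscale \<i> y') \<in> F" "w' - (x' - hscale \<i> y') \<in> F" using c(2) by (auto simp: hconj_def)
    from clF(1)[OF clF(2)[OF c(3) xy(4)] xy'(4)]
    have "(x - x') - hscale \<i> (y - y') \<in> F" by (simp add: algebra_simps)
    note t = triv[OF R(3)[OF xy(1) xy'(1)] R(3)[OF xy(2) xy'(2)] this]
    from clF(1)[OF clF(1)[OF clF(2)[OF xy(3) xy'(3)] t(1)] clF(3)[OF t(2), of \<i>]]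
    have "(u - (x + hscale \<i> y)) - (u' - (x' + hscale \<i> y')) + (x - x') + hscale \<i> (y - y') \<in> F" .
    then show ?thesis by (simp add: algebra_simps)
  qed
  \<comment> \<open>Let \<open>y\<close> be a real vector with component \<open>-iu\<close> in \<open>Z/F\<close>, and \<open>x = u + h\<close>. Then \<open>x + iy\<close> has component \<open>2u\<close>
    and its conjugate \<open>x - iy\<close> lies in \<open>F\<^sup>\<bottom>\<^sub>+\<close>. As conjugation carries \<open>Z/F\<close> onto \<open>F\<^sup>\<bottom>\<^sub>+\<close>, the vector \<open>x + iy\<close> lies
    in \<open>Z/F\<close>, so it is \<open>2u\<close>, and comparing components in \<open>F\<^sup>\<bottom>\<^sub>+\<close> gives \<open>x - iy = 2h\<close>. Thus \<open>h\<close> is the conjugate of \<open>u\<close>.\<close>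
  have key: "h = hl u" if u: "u \<in> Z" and h: "h \<in> perp F" "h \<in> Hplus" and uh: "(u + h) +o F \<in> L" for u h
  proof -
    \<comment> \<open>The vector \<open>y\<close> exists because \<open>\<Lambda>\<close> spans \<open>\<complex>\<^sup>g\<close> over \<open>\<real>\<close>.\<close>
    have "\<exists>v k. v \<in> Z \<and> k \<in> perp F \<and> k \<in> Hplus \<and> (v + k) +o F \<in> lattice_real F L \<and> \<phi> v = - \<i> *s \<phi> u"
    proof -
      let ?r = "2 * CARD('n)"
      obtain E where El: "\<And>i. i < ?r \<Longrightarrow> E i \<in> \<Lambda>" and Es: "\<forall>v. \<exists>c. v = (\<Sum>i<?r. c i *\<^sub>R E i)"
      proof -
        obtain E where "\<forall>v. \<exists>c. v = (\<Sum>i<?r. c i *\<^sub>R E i)"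
          "\<Lambda> = {\<Sum>i<?r. of_int (k i) *\<^sub>R E i | k :: nat \<Rightarrow> int. True}"
          using ppav_basis[OF pp] by (elim exE conjE)
        moreover have "E j \<in> {\<Sum>i<?r. of_int (k i) *\<^sub>R E i | k :: nat \<Rightarrow> int. True}" if "j < ?r" for j
        proof -
          have "(\<Sum>i<?r. of_int (if i = j then 1 else 0) *\<^sub>R E i) = (\<Sum>i<?r. if i = j then E j else 0)"
            by (intro sum.cong) auto
          also have "\<dots> = E j" using that by simp
          finally have "E j = (\<Sum>i<?r. of_int (if i = j then 1 else 0) *\<^sub>R E i)" by simp
          then show ?thesis by (intro CollectI exI[of _ "\<lambda>i. if i = j then 1 else 0"] conjI TrueI)
        qed
        ultimately show ?thesis using that by blast
      qed
      have "\<exists>v k. v \<in> Z \<and> k \<in> perp F \<and> k \<in> Hplus \<and> (v + k) +o F \<in> L \<and> \<phi> v = E i" if "i < ?r" for i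
      proof -
        have "E i \<in> \<phi> ` {u \<in> Z. \<exists>h\<in>perp F \<inter> Hplus. (u + h) +o F \<in> L}" using El[OF that] \<Lambda> by simp
        then obtain v where v: "E i = \<phi> v" "v \<in> {u \<in> Z. \<exists>h\<in>perp F \<inter> Hplus. (u + h) +o F \<in> L}" by (rule imageE)
        then obtain k where "v \<in> Z" "k \<in> perp F \<inter> Hplus" "(v + k) +o F \<in> L" by blast
        with v(1) show ?thesis by (intro exI[of _ v] exI[of _ k]) simp
      qed
      then obtain v k where vk: "\<And>i. i < ?r \<Longrightarrow> v i \<in> Z" "\<And>i. i < ?r \<Longrightarrow> k i \<in> perp F"
        "\<And>i. i < ?r \<Longrightarrow> k i \<in> Hplus" "\<And>i. i < ?r \<Longrightarrow> (v i + k i) +o F \<in> L" "\<And>i. i < ?r \<Longrightarrow> \<phi> (v i) = E i"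
        by metis
      obtain c where c: "- \<i> *s \<phi> u = (\<Sum>i<?r. c i *\<^sub>R E i)" using Es by blast
      define v' where "v' = (\<Sum>i<?r. hscale (of_real (c i)) (v i))"
      define k' where "k' = (\<Sum>i<?r. hscale (of_real (c i)) (k i))"
      have "v' \<in> Z" unfolding v'_def by (intro H'.subspace_sum H'.subspace_scale Zs vk) simp
      moreover have "k' \<in> perp F" "k' \<in> Hplus" unfolding k'_def
        by (intro H'.subspace_sum H'.subspace_scale subspace_perp Hplus_subspace vk; simp)+
      moreover have "\<phi> v' = - \<i> *s \<phi> u"
      proof -
        have "\<phi> v' = (\<Sum>i<?r. \<phi> (hscale (of_real (c i)) (v i)))"
          unfolding v'_def by (intro phil H'.subspace_scale Zs vk) simp
        also have "\<dots> = (\<Sum>i<?r. c i *\<^sub>R E i)"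
          by (rule sum.cong) (simp_all add: phil vk scaleR_eq_scalar)
        finally show ?thesis unfolding c .
      qed
      moreover have "(v' + k') +o F \<in> lattice_real F L"
      proof -
        have "v' + k' = (\<Sum>i<?r. hscale (of_real (c i)) (v i + k i))"
          by (simp add: v'_def k'_def H'.scale_right_distrib sum.distrib)
        then show ?thesis unfolding lattice_real_def
          by (intro CollectI exI[of _ ?r] exI[of _ c] exI[of _ "\<lambda>i. v i + k i"]) (simp add: vk)
      qed
      ultimately show ?thesis by blast
    qed
    then obtain v k where v: "v \<in> Z" "k \<in> perp F" "k \<in> Hplus" "(v + k) +o F \<in> lattice_real F L" "\<phi> v = - \<i> *s \<phi> u"
      by blast
    have uhR: "(u + h) +o F \<in> lattice_real F L" by (rule L_R[OF uh])
    note clZ = H'.subspace_add[OF Zs(1)] H'.subspace_diff[OF Zs(1)] H'.subspace_scale[OF Zs(1)]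
    have iv: "u - hscale \<i> v \<in> Z" "u + hscale \<i> v \<in> Z" using u v clZ by auto
    have f1: "(u - hscale \<i> v) \<in> F"
    proof -
      have "\<phi> (hscale \<i> v) = \<phi> u" using v by (simp add: phil)
      then show ?thesis using u v(1) clZ by (simp add: diff_in_F)
    qed
    define w where "w = h - hscale \<i> k"
    have "(u + hscale \<i> v + (h + hscale \<i> k)) - ((u + h) + hscale \<i> (v + k)) = 0"
      "w - ((u + h) - hscale \<i> (v + k)) = - (u - hscale \<i> v)"
      by (simp_all add: w_def algebra_simps)
    then have c1: "hconj F L (u + hscale \<i> v + (h + hscale \<i> k)) w"
      unfolding hconj_def using uhR v(4) H'.subspace_0[OF F_subspace] H'.subspace_neg[OF F_subspace f1] by metis
    have "w + 0 \<in> (perp F \<inter> Hplus) + F"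
      unfolding w_def using h v H'.subspace_0[OF F_subspace]
      by (intro set_plus_intro IntI H'.subspace_diff H'.subspace_scale subspace_perp Hplus_subspace) auto
    then obtain u2 where u2: "u2 \<in> Z" "hconj F L u2 w" using conj_set by auto
    have "(u + hscale \<i> v + (h + hscale \<i> k)) - (u2 + 0) \<in> F"
      using conj_unique'[OF c1 u2(2)] H'.subspace_0[OF F_subspace] by simp
    from decompose_unique(1)[OF _ _ u2(1) _ this]
    have "h + hscale \<i> k = 0" using iv h v H'.subspace_0[OF Hplus_subspace]
        H'.subspace_add[OF Hplus_subspace] H'.subspace_scale[OF Hplus_subspace] by simp
    then have ik: "hscale \<i> k = - h" by (simp add: eq_neg_iff_add_eq_0 add.commute)
    define x where "x = hscale (of_real (1/2)) (u + h)"
    define y where "y = hscale (of_real (1/2)) (v + k)"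
    have half: "hscale (1/2) z + hscale (1/2) z = z" for z
      by (simp flip: H'.scale_left_distrib)
    have "hscale \<i> y = hscale (1/2) (hscale \<i> v + hscale \<i> k)"
      by (simp add: y_def H'.scale_right_distrib mult.commute)
    then have iy: "hscale \<i> y = hscale (1/2) (hscale \<i> v) - hscale (1/2) h"
      by (simp add: ik H'.scale_right_diff_distrib)
    have x: "x = hscale (1/2) u + hscale (1/2) h" by (simp add: x_def H'.scale_right_distrib)
    have "u - (x + hscale \<i> y) = hscale (1/2) (u - hscale \<i> v)"
    proof -
      have "u - (x + hscale \<i> y) = (hscale (1/2) u + hscale (1/2) u) - (x + hscale \<i> y)" by (simp only: half)
      then show ?thesis by (simp add: x iy H'.scale_right_diff_distrib)
    qed
    moreover have "h - (x - hscale \<i> y) = - hscale (1/2) (u - hscale \<i> v)"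
    proof -
      have "h - (x - hscale \<i> y) = (hscale (1/2) h + hscale (1/2) h) - (x - hscale \<i> y)" by (simp only: half)
      then show ?thesis by (simp add: x iy H'.scale_right_diff_distrib)
    qed
    moreover have "x +o F \<in> lattice_real F L" "y +o F \<in> lattice_real F L"
      unfolding x_def y_def by (intro R(2) uhR v)+
    ultimately have c2: "hconj F L u h"
      unfolding hconj_def using f1 H'.subspace_neg[OF F_subspace] H'.subspace_scale[OF F_subspace] by metis
    define w0 where "w0 = (SOME w. hconj F L u w)"
    have "hconj F L u w0" unfolding w0_def by (rule someI[of "hconj F L u" h]) (rule c2)
    then have w0: "w0 - h \<in> F" using conj_unique[OF _ c2] H'.subspace_0[OF F_subspace] by simp
    have "hl u = h"
    proof (rule hl_unique)
      fix z assume z: "z \<in> Z"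
      have "hform (w0 - h) z = 0" using w0 F_Z z Zs(4) by blast
      then have "hform h z = hform w0 z" by (simp add: hform_diff)
      moreover have "hform w0 z / of_real pi = B (\<phi> u) (\<phi> z)"
        using herm[OF u z] by (simp add: hermB_def w0_def)
      ultimately show "hform h z = of_real pi * B (\<phi> u) (\<phi> z)" by (simp add: field_simps)
    qed fact
    then show ?thesis by simp
  qed
  have "L = canonical_lattice \<Lambda> B Z \<phi>"
  proof (rule set_eqI, rule iffI)
    fix A assume A: "A \<in> L"
    then obtain n where "A = (\<Sum>i<2 * CARD('n). hscale (of_int (n i)) (e i)) +o F"
      using e unfolding lattice_basis_def by blast
    then obtain x where x: "A = x +o F" "x \<in> perp F"
      using e subspace_perp unfolding lattice_basis_def
      by (metis (no_types, lifting) H'.subspace_scale H'.subspace_sum lessThan_iff)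
    define u h where "u = prj Z x" and "h = x - u"
    have u: "u \<in> Z" "h \<in> Hplus" "u + h = x" by (simp_all add: u_def h_def prj lc)
    have h: "h \<in> perp F" unfolding h_def
      using x(2) u(1) Z_perp_F by (intro H'.subspace_diff subspace_perp) auto
    have "h = hl u" using key[OF u(1) h u(2)] A x u by simp
    moreover have "\<phi> u \<in> \<phi> ` {u \<in> Z. \<exists>h\<in>perp F \<inter> Hplus. (u + h) +o F \<in> L}"
      using u h A x by (intro imageI) blast
    then have "\<phi> u \<in> \<Lambda>" using \<Lambda> by simp
    ultimately show "A \<in> canonical_lattice \<Lambda> B Z \<phi>"
      using u x by (auto simp: canonical_lattice_def)
  next
    fix A assume "A \<in> canonical_lattice \<Lambda> B Z \<phi>"
    then obtain u where u: "u \<in> Z" "\<phi> u \<in> \<Lambda>" "A = rl u +o F" unfolding L_iff by blast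
    then have "\<phi> u \<in> \<phi> ` {u \<in> Z. \<exists>h\<in>perp F \<inter> Hplus. (u + h) +o F \<in> L}" using \<Lambda> by simp
    then obtain u' h where u': "\<phi> u = \<phi> u'" "u' \<in> Z" "h \<in> perp F" "h \<in> Hplus" "(u' + h) +o F \<in> L" by auto
    then have "h = hl u'" by (intro key)
    then have "(u' + h) = rl u'" by (simp add: rl_def)
    moreover have "A = rl u' +o F" using u u' by (simp add: coset_eq_iff F_subspace rl_diff_F)
    ultimately show "A \<in> L" using u' by simp
  qed
  then have "a = \<lparr>Zof = Z, Fof = zker Z \<phi>, Lof = canonical_lattice \<Lambda> B Z \<phi>\<rparr>"
    using ker by (simp add: Z_def L_def)
  then show ?thesis
    using lc ext lin surj by (auto simp: p_eq mk_pt_def marked_def intro!: exI[of _ Z] exI[of _ \<phi>])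
qed

section \<open>The action of \<open>Sp\<^sup>+(H')\<close> on \<open>Sp(X,\<Theta>)\<close>\<close>

lemma image_coset:
  assumes "hlinear g"
  shows "g ` (x +o S) = g x +o g ` S"
  unfolding elt_set_plus_def using hlinearD(1)[OF assms] by (auto simp: image_iff) metis+

text \<open>Group elements preserve the form and \<open>H'\<^sub>+\<close>, hence everything from which the canonical lattice is built.\<close>

lemma pt_act_mk_pt:
  fixes \<Lambda> :: "(complex^'n) set"
  assumes pp: "ppav \<Lambda> B" and g: "g \<in> SpPlus_full" and m: "marked Z \<phi>"
    and \<phi>': "\<phi>' = restrict (\<phi> \<circ> inv g) (g ` Z)"
  shows "marked (g ` Z) \<phi>'" "pt_act g (mk_pt \<Lambda> B Z \<phi>) = mk_pt \<Lambda> B (g ` Z) \<phi>'"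
proof -
  note gD = SpPlus_fullD[OF g]
  interpret marked_complement \<Lambda> B Z \<phi> using pp m by (rule marked_complementI)
  have \<phi>'g: "\<phi>' (g z) = \<phi> z" if "z \<in> Z" for z using that by (simp add: \<phi>' gD)
  have "zlin (g ` Z) \<phi>'"
    unfolding zlin_def
  proof (intro conjI ballI allI)
    fix u v assume "u \<in> g ` Z" "v \<in> g ` Z"
    then obtain x y where x: "x \<in> Z" "y \<in> Z" "u = g x" "v = g y" by blast
    then show "\<phi>' (u + v) = \<phi>' u + \<phi>' v"
      using \<phi>'g[of "x + y"] by (simp add: hlinearD[OF gD(2)] H'.subspace_add Zs \<phi>'g phil)
  next
    fix c u assume "u \<in> g ` Z"
    then obtain x where x: "x \<in> Z" "u = g x" by blast
    then show "\<phi>' (hscale c u) = c *s \<phi>' u"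
      using \<phi>'g[of "hscale c x"] by (simp add: hlinearD[OF gD(2)] H'.subspace_scale Zs \<phi>'g phil)
  qed
  moreover have "\<phi>' ` g ` Z = UNIV"
    unfolding image_image using phi_surj by (simp add: \<phi>'g cong: image_cong)
  ultimately show m': "marked (g ` Z) \<phi>'"
    unfolding marked_def using lagrangian_complement_image[OF g Z] by (simp add: \<phi>')
  interpret g: marked_complement \<Lambda> B "g ` Z" \<phi>' using pp m' by (rule marked_complementI)
  have ker: "zker (g ` Z) \<phi>' = g ` F"
    by (auto simp: zker_def \<phi>'g)
  have hl': "g.hl (g u) = g (hl u)" if "u \<in> Z" for u
  proof (rule g.hl_unique)
    show "g (hl u) \<in> Hplus" using hl(1) gD(6) by blast
    fix v assume "v \<in> g ` Z"
    then obtain w where "w \<in> Z" "v = g w" by blast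
    then show "hform (g (hl u)) v = of_real pi * B (\<phi>' (g u)) (\<phi>' v)"
      using that by (simp add: gD hl \<phi>'g)
  qed
  have "(image g) ` L = canonical_lattice \<Lambda> B (g ` Z) \<phi>'"
  proof -
    have c: "g ` ((u + hl u) +o F) = (g u + g.hl (g u)) +o zker (g ` Z) \<phi>'" if "u \<in> Z" for u
      using that by (simp add: image_coset gD ker hl' hlinearD[OF gD(2)])
    show ?thesis
    proof (rule set_eqI, rule iffI)
      fix A assume "A \<in> (image g) ` L"
      then obtain u where u: "u \<in> Z" "\<phi> u \<in> \<Lambda>" "A = g ` ((u + hl u) +o F)"
        by (auto simp: canonical_lattice_def)
      then have "A = (g u + g.hl (g u)) +o zker (g ` Z) \<phi>'" using c by simp
      moreover have "g u \<in> g ` Z" "\<phi>' (g u) \<in> \<Lambda>" using u by (simp_all add: \<phi>'g)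
      ultimately show "A \<in> canonical_lattice \<Lambda> B (g ` Z) \<phi>'"
        unfolding canonical_lattice_def by blast
    next
      fix A assume "A \<in> canonical_lattice \<Lambda> B (g ` Z) \<phi>'"
      then obtain v where v: "v \<in> g ` Z" "\<phi>' v \<in> \<Lambda>" "A = (v + g.hl v) +o zker (g ` Z) \<phi>'"
        unfolding canonical_lattice_def by blast
      then obtain u where u: "u \<in> Z" "v = g u" by blast
      then have "A = g ` ((u + hl u) +o F)" using v(3) c by simp
      moreover have "(u + hl u) +o F \<in> L" using u v(2) by (auto simp: canonical_lattice_def \<phi>'g)
      ultimately show "A \<in> (image g) ` L" by blast
    qed
  qed
  then show "pt_act g (mk_pt \<Lambda> B Z \<phi>) = mk_pt \<Lambda> B (g ` Z) \<phi>'"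
    by (simp add: pt_act_def mk_pt_def ker \<phi>'[symmetric])
qed

lemma pt_act_in_Sp:
  assumes "ppav \<Lambda> B" "g \<in> SpPlus_full" "p \<in> Sp \<Lambda> B"
  shows "pt_act g p \<in> Sp \<Lambda> B"
proof -
  obtain Z \<phi> where p: "marked Z \<phi>" "p = mk_pt \<Lambda> B Z \<phi>" using Sp_cases assms(1,3) by blast
  note a = pt_act_mk_pt[OF assms(1,2) p(1) refl]
  show ?thesis unfolding p(2) a(2) by (rule mk_pt_in_Sp[OF assms(1) a(1)])
qed

lemma pt_act_inv:
  assumes "ppav \<Lambda> B" "g \<in> SpPlus_full" "p \<in> Sp \<Lambda> B"
  shows "pt_act (inv g) (pt_act g p) = p"
proof -
  note gD = SpPlus_fullD[OF assms(2)]
  obtain Z \<phi> where p: "marked Z \<phi>" "p = mk_pt \<Lambda> B Z \<phi>" using Sp_cases assms(1,3) by blast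
  note a = pt_act_mk_pt[OF assms(1,2) p(1) refl]
  have Z: "inv g ` g ` Z = Z" by (simp add: image_image gD)
  have ii: "inv (inv g) = g" using gD(1) by (rule inv_inv_eq)
  have "restrict (restrict (\<phi> \<circ> inv g) (g ` Z) \<circ> inv (inv g)) Z = \<phi>"
  proof
    fix x show "restrict (restrict (\<phi> \<circ> inv g) (g ` Z) \<circ> inv (inv g)) Z x = \<phi> x"
    proof (cases "x \<in> Z")
      case True
      then have "g x \<in> g ` Z" by (rule imageI)
      with True show ?thesis by (simp only: ii restrict_apply o_apply if_True gD(8))
    next
      case False
      moreover have "\<phi> x = undefined" using p(1) False unfolding marked_def by (blast intro: extensional_arb)
      ultimately show ?thesis by (simp only: restrict_apply if_False)
    qed
  qed
  then show ?thesis
    using pt_act_mk_pt(2)[OF assms(1) inv_SpPlus_full[OF assms(2)] a(1) refl]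
    unfolding p(2) a(2) Z by simp
qed

lemma pt_act_inv':
  assumes "ppav \<Lambda> B" "g \<in> SpPlus_full" "p \<in> Sp \<Lambda> B"
  shows "pt_act g (pt_act (inv g) p) = p"
  using pt_act_inv[OF assms(1) inv_SpPlus_full[OF assms(2)] assms(3)] SpPlus_fullD(1)[OF assms(2)]
  by (simp add: inv_inv_eq)

text \<open>Points are pairs \<open>(Z, \<phi>)\<close>, so this is \<open>SpPlus_transitive\<close>.\<close>

proposition Sp_transitive:
  fixes \<Lambda> :: "(complex^'n) set"
  assumes pp: "ppav \<Lambda> B" and p: "p \<in> Sp \<Lambda> B" "p' \<in> Sp \<Lambda> B"
  shows "\<exists>g\<in>SpPlus. pt_act g p = p'"
proof -
  obtain Z \<phi> where m: "marked Z \<phi>" "p = mk_pt \<Lambda> B Z \<phi>" using Sp_cases[OF pp p(1)] by blast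
  obtain Z' \<phi>' where m': "marked Z' \<phi>'" "p' = mk_pt \<Lambda> B Z' \<phi>'" using Sp_cases[OF pp p(2)] by blast
  obtain g where g: "g \<in> SpPlus" "g ` Z = Z'" "\<And>z. z \<in> Z \<Longrightarrow> \<phi>' (g z) = \<phi> z"
    using SpPlus_transitive[of Z \<phi> Z' \<phi>'] m(1) m'(1) by (auto simp: marked_def)
  have gf: "g \<in> SpPlus_full" using g(1) SpPlus_subset by blast
  have "\<phi>' = restrict (\<phi> \<circ> inv g) (g ` Z)"
  proof
    fix x
    show "\<phi>' x = restrict (\<phi> \<circ> inv g) (g ` Z) x"
    proof (cases "x \<in> g ` Z")
      case True
      then obtain z where "z \<in> Z" "x = g z" by blast
      then show ?thesis by (simp add: g(3) SpPlus_fullD(8)[OF gf])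
    next
      case False
      then have "x \<notin> Z'" by (simp add: g(2))
      then have "\<phi>' x = undefined" using m'(1) unfolding marked_def by (blast intro: extensional_arb)
      then show ?thesis using False by simp
    qed
  qed
  then have "pt_act g p = p'"
    using pt_act_mk_pt(2)[OF pp gf m(1)] m(2) m'(2) g(2) by simp
  with g(1) show ?thesis by blast
qed

text \<open>A point exists: \<open>Z = t\<^sup>-\<^sup>1\<complex>[t\<^sup>-\<^sup>1]\<close>, with \<open>\<phi>\<close> reading off finitely many coefficients.\<close>

lemma lagrangian_complement_polar: "lagrangian_complement {x. \<forall>n>0. hcoeff x n = 0}" (is "lagrangian_complement ?Z")
proof -
  have sub: "H'.subspace ?Z" by (rule H'.subspaceI) auto
  have zero: "x = 0" if "x \<in> ?Z" "x \<in> Hplus" for x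
  proof (rule hp_eqI)
    fix n show "hcoeff x n = hcoeff 0 n"
      using that by (cases n "0 :: int" rule: linorder_cases) (auto simp: Hplus_iff)
  qed
  have iso: "hform x y = 0" if "x \<in> ?Z" "y \<in> ?Z" for x y
  proof -
    let ?s = "\<Sum>n\<in>polar_supp y. hscale (hcoeff y (- int (Suc n))) (hbasis (- int (Suc n)))"
    have b: "hbasis (- int (Suc n)) \<in> ?Z" for n by (simp add: hcoeff_hbasis)
    have "y - ?s \<in> ?Z"
      by (intro H'.subspace_diff H'.subspace_sum H'.subspace_scale sub b that)
    then have "y - ?s = 0" by (rule zero[OF _ polar_part])
    then have y: "y = ?s" by simp
    have "hform x (hbasis (- int (Suc n))) = 0" for n
      using that(1) by (simp add: hform_hbasis)
    then have "hform x ?s = 0"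
      unfolding hform_sum_right hform_scale_right by simp
    then show ?thesis by (subst y)
  qed
  have "perp ?Z = ?Z"
  proof
    show "?Z \<subseteq> perp ?Z" using iso by (auto simp: perp_def)
    show "perp ?Z \<subseteq> ?Z"
    proof
      fix x assume x: "x \<in> perp ?Z"
      have "hcoeff x n = 0" if n: "n > 0" for n
      proof -
        have "hbasis (- n) \<in> ?Z" using n by (simp add: hcoeff_hbasis)
        then have "hform x (hbasis (- n)) = 0" using x by (simp add: perp_def)
        then show ?thesis using n by (simp add: hform_hbasis)
      qed
      then show "x \<in> ?Z" by simp
    qed
  qed
  moreover have "0 \<in> ?Z" "0 \<in> Hplus" by (simp_all add: Hplus_iff)
  ultimately show ?thesis
    using sub zero by (auto simp: lagrangian_complement_def lagrangian_def)
qed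

lemma Sp_nonempty:
  fixes \<Lambda> :: "(complex^'n) set"
  assumes "ppav \<Lambda> B"
  shows "Sp \<Lambda> B \<noteq> {}"
proof -
  let ?Z = "{x. \<forall>n>0. hcoeff x n = 0}"
  obtain idx :: "'n \<Rightarrow> nat" where idx: "inj idx"
    using finite_imp_inj_to_nat_seg[of "UNIV :: 'n set"] by auto
  define \<phi> :: "hp \<Rightarrow> complex^'n" where "\<phi> = restrict (\<lambda>x. \<chi> i. hcoeff x (- int (Suc (idx i)))) ?Z"
  have Zs: "H'.subspace ?Z" by (rule lagrangian_complementD(1)[OF lagrangian_complement_polar])
  have "zlin ?Z \<phi>"
    unfolding zlin_def using H'.subspace_add[OF Zs] H'.subspace_scale[OF Zs]
    by (simp add: \<phi>_def vec_eq_iff del: of_nat_Suc)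
  moreover have "v \<in> \<phi> ` ?Z" for v
  proof
    let ?x = "\<Sum>i\<in>UNIV. hscale (v $ i) (hbasis (- int (Suc (idx i))))"
    show x: "?x \<in> ?Z"
      by (auto simp: hcoeff_sum hcoeff_hbasis)
    have "hcoeff ?x (- int (Suc (idx j))) = v $ j" for j
    proof -
      have "hcoeff ?x (- int (Suc (idx j))) = (\<Sum>i\<in>UNIV. if i = j then v $ i else 0)"
        unfolding hcoeff_sum by (intro sum.cong) (auto simp: hcoeff_hbasis inj_eq[OF idx])
      then show ?thesis by simp
    qed
    then show "v = \<phi> ?x" using x by (simp add: \<phi>_def vec_eq_iff del: of_nat_Suc)
  qed
  ultimately have "marked ?Z \<phi>"
    using lagrangian_complement_polar by (auto simp: marked_def \<phi>_def)
  then show ?thesis using mk_pt_in_Sp[OF assms] by blast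
qed

section \<open>Holomorphic functions on \<open>Sp(X,\<Theta>)\<close>\<close>

lemma topspace_SpTop [simp]: "topspace (SpTop \<Lambda> B) = Sp \<Lambda> B"
  by (simp add: SpTop_def topspace_pullback_topology)

lemma holo_openin: "holo \<Lambda> B U f \<Longrightarrow> openin (SpTop \<Lambda> B) U"
  by (simp add: holo_def)

lemma continuous_map_tendsto:
  "continuous_map X euclidean f \<longleftrightarrow> (\<forall>x\<in>topspace X. (f \<longlongrightarrow> f x) (atin X x))"
  by (simp add: continuous_map_atin limitin_canonical_iff)

lemma continuous_map_coord: "continuous_map (SpTop \<Lambda> B) euclidean (\<lambda>p. coord p i)"
proof -
  have "continuous_map (SpTop \<Lambda> B) euclidean ((\<lambda>x. x i) \<circ> coord)"
    unfolding SpTop_def by (rule continuous_map_pullback) simp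
  then show ?thesis by (simp add: o_def)
qed

lemma holo_const: "openin (SpTop \<Lambda> B) U \<Longrightarrow> holo \<Lambda> B U (\<lambda>_. c)"
  by (simp add: holo_def)

lemma holo_coord:
  assumes "openin (SpTop \<Lambda> B) U"
  shows "holo \<Lambda> B U (\<lambda>p. coord p i)"
  unfolding holo_def
proof (intro conjI allI impI)
  show "continuous_map (subtopology (SpTop \<Lambda> B) U) euclidean (\<lambda>p. coord p i)"
    by (rule continuous_map_from_subtopology[OF continuous_map_coord])
  fix D \<gamma> c d assume "open D \<and> \<gamma> ` D \<subseteq> U \<and> (\<forall>z\<in>D. \<forall>i. coord (\<gamma> z) i = c i + z * d i)"
  then have "(\<lambda>z. coord (\<gamma> z) i) holomorphic_on D \<longleftrightarrow> (\<lambda>z. c i + z * d i) holomorphic_on D"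
    by (intro holomorphic_cong) auto
  also have "(\<lambda>z. c i + z * d i) holomorphic_on D" by (intro holomorphic_intros)
  finally show "(\<lambda>z. coord (\<gamma> z) i) holomorphic_on D" by simp
qed fact

lemma holoD:
  assumes "holo \<Lambda> B U f"
  shows "openin (SpTop \<Lambda> B) U"
    "x \<in> topspace (subtopology (SpTop \<Lambda> B) U) \<Longrightarrow> (f \<longlongrightarrow> f x) (atin (subtopology (SpTop \<Lambda> B) U) x)"
    "open D \<and> \<gamma> ` D \<subseteq> U \<and> (\<forall>z\<in>D. \<forall>i. coord (\<gamma> z) i = c i + z * d i) \<Longrightarrow> (\<lambda>z. f (\<gamma> z)) holomorphic_on D"
proof -
  have *: "openin (SpTop \<Lambda> B) U \<and> (\<forall>x\<in>topspace (subtopology (SpTop \<Lambda> B) U). (f \<longlongrightarrow> f x) (atin (subtopology (SpTop \<Lambda> B) U) x)) \<and>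
    (\<forall>D \<gamma> c d. open D \<and> \<gamma> ` D \<subseteq> U \<and> (\<forall>z\<in>D. \<forall>i. coord (\<gamma> z) i = c i + z * d i) \<longrightarrow> (\<lambda>z. f (\<gamma> z)) holomorphic_on D)"
    using assms unfolding holo_def continuous_map_tendsto .
  show "openin (SpTop \<Lambda> B) U" using * by (rule conjunct1)
  show "x \<in> topspace (subtopology (SpTop \<Lambda> B) U) \<Longrightarrow> (f \<longlongrightarrow> f x) (atin (subtopology (SpTop \<Lambda> B) U) x)"
    using *[THEN conjunct2, THEN conjunct1] by (rule bspec)
  show "open D \<and> \<gamma> ` D \<subseteq> U \<and> (\<forall>z\<in>D. \<forall>i. coord (\<gamma> z) i = c i + z * d i) \<Longrightarrow> (\<lambda>z. f (\<gamma> z)) holomorphic_on D"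
    by (rule *[THEN conjunct2, THEN conjunct2, THEN spec, THEN spec, THEN spec, THEN spec, THEN mp])
qed

lemma holoI:
  assumes "openin (SpTop \<Lambda> B) U"
    "\<And>x. x \<in> topspace (subtopology (SpTop \<Lambda> B) U) \<Longrightarrow> (f \<longlongrightarrow> f x) (atin (subtopology (SpTop \<Lambda> B) U) x)"
    "\<And>D \<gamma> c d. open D \<and> \<gamma> ` D \<subseteq> U \<and> (\<forall>z\<in>D. \<forall>i. coord (\<gamma> z) i = c i + z * d i) \<Longrightarrow> (\<lambda>z. f (\<gamma> z)) holomorphic_on D"
  shows "holo \<Lambda> B U f"
  unfolding holo_def continuous_map_tendsto
proof (intro conjI allI impI ballI)
  show "openin (SpTop \<Lambda> B) U" by (rule assms(1))
qed (rule assms(2,3), assumption)+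

lemma holo_add:
  assumes f: "holo \<Lambda> B U f" and h: "holo \<Lambda> B U h"
  shows "holo \<Lambda> B U (\<lambda>p. f p + h p)"
  by (rule holoI) (intro tendsto_add holomorphic_on_add holoD[OF f] holoD[OF h]; assumption)+

lemma holo_mult:
  assumes f: "holo \<Lambda> B U f" and h: "holo \<Lambda> B U h"
  shows "holo \<Lambda> B U (\<lambda>p. f p * h p)"
  by (rule holoI) (intro tendsto_mult holomorphic_on_mult holoD[OF f] holoD[OF h]; assumption)+

lemma holo_inverse:
  assumes f: "holo \<Lambda> B U f" and nz: "\<And>p. p \<in> U \<Longrightarrow> f p \<noteq> 0"
  shows "holo \<Lambda> B U (\<lambda>p. inverse (f p))"
proof (rule holoI)
  show "((\<lambda>p. inverse (f p)) \<longlongrightarrow> inverse (f x)) (atin (subtopology (SpTop \<Lambda> B) U) x)"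
    if "x \<in> topspace (subtopology (SpTop \<Lambda> B) U)" for x
    using that by (intro tendsto_inverse holoD[OF f] nz) auto
  show "(\<lambda>z. inverse (f (\<gamma> z))) holomorphic_on D"
    if "open D \<and> \<gamma> ` D \<subseteq> U \<and> (\<forall>z\<in>D. \<forall>i. coord (\<gamma> z) i = c i + z * d i)" for D \<gamma> c d
    using that by (intro holomorphic_on_inverse holoD(3)[OF f that] nz) auto
qed (rule holoD(1)[OF f])

lemma holo_sum:
  assumes "openin (SpTop \<Lambda> B) U" "\<And>i. i \<in> A \<Longrightarrow> holo \<Lambda> B U (f i)"
  shows "holo \<Lambda> B U (\<lambda>p. \<Sum>i\<in>A. f i p)"
  using assms(2)
  by (induction A rule: infinite_finite_induct) (auto intro!: holo_add holo_const assms(1))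

lemma holo_prod:
  assumes "openin (SpTop \<Lambda> B) U" "\<And>i. i \<in> A \<Longrightarrow> holo \<Lambda> B U (f i)"
  shows "holo \<Lambda> B U (\<lambda>p. \<Prod>i\<in>A. f i p)"
  using assms(2)
  by (induction A rule: infinite_finite_induct) (auto intro!: holo_mult holo_const assms(1))

lemma holo_subset:
  assumes "holo \<Lambda> B U f" "openin (SpTop \<Lambda> B) V" "V \<subseteq> U"
  shows "holo \<Lambda> B V f"
  unfolding holo_def
proof (intro conjI allI impI)
  show "continuous_map (subtopology (SpTop \<Lambda> B) V) euclidean f"
    using assms by (auto simp: holo_def intro: continuous_map_from_subtopology_mono)
  fix D \<gamma> c d assume "open D \<and> \<gamma> ` D \<subseteq> V \<and> (\<forall>z\<in>D. \<forall>i. coord (\<gamma> z) i = c i + z * d i)"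
  then show "(\<lambda>z. f (\<gamma> z)) holomorphic_on D"
    using assms(1,3) unfolding holo_def by blast
qed fact

lemma holo_cong:
  assumes "holo \<Lambda> B U f" "\<And>p. p \<in> U \<Longrightarrow> f p = h p"
  shows "holo \<Lambda> B U h"
  unfolding holo_def
proof (intro conjI allI impI)
  show "continuous_map (subtopology (SpTop \<Lambda> B) U) euclidean h"
    using assms by (auto simp: holo_def intro: continuous_map_eq)
  fix D \<gamma> c d assume *: "open D \<and> \<gamma> ` D \<subseteq> U \<and> (\<forall>z\<in>D. \<forall>i. coord (\<gamma> z) i = c i + z * d i)"
  then have "(\<lambda>z. f (\<gamma> z)) holomorphic_on D"
    using assms(1) unfolding holo_def by blast
  then show "(\<lambda>z. h (\<gamma> z)) holomorphic_on D"
    by (rule holomorphic_transform) (use * assms(2) in blast)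
qed (use assms holo_openin in blast)

lemma holo_det:
  fixes M :: "'n::finite pt \<Rightarrow> complex^'k^'k"
  assumes "openin (SpTop \<Lambda> B) U" "\<And>i j. holo \<Lambda> B U (\<lambda>p. M p $ i $ j)"
  shows "holo \<Lambda> B U (\<lambda>p. det (M p))"
  unfolding det_def by (intro holo_sum holo_mult holo_prod holo_const assms)

text \<open>The group acts by affine transformations in coordinates, each involving only finitely many
  coordinates: \<open>g\<^sup>-\<^sup>1 t\<^sup>-\<^sup>m\<close> has a finite polar part, and \<open>g\<close> is continuous for the \<open>t\<close>-adic topology.\<close>

inductive_set affine_funs :: "('n::finite pt \<Rightarrow> complex) set" where
  const: "(\<lambda>_. c) \<in> affine_funs"
| coord: "(\<lambda>p. coord p i) \<in> affine_funs"
| add: "f \<in> affine_funs \<Longrightarrow> h \<in> affine_funs \<Longrightarrow> (\<lambda>p. f p + h p) \<in> affine_funs"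
| scale: "f \<in> affine_funs \<Longrightarrow> (\<lambda>p. c * f p) \<in> affine_funs"

lemma affine_funs_sum: "(\<And>i. i \<in> A \<Longrightarrow> f i \<in> affine_funs) \<Longrightarrow> (\<lambda>p. \<Sum>i\<in>A. f i p) \<in> affine_funs"
  by (induction A rule: infinite_finite_induct) (auto intro: affine_funs.intros)

lemma affine_funs_holo:
  assumes "f \<in> affine_funs" "openin (SpTop \<Lambda> B) U"
  shows "holo \<Lambda> B U f"
  using assms(1)
  by induction (auto intro!: holo_add holo_mult holo_const holo_coord assms(2))

lemma affine_funs_line:
  assumes "f \<in> affine_funs"
  shows "\<exists>a b. \<forall>p z. (\<forall>i. coord p i = c i + z * d i) \<longrightarrow> f p = a + z * b"
  using assms
proof induction
  case (const c)
  then show ?case by - (rule exI[of _ c], rule exI[of _ 0], simp)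
next
  case (coord i)
  then show ?case by - (rule exI[of _ "c i"], rule exI[of _ "d i"], simp)
next
  case (add f h)
  then obtain a b a' b' where *: "\<And>p z. (\<forall>i. coord p i = c i + z * d i) \<Longrightarrow> f p = a + z * b"
    "\<And>p z. (\<forall>i. coord p i = c i + z * d i) \<Longrightarrow> h p = a' + z * b'" by blast
  have "f p + h p = (a + a') + z * (b + b')" if "\<forall>i. coord p i = c i + z * d i" for p z
    using *(1)[OF that] *(2)[OF that] by (simp add: algebra_simps)
  then show ?case by blast
next
  case (scale f k)
  then obtain a b where *: "\<And>p z. (\<forall>i. coord p i = c i + z * d i) \<Longrightarrow> f p = a + z * b" by blast
  have "k * f p = k * a + z * (k * b)" if "\<forall>i. coord p i = c i + z * d i" for p z
    using *[OF that] by (simp add: algebra_simps)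
  then show ?case by blast
qed

lemma coord_mk_pt:
  "coord (mk_pt \<Lambda> B Z \<phi>) (Inl (m, k)) = hcoeff (zlift Z m) (int (Suc k))"
  "coord (mk_pt \<Lambda> B Z \<phi>) (Inr (m, i)) = \<phi> (zlift Z m) $ i"
  by (simp_all add: mk_pt_def del: of_nat_Suc)

lemma coord_pt_act:
  fixes \<Lambda> :: "(complex^'n) set"
  assumes pp: "ppav \<Lambda> B" and g: "g \<in> SpPlus_full"
  shows "\<exists>f\<in>affine_funs. \<forall>p\<in>Sp \<Lambda> B. coord (pt_act g p) i = f p"
proof -
  note gD = SpPlus_fullD[OF g]
  note lin = hlinearD[OF gD(2)]
  define x where "x m = inv g (hbasis (- int (Suc m)))" for m
  define c where "c m n = hcoeff (x m) (- int (Suc n))" for m n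
  have zl: "zlift (g ` Z) m = g (\<Sum>n\<in>polar_supp (x m). hscale (c m n) (zlift Z n))"
    if Z: "lagrangian_complement Z" for Z m
  proof -
    have "zlift (g ` Z) m = prj (g ` Z) (g (x m))"
      unfolding zlift_eq_prj[OF lagrangian_complement_image[OF g Z]] x_def gD(9) ..
    also have "\<dots> = g (prj Z (x m))" by (rule prj_image[OF g Z])
    finally show ?thesis unfolding prj_expand[OF Z] c_def .
  qed
  consider m k where "i = Inl (m, k)" | m j where "i = Inr (m, j)" by (metis surj_pair sum.exhaust)
  then show ?thesis
  proof cases
    case 1
    obtain K where K: "g ` hord K \<subseteq> hord (int k + 2)" using gD(3) unfolding tcont_def by meson
    define f where "f p = (\<Sum>n\<in>polar_supp (x m). c m n * (hcoeff (g (hbasis (- int (Suc n)))) (int (Suc k)) +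
      (\<Sum>l\<in>{1..<K}. hcoeff (g (hbasis l)) (int (Suc k)) * coord p (Inl (n, nat l - 1)))))" for p :: "'n pt"
    have "f \<in> affine_funs" unfolding f_def by (intro affine_funs_sum affine_funs.intros)
    moreover have "coord (pt_act g p) i = f p" if p: "p \<in> Sp \<Lambda> B" for p
    proof -
      obtain Z \<phi> where m: "marked Z \<phi>" "p = mk_pt \<Lambda> B Z \<phi>" using Sp_cases[OF pp p] by blast
      then have Z: "lagrangian_complement Z" by (simp add: marked_def)
      have 1: "hcoeff (g (zlift Z n)) (int (Suc k)) = hcoeff (g (hbasis (- int (Suc n)))) (int (Suc k)) +
        (\<Sum>l\<in>{1..<K}. hcoeff (g (hbasis l)) (int (Suc k)) * coord p (Inl (n, nat l - 1)))" for n
      proof -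
        let ?b = "hbasis (- int (Suc n))"
        define r where "r = zlift Z n - ?b"
        have r: "r \<in> hord 1" unfolding r_def hord_1 by (rule zlift(2)[OF Z])
        define s where "s = (\<Sum>l\<in>{1..<K}. hscale (hcoeff r l) (hbasis l))"
        have "r - s \<in> hord K" unfolding s_def by (rule hord_truncate[OF r])
        then have "g (r - s) \<in> hord (int k + 2)" using K by blast
        then have "hcoeff (g (r - s)) (int (Suc k)) = 0" by (rule hordD) simp
        moreover have "zlift Z n = ?b + s + (r - s)" by (simp add: r_def)
        then have "g (zlift Z n) = g ?b + g s + g (r - s)" by (simp only: lin(1))
        moreover have "hcoeff (g s) (int (Suc k)) = (\<Sum>l\<in>{1..<K}. hcoeff r l * hcoeff (g (hbasis l)) (int (Suc k)))"
          by (simp add: s_def lin hcoeff_sum)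
        moreover have "hcoeff r l = coord p (Inl (n, nat l - 1))" if "l \<in> {1..<K}" for l
        proof -
          have "int (Suc (nat l - 1)) = l" using that by auto
          then show ?thesis unfolding m(2) coord_mk_pt using that by (simp add: r_def hcoeff_hbasis del: of_nat_Suc)
        qed
        ultimately show ?thesis by (simp add: mult.commute)
      qed
      have "coord (pt_act g p) i = hcoeff (zlift (g ` Z) m) (int (Suc k))"
        unfolding 1 m(2) pt_act_mk_pt(2)[OF pp g m(1) refl] \<open>i = _\<close> coord_mk_pt ..
      also have "\<dots> = (\<Sum>n\<in>polar_supp (x m). c m n * hcoeff (g (zlift Z n)) (int (Suc k)))"
        by (simp add: zl[OF Z] lin hcoeff_sum del: of_nat_Suc)
      also have "\<dots> = f p" by (simp only: 1 f_def)
      finally show ?thesis .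
    qed
    ultimately show ?thesis by blast
  next
    case 2
    define f where "f p = (\<Sum>n\<in>polar_supp (x m). c m n * coord p (Inr (n, j)))" for p :: "'n pt"
    have "f \<in> affine_funs" unfolding f_def by (intro affine_funs_sum affine_funs.intros)
    moreover have "coord (pt_act g p) i = f p" if p: "p \<in> Sp \<Lambda> B" for p
    proof -
      obtain Z \<phi> where m: "marked Z \<phi>" "p = mk_pt \<Lambda> B Z \<phi>" using Sp_cases[OF pp p] by blast
      then have Z: "lagrangian_complement Z" and lin\<phi>: "zlin Z \<phi>" by (simp_all add: marked_def)
      note Zs = lagrangian_complementD(1)[OF Z]
      let ?z = "\<Sum>n\<in>polar_supp (x m). hscale (c m n) (zlift Z n)"
      have zZ: "?z \<in> Z" by (intro H'.subspace_sum H'.subspace_scale Zs zlift Z)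
      have "coord (pt_act g p) i = restrict (\<phi> \<circ> inv g) (g ` Z) (g ?z) $ j"
        unfolding m(2) pt_act_mk_pt(2)[OF pp g m(1) refl] \<open>i = _\<close> coord_mk_pt zl[OF Z] ..
      also have "\<dots> = \<phi> ?z $ j" using zZ by (simp add: gD)
      also have "\<phi> ?z = (\<Sum>n\<in>polar_supp (x m). \<phi> (hscale (c m n) (zlift Z n)))"
        by (intro zlinD[OF lin\<phi> Zs] H'.subspace_scale Zs zlift Z)
      also have "\<dots> = (\<Sum>n\<in>polar_supp (x m). c m n *s \<phi> (zlift Z n))"
        by (simp add: zlinD[OF lin\<phi> Zs] zlift[OF Z])
      finally show ?thesis by (simp add: f_def m(2) coord_mk_pt)
    qed
    ultimately show ?thesis by blast
  qed
qed

lemma continuous_map_pt_act: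
  assumes pp: "ppav \<Lambda> B" and g: "g \<in> SpPlus_full"
  shows "continuous_map (SpTop \<Lambda> B) (SpTop \<Lambda> B) (pt_act g)"
  unfolding SpTop_def[of \<Lambda> B]
proof (rule continuous_map_pullback', fold SpTop_def)
  show "topspace (SpTop \<Lambda> B) \<subseteq> pt_act g -` Sp \<Lambda> B"
    using pt_act_in_Sp[OF pp g] by auto
  have "continuous_map (SpTop \<Lambda> B) euclidean (\<lambda>p. coord (pt_act g p) i)" for i
  proof -
    obtain f where f: "f \<in> affine_funs" "\<And>p. p \<in> Sp \<Lambda> B \<Longrightarrow> coord (pt_act g p) i = f p"
      using coord_pt_act[OF pp g] by blast
    have "holo \<Lambda> B (Sp \<Lambda> B) f"
      by (rule affine_funs_holo[OF f(1)]) (metis openin_topspace topspace_SpTop)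
    then have "continuous_map (SpTop \<Lambda> B) euclidean f"
      by (simp add: holo_def) (metis subtopology_topspace topspace_SpTop)
    then show ?thesis by (rule continuous_map_eq) (simp add: f(2))
  qed
  then show "continuous_map (SpTop \<Lambda> B) euclidean (coord \<circ> pt_act g)"
    by (simp add: euclidean_product_topology[symmetric] continuous_map_componentwise_UNIV)
qed

lemma holo_pullback:
  assumes pp: "ppav \<Lambda> B" and g: "g \<in> SpPlus_full" and f: "holo \<Lambda> B U f"
  shows "holo \<Lambda> B {p \<in> Sp \<Lambda> B. pt_act g p \<in> U} (\<lambda>p. f (pt_act g p))"
proof -
  let ?V = "{p \<in> Sp \<Lambda> B. pt_act g p \<in> U}"
  note cont = continuous_map_pt_act[OF pp g]
  have V: "openin (SpTop \<Lambda> B) ?V"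
    using openin_continuous_map_preimage[OF cont holo_openin[OF f]] by simp
  show ?thesis
    unfolding holo_def
  proof (intro conjI allI impI)
    have "continuous_map (subtopology (SpTop \<Lambda> B) ?V) (subtopology (SpTop \<Lambda> B) U) (pt_act g)"
    proof (rule continuous_map_into_subtopology)
      show "continuous_map (subtopology (SpTop \<Lambda> B) ?V) (SpTop \<Lambda> B) (pt_act g)"
        by (rule continuous_map_from_subtopology[OF cont])
      show "pt_act g \<in> topspace (subtopology (SpTop \<Lambda> B) ?V) \<rightarrow> U"
        by (rule funcsetI) simp
    qed
    then have "continuous_map (subtopology (SpTop \<Lambda> B) ?V) euclidean (f \<circ> pt_act g)"
      using f unfolding holo_def by (blast intro: continuous_map_compose)
    then show "continuous_map (subtopology (SpTop \<Lambda> B) ?V) euclidean (\<lambda>p. f (pt_act g p))"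
      by (simp add: o_def)
    fix D \<gamma> c d assume *: "open D \<and> \<gamma> ` D \<subseteq> ?V \<and> (\<forall>z\<in>D. \<forall>i. coord (\<gamma> z) i = c i + z * d i)"
    have "\<exists>a b. \<forall>z\<in>D. coord (pt_act g (\<gamma> z)) i = a + z * b" for i
    proof -
      obtain h where h: "h \<in> affine_funs" "\<And>p. p \<in> Sp \<Lambda> B \<Longrightarrow> coord (pt_act g p) i = h p"
        using coord_pt_act[OF pp g] by blast
      obtain a b where ab: "\<And>p z. (\<forall>i. coord p i = c i + z * d i) \<Longrightarrow> h p = a + z * b"
        using affine_funs_line[OF h(1), of c d] by blast
      have "coord (pt_act g (\<gamma> z)) i = a + z * b" if "z \<in> D" for z
      proof -
        have "\<gamma> z \<in> Sp \<Lambda> B" using * that by blast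
        moreover have "h (\<gamma> z) = a + z * b" by (rule ab) (use * that in blast)
        ultimately show ?thesis by (simp only: h(2))
      qed
      then show ?thesis by blast
    qed
    then obtain a b where "\<And>i z. z \<in> D \<Longrightarrow> coord (pt_act g (\<gamma> z)) i = a i + z * b i" by metis
    moreover have "(\<lambda>z. pt_act g (\<gamma> z)) ` D \<subseteq> U" using * by auto
    ultimately show "(\<lambda>z. f (pt_act g (\<gamma> z))) holomorphic_on D"
      using * by (intro holoD(3)[OF f, of D "\<lambda>z. pt_act g (\<gamma> z)" a b] conjI ballI allI) simp_all
  qed (rule V)
qed

section \<open>Polynomials\<close>

definition vars_in :: "'v set \<Rightarrow> 'v mpoly \<Rightarrow> bool" where
  "vars_in W p \<longleftrightarrow> (\<forall>m\<in>Poly_Mapping.keys p. Poly_Mapping.keys m \<subseteq> W)"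

lemma PConst_1: "PConst 1 = 1"
  by (simp add: PConst_def)

lemma PConst_sum: "PConst (sum f A) = (\<Sum>i\<in>A. PConst (f i))"
  by (induction A rule: infinite_finite_induct) (simp_all add: PConst_0 PConst_add)

lemma PConst_uminus: "PConst (- c) = - PConst c"
  by (simp add: PConst_def single_uminus)

lemma psubst_uminus: "psubst f (- p) = - psubst f p"
  using psubst_add[of f p "- p"] by (simp add: psubst_0 eq_neg_iff_add_eq_0 add.commute)

lemma psubst_diff: "psubst f (p - q) = psubst f p - psubst f q"
  using psubst_add[of f p "- q"] by (simp add: psubst_uminus)

lemma psubst_1: "psubst f 1 = 1"
  using psubst_PConst[of f 1] by (simp add: PConst_1)

lemma PVar_power: "PVar v ^ k = Poly_Mapping.single (Poly_Mapping.single v k) 1"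
proof (induction k)
  case (Suc k)
  then show ?case by (simp add: PVar_def mult_single single_add[symmetric])
qed simp

lemma monomial_eq_prod:
  fixes m :: "'v \<Rightarrow>\<^sub>0 nat"
  shows "(\<Prod>v\<in>Poly_Mapping.keys m. PVar v ^ Poly_Mapping.lookup m v) = Poly_Mapping.single m (1::complex)"
proof -
  have *: "(\<Prod>v\<in>A. PVar v ^ Poly_Mapping.lookup m v) =
      Poly_Mapping.single (\<Sum>v\<in>A. Poly_Mapping.single v (Poly_Mapping.lookup m v)) (1::complex)"
    if "finite A" for A :: "'v set"
    using that by (induction A) (simp_all add: PVar_power mult_single)
  have "(\<Sum>v\<in>Poly_Mapping.keys m. Poly_Mapping.single v (Poly_Mapping.lookup m v)) = m"
  proof (rule poly_mapping_eqI)
    fix w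
    have "Poly_Mapping.lookup (\<Sum>v\<in>Poly_Mapping.keys m. Poly_Mapping.single v (Poly_Mapping.lookup m v)) w =
      (\<Sum>v\<in>Poly_Mapping.keys m. if v = w then Poly_Mapping.lookup m w else 0)"
      unfolding lookup_sum by (intro sum.cong) (auto simp: lookup_single when_def)
    then show "Poly_Mapping.lookup (\<Sum>v\<in>Poly_Mapping.keys m. Poly_Mapping.single v (Poly_Mapping.lookup m v)) w =
      Poly_Mapping.lookup m w" by (simp add: in_keys_iff)
  qed
  then show ?thesis by (simp add: *)
qed

lemma psubst_PVar_id: "psubst PVar p = p"
proof (induction p rule: poly_mapping_single_induct)
  case (2 m c q)
  have "psubst PVar (Poly_Mapping.single m c) = Poly_Mapping.single m c"
    unfolding psubst_single monomial_eq_prod by (simp add: PConst_def mult_single)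
  with 2 show ?case by (simp add: psubst_add)
qed (simp add: psubst_0)

lemma mpoly_induct_in [consumes 1, case_names const var add mult]:
  assumes "vars_in W p"
    and const: "\<And>c. P (PConst c)" and var: "\<And>v. v \<in> W \<Longrightarrow> P (PVar v)"
    and add: "\<And>p q. P p \<Longrightarrow> P q \<Longrightarrow> P (p + q)" and mult: "\<And>p q. P p \<Longrightarrow> P q \<Longrightarrow> P (p * q)"
  shows "P p"
proof -
  have sum: "P (sum f A)" if "\<And>i. i \<in> A \<Longrightarrow> P (f i)" for f and A :: "('a \<Rightarrow>\<^sub>0 nat) set"
    using that by (induction A rule: infinite_finite_induct) (auto intro: add const[of 0, unfolded PConst_0])
  have prod: "P (prod f A)" if "\<And>i. i \<in> A \<Longrightarrow> P (f i)" for f and A :: "'a set"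
    using that by (induction A rule: infinite_finite_induct) (auto intro: mult const[of 1, unfolded PConst_1])
  have pow: "P (PVar v ^ k)" if "v \<in> W" for v and k :: nat
    by (induction k) (auto intro: mult var that const[of 1, unfolded PConst_1])
  have "P (psubst PVar p)"
    unfolding psubst_def using assms(1) by (intro sum mult const prod pow) (auto simp: vars_in_def)
  then show ?thesis by (simp add: psubst_PVar_id)
qed

lemma mpoly_induct [case_names const var add mult]:
  assumes "\<And>c. P (PConst c)" "\<And>v. P (PVar v)"
    "\<And>p q. P p \<Longrightarrow> P q \<Longrightarrow> P (p + q)" "\<And>p q. P p \<Longrightarrow> P q \<Longrightarrow> P (p * q)"
  shows "P p"
  by (rule mpoly_induct_in[of UNIV p P]) (auto simp: vars_in_def assms)

lemma psubst_psubst: "psubst f (psubst g p) = psubst (\<lambda>v. psubst f (g v)) p"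
  by (induction p rule: mpoly_induct) (simp_all add: psubst_PConst psubst_PVar psubst_add psubst_mult)

definition linform :: "complex^'n \<Rightarrow> 'n mpoly" where
  "linform v = (\<Sum>i\<in>UNIV. PConst (v $ i) * PVar i)"

lemma linform_add: "linform (u + v) = linform u + linform v"
  by (simp add: linform_def PConst_add distrib_right sum.distrib)

lemma linform_scale: "linform (c *s v) = PConst c * linform v"
  by (simp add: linform_def PConst_mult sum_distrib_left mult.assoc)

lemma linform_0: "linform 0 = 0"
  by (simp add: linform_def PConst_0)

lemma linform_sum: "linform (sum f A) = (\<Sum>i\<in>A. linform (f i))"
  by (induction A rule: infinite_finite_induct) (simp_all add: linform_0 linform_add)

lemma linform_axis: "linform (axis i 1) = PVar i"
proof -
  have "linform (axis i 1) = (\<Sum>j\<in>UNIV. if j = i then PVar i else 0)"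
    unfolding linform_def by (intro sum.cong) (auto simp: axis_def PConst_1 PConst_0)
  then show ?thesis by simp
qed

section \<open>Evaluation of the Fock space in \<open>Sym(Z/F)\<close>\<close>

text \<open>The quotient map \<open>\<pi>\<^sup>0 = Sym(H'/H'\<^sub>+) = Sym(Z) \<rightarrow> Sym(Z/F) = \<complex>[X\<^sub>i]\<close> at a point \<open>(Z,\<phi>)\<close>, in coordinates.\<close>

definition ev :: "'n::finite pt \<Rightarrow> fock \<Rightarrow> 'n mpoly" where
  "ev p = psubst (\<lambda>n. linform (\<chi> i. coord p (Inr (n, i))))"

lemmas ev_simps = psubst_add[of "\<lambda>n. linform (\<chi> i. coord p (Inr (n, i)))" for p, folded ev_def]
  psubst_mult[of "\<lambda>n. linform (\<chi> i. coord p (Inr (n, i)))" for p, folded ev_def]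
  psubst_diff[of "\<lambda>n. linform (\<chi> i. coord p (Inr (n, i)))" for p, folded ev_def]
  psubst_PConst[of "\<lambda>n. linform (\<chi> i. coord p (Inr (n, i)))" for p, folded ev_def]
  psubst_PVar[of "\<lambda>n. linform (\<chi> i. coord p (Inr (n, i)))" for p, folded ev_def]
  psubst_0[of "\<lambda>n. linform (\<chi> i. coord p (Inr (n, i)))" for p, folded ev_def]
  psubst_1[of "\<lambda>n. linform (\<chi> i. coord p (Inr (n, i)))" for p, folded ev_def]
  psubst_sum[of "\<lambda>n. linform (\<chi> i. coord p (Inr (n, i)))" for p, folded ev_def]

lemma ev_PVar: "ev (mk_pt \<Lambda> B Z \<phi>) (PVar n) = linform (\<phi> (zlift Z n))"
  by (simp add: ev_simps coord_mk_pt)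

lemma polar_sum: "polar (sum h A) = (\<Sum>i\<in>A. polar (h i))"
  by (induction A rule: infinite_finite_induct) (simp_all add: polar_add, simp_all add: polar_def)

lemma polar_eqI: "x - y \<in> Hplus \<Longrightarrow> polar x = polar y"
  using polar_add[of "x - y" y] polar_Hplus[of "x - y"] by simp

lemma polar_hbasis: "polar (hbasis (- int (Suc n))) = PVar n"
proof -
  have "polar (hbasis (- int (Suc n))) =
      (\<Sum>m\<in>{n}. PConst (hcoeff (hbasis (- int (Suc n))) (- int (Suc m))) * PVar m)"
    by (rule polar_superset) (auto simp: hcoeff_hbasis)
  then show ?thesis by (simp add: hcoeff_hbasis PConst_1)
qed

lemma polar_zlift: "lagrangian_complement Z \<Longrightarrow> polar (zlift Z n) = PVar n"
  using polar_eqI[OF zlift(2)] polar_hbasis by simp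

lemma polar_prj:
  assumes "lagrangian_complement Z"
  shows "polar (prj Z x) = polar x"
  using polar_eqI[OF prj(2)[OF assms]] by simp

text \<open>The polar part of \<open>f\<close> is that of its projection to \<open>Z\<close>, so evaluation acts on \<open>f\<close> through \<open>Z/F\<close>; in
  particular it kills \<open>F\<close>.\<close>

lemma ev_polar:
  assumes "marked Z \<phi>"
  shows "ev (mk_pt \<Lambda> B Z \<phi>) (polar f) = linform (\<phi> (prj Z f))"
proof -
  have Z: "lagrangian_complement Z" and lin: "zlin Z \<phi>" using assms by (simp_all add: marked_def)
  note Zs = lagrangian_complementD(1)[OF Z] and l = zlinD[OF lin Zs]
  have "\<phi> (prj Z f) = (\<Sum>n\<in>polar_supp f. \<phi> (hscale (hcoeff f (- int (Suc n))) (zlift Z n)))"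
    unfolding prj_expand[OF Z] by (intro l H'.subspace_scale Zs zlift Z)
  also have "\<dots> = (\<Sum>n\<in>polar_supp f. hcoeff f (- int (Suc n)) *s \<phi> (zlift Z n))"
    by (simp add: l zlift[OF Z])
  finally have "linform (\<phi> (prj Z f)) = (\<Sum>n\<in>polar_supp f. PConst (hcoeff f (- int (Suc n))) * linform (\<phi> (zlift Z n)))"
    by (simp only: linform_sum linform_scale)
  then show ?thesis
    unfolding polar_def polar_supp_def by (simp only: ev_simps(2,4,8) ev_PVar)
qed

text \<open>Group elements commute with the projections along \<open>H'\<^sub>+\<close>, and \<open>g\<close> carries \<open>\<phi>\<close> to the marking of the
  translated point.\<close>

lemma ev_equivariant:
  fixes \<Lambda> :: "(complex^'n) set"
  assumes pp: "ppav \<Lambda> B" and g: "g \<in> SpPlus_full" and p: "p \<in> Sp \<Lambda> B"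
  shows "ev (pt_act g p) (fock_act g v) = ev p v"
proof -
  note gD = SpPlus_fullD[OF g]
  obtain Z \<phi> where m: "marked Z \<phi>" "p = mk_pt \<Lambda> B Z \<phi>" using Sp_cases[OF pp p] by blast
  then have Z: "lagrangian_complement Z" by (simp add: marked_def)
  note a = pt_act_mk_pt[OF pp g m(1) refl]
  have "ev (pt_act g p) (polar (g (hbasis (- int (Suc n))))) = ev p (PVar n)" for n
  proof -
    have "prj (g ` Z) (g (hbasis (- int (Suc n)))) = g (zlift Z n)"
      unfolding prj_image[OF g Z] zlift_eq_prj[OF Z] ..
    then have "ev (pt_act g p) (polar (g (hbasis (- int (Suc n))))) =
        linform (restrict (\<phi> \<circ> inv g) (g ` Z) (g (zlift Z n)))"
      unfolding m(2) a(2) ev_polar[OF a(1)] by simp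
    also have "\<dots> = linform (\<phi> (zlift Z n))" using zlift(1)[OF Z] by (simp add: gD)
    finally show ?thesis unfolding m(2) ev_PVar .
  qed
  then show ?thesis
    by (simp add: fock_act_def ev_def psubst_psubst psubst_PVar)
qed

section \<open>Local sections\<close>

lemma sum_lessThan_append:
  fixes f g :: "nat \<Rightarrow> 'a::comm_monoid_add"
  shows "(\<Sum>k<n. f k) + (\<Sum>k<m. g k) = (\<Sum>k<n + m. if k < n then f k else g (k - n))"
proof -
  have "(\<Sum>k<n + m. if k < n then f k else g (k - n)) =
    (\<Sum>k<n. f k) + (\<Sum>k\<in>{n..<n + m}. g (k - n))"
    unfolding lessThan_atLeast0 sum.atLeastLessThan_concat[of 0 n "n + m", symmetric, simplified] by simp
  also have "(\<Sum>k\<in>{n..<n + m}. g (k - n)) = (\<Sum>k<m. g k)"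
    using sum.shift_bounds_nat_ivl[of "\<lambda>k. g (k - n)" 0 n m] by (simp add: lessThan_atLeast0 add.commute)
  finally show ?thesis ..
qed

lemma fock_section_single: "holo \<Lambda> B U f \<Longrightarrow> fock_section \<Lambda> B U (\<lambda>b. PConst (f b) * v)"
  unfolding fock_section_def by (rule exI[of _ 1], rule exI[of _ "\<lambda>_. v"], rule exI[of _ "\<lambda>_. f"]) simp

lemma fock_section_const: "openin (SpTop \<Lambda> B) U \<Longrightarrow> fock_section \<Lambda> B U (\<lambda>_. v)"
  using fock_section_single[OF holo_const[of \<Lambda> B U 1], of v] by (simp add: PConst_1)

lemma fock_section_add:
  assumes "fock_section \<Lambda> B U \<sigma>" "fock_section \<Lambda> B U \<tau>"
  shows "fock_section \<Lambda> B U (\<lambda>b. \<sigma> b + \<tau> b)"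
proof -
  obtain n v f where 1: "\<forall>k<n. holo \<Lambda> B U (f k)" "\<forall>b\<in>U. \<sigma> b = (\<Sum>k<(n::nat). PConst (f k b) * v k)"
    using assms(1) unfolding fock_section_def by blast
  obtain m w h where 2: "\<forall>k<m. holo \<Lambda> B U (h k)" "\<forall>b\<in>U. \<tau> b = (\<Sum>k<(m::nat). PConst (h k b) * w k)"
    using assms(2) unfolding fock_section_def by blast
  let ?f = "\<lambda>k. if k < n then f k else h (k - n)" and ?v = "\<lambda>k. if k < n then v k else w (k - n)"
  have "\<forall>k<n + m. holo \<Lambda> B U (?f k)" using 1(1) 2(1) by auto
  moreover have "\<forall>b\<in>U. \<sigma> b + \<tau> b = (\<Sum>k<n + m. PConst (?f k b) * ?v k)"
  proof
    fix b assume "b \<in> U"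
    then have "\<sigma> b + \<tau> b = (\<Sum>k<n. PConst (f k b) * v k) + (\<Sum>k<m. PConst (h k b) * w k)"
      using 1(2) 2(2) by simp
    also have "\<dots> = (\<Sum>k<n + m. PConst (?f k b) * ?v k)"
      unfolding sum_lessThan_append by (rule sum.cong) simp_all
    finally show "\<sigma> b + \<tau> b = (\<Sum>k<n + m. PConst (?f k b) * ?v k)" .
  qed
  ultimately show ?thesis
    unfolding fock_section_def by (intro exI[of _ "n + m"] exI[of _ ?v] exI[of _ ?f] conjI)
qed

lemma fock_section_scale:
  assumes "fock_section \<Lambda> B U \<sigma>" "holo \<Lambda> B U h"
  shows "fock_section \<Lambda> B U (\<lambda>b. PConst (h b) * w * \<sigma> b)"
proof -
  obtain n v f where 1: "\<forall>k<n. holo \<Lambda> B U (f k)" "\<forall>b\<in>U. \<sigma> b = (\<Sum>k<(n::nat). PConst (f k b) * v k)"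
    using assms(1) unfolding fock_section_def by blast
  have "\<forall>k<n. holo \<Lambda> B U (\<lambda>b. h b * f k b)" using 1(1) assms(2) by (auto intro: holo_mult)
  moreover have "\<forall>b\<in>U. PConst (h b) * w * \<sigma> b = (\<Sum>k<n. PConst (h b * f k b) * (w * v k))"
    using 1(2) by (simp add: sum_distrib_left PConst_mult mult_ac)
  ultimately show ?thesis unfolding fock_section_def
    by (intro exI[of _ n] exI[of _ "\<lambda>k. w * v k"] exI[of _ "\<lambda>k b. h b * f k b"] conjI)
qed

lemma fock_section_cong:
  assumes "fock_section \<Lambda> B U \<sigma>" "\<And>b. b \<in> U \<Longrightarrow> \<sigma> b = \<tau> b"
  shows "fock_section \<Lambda> B U \<tau>"
proof -
  have "(\<forall>b\<in>U. \<tau> b = s b) \<longleftrightarrow> (\<forall>b\<in>U. \<sigma> b = s b)" for s using assms(2) by simp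
  with assms(1) show ?thesis unfolding fock_section_def by (simp only:)
qed

lemma fock_section_subset:
  "fock_section \<Lambda> B U \<sigma> \<Longrightarrow> openin (SpTop \<Lambda> B) V \<Longrightarrow> V \<subseteq> U \<Longrightarrow> fock_section \<Lambda> B V \<sigma>"
  unfolding fock_section_def by (meson holo_subset subsetD)

lemma fock_section_sum:
  assumes "openin (SpTop \<Lambda> B) U" "\<And>i. i \<in> A \<Longrightarrow> fock_section \<Lambda> B U (\<sigma> i)"
  shows "fock_section \<Lambda> B U (\<lambda>b. \<Sum>i\<in>A. \<sigma> i b)"
  using assms(2)
  by (induction A rule: infinite_finite_induct) (auto intro!: fock_section_add fock_section_const assms(1))

lemma fock_section_mult:
  assumes U: "openin (SpTop \<Lambda> B) U" and "fock_section \<Lambda> B U \<sigma>" "fock_section \<Lambda> B U \<tau>"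
  shows "fock_section \<Lambda> B U (\<lambda>b. \<sigma> b * \<tau> b)"
proof -
  obtain n v f where 1: "\<forall>k<n. holo \<Lambda> B U (f k)" "\<forall>b\<in>U. \<sigma> b = (\<Sum>k<(n::nat). PConst (f k b) * v k)"
    using assms(2) unfolding fock_section_def by blast
  have "fock_section \<Lambda> B U (\<lambda>b. \<Sum>k<n. PConst (f k b) * v k * \<tau> b)"
    by (intro fock_section_sum U fock_section_scale assms(3)) (use 1 in auto)
  then show ?thesis by (rule fock_section_cong) (simp add: 1(2) sum_distrib_right)
qed

lemma fock_section_psubst:
  assumes U: "openin (SpTop \<Lambda> B) U" and "\<And>i. fock_section \<Lambda> B U (\<lambda>b. \<theta> b i)"
  shows "fock_section \<Lambda> B U (\<lambda>b. psubst (\<theta> b) P)"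
  by (induction P rule: mpoly_induct)
    (simp_all add: psubst_PConst psubst_PVar psubst_add psubst_mult fock_section_const fock_section_add
      fock_section_mult assms)

text \<open>The condition that defines \<open>out_germs\<close>, on a fixed open set.\<close>

definition out_section :: "nat \<Rightarrow> (complex^'n) set \<Rightarrow> (complex^'n \<Rightarrow> complex^'n \<Rightarrow> complex)
    \<Rightarrow> 'n pt set \<Rightarrow> ('n pt \<Rightarrow> fock) \<Rightarrow> bool" where
  "out_section N \<Lambda> B U \<tau> \<longleftrightarrow> (\<exists>(n::nat) A f \<sigma>. (\<forall>k<n. taut_section \<Lambda> B U (f k) \<and> fock_section \<Lambda> B U (\<sigma> k)) \<and>
        (\<forall>b\<in>U. \<tau> b = (\<Sum>k<n. heis N (A k) (f k b) (\<sigma> k b))))"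

lemma out_germs_eq: "out_germs N \<Lambda> B p = {\<tau>. \<exists>U. openin (SpTop \<Lambda> B) U \<and> p \<in> U \<and> out_section N \<Lambda> B U \<tau>}"
  by (simp add: out_germs_def out_section_def)

lemma out_section_0: "out_section N \<Lambda> B U (\<lambda>_. 0)"
  unfolding out_section_def by (rule exI[of _ 0]) simp

lemma out_section_cong:
  assumes "out_section N \<Lambda> B U \<sigma>" "\<And>b. b \<in> U \<Longrightarrow> \<sigma> b = \<tau> b"
  shows "out_section N \<Lambda> B U \<tau>"
proof -
  have "(\<forall>b\<in>U. \<tau> b = s b) \<longleftrightarrow> (\<forall>b\<in>U. \<sigma> b = s b)" for s using assms(2) by simp
  with assms(1) show ?thesis unfolding out_section_def by (simp only:)
qed

lemma out_section_add:
  assumes "out_section N \<Lambda> B U \<tau>" "out_section N \<Lambda> B U \<tau>'"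
  shows "out_section N \<Lambda> B U (\<lambda>b. \<tau> b + \<tau>' b)"
proof -
  obtain n A f \<sigma> where 1: "\<forall>k<n. taut_section \<Lambda> B U (f k) \<and> fock_section \<Lambda> B U (\<sigma> k)"
    "\<forall>b\<in>U. \<tau> b = (\<Sum>k<(n::nat). heis N (A k) (f k b) (\<sigma> k b))"
    using assms(1) unfolding out_section_def by blast
  obtain n' A' f' \<sigma>' where 2: "\<forall>k<n'. taut_section \<Lambda> B U (f' k) \<and> fock_section \<Lambda> B U (\<sigma>' k)"
    "\<forall>b\<in>U. \<tau>' b = (\<Sum>k<(n'::nat). heis N (A' k) (f' k b) (\<sigma>' k b))"
    using assms(2) unfolding out_section_def by blast
  let ?A = "\<lambda>k. if k < n then A k else A' (k - n)" and ?f = "\<lambda>k. if k < n then f k else f' (k - n)"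
    and ?s = "\<lambda>k. if k < n then \<sigma> k else \<sigma>' (k - n)"
  have "\<forall>k<n + n'. taut_section \<Lambda> B U (?f k) \<and> fock_section \<Lambda> B U (?s k)" using 1(1) 2(1) by auto
  moreover have "\<forall>b\<in>U. \<tau> b + \<tau>' b = (\<Sum>k<n + n'. heis N (?A k) (?f k b) (?s k b))"
  proof
    fix b assume "b \<in> U"
    then have "\<tau> b + \<tau>' b = (\<Sum>k<n. heis N (A k) (f k b) (\<sigma> k b)) + (\<Sum>k<n'. heis N (A' k) (f' k b) (\<sigma>' k b))"
      using 1(2) 2(2) by simp
    also have "\<dots> = (\<Sum>k<n + n'. heis N (?A k) (?f k b) (?s k b))"
      unfolding sum_lessThan_append by (rule sum.cong) simp_all
    finally show "\<tau> b + \<tau>' b = (\<Sum>k<n + n'. heis N (?A k) (?f k b) (?s k b))" .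
  qed
  ultimately show ?thesis
    unfolding out_section_def by (intro exI[of _ "n + n'"] exI[of _ ?A] exI[of _ ?f] exI[of _ ?s] conjI)
qed

lemma out_section_sum:
  "(\<And>i. i \<in> A \<Longrightarrow> out_section N \<Lambda> B U (\<tau> i)) \<Longrightarrow> out_section N \<Lambda> B U (\<lambda>b. \<Sum>i\<in>A. \<tau> i b)"
  by (induction A rule: infinite_finite_induct) (auto intro!: out_section_add out_section_0)

lemma out_section_mult:
  assumes U: "openin (SpTop \<Lambda> B) U" and "out_section N \<Lambda> B U \<tau>" "fock_section \<Lambda> B U \<rho>"
  shows "out_section N \<Lambda> B U (\<lambda>b. \<tau> b * \<rho> b)"
proof -
  obtain n A f \<sigma> where 1: "\<forall>k<n. taut_section \<Lambda> B U (f k) \<and> fock_section \<Lambda> B U (\<sigma> k)"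
    "\<forall>b\<in>U. \<tau> b = (\<Sum>k<(n::nat). heis N (A k) (f k b) (\<sigma> k b))"
    using assms(2) unfolding out_section_def by blast
  have "\<forall>k<n. taut_section \<Lambda> B U (f k) \<and> fock_section \<Lambda> B U (\<lambda>b. \<sigma> k b * \<rho> b)"
    using 1(1) assms(3) fock_section_mult[OF U] by blast
  moreover have "\<forall>b\<in>U. \<tau> b * \<rho> b = (\<Sum>k<n. heis N (A k) (f k b) (\<sigma> k b * \<rho> b))"
    using 1(2) by (simp add: sum_distrib_right heis_def mult.assoc)
  ultimately show ?thesis
    unfolding out_section_def by (intro exI[of _ n] exI[of _ A] exI[of _ f] exI[of _ "\<lambda>k b. \<sigma> k b * \<rho> b"] conjI)
qed

lemma heis_H1:
  assumes "N \<ge> 1"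
  shows "heis N (H1 N) f v = polar f * v"
proof -
  have "sqrt (2 * real N) \<noteq> 0" using assms by simp
  then have "complex_of_real (1 / sqrt (2 * real N)) * complex_of_real (sqrt (2 * real N)) = 1"
    by (metis nonzero_eq_divide_eq of_real_1 of_real_mult)
  then show ?thesis by (simp add: heis_def H1_def PConst_1)
qed

lemma out_section_polar:
  assumes "N \<ge> 1" "openin (SpTop \<Lambda> B) U" "taut_section \<Lambda> B U f"
  shows "out_section N \<Lambda> B U (\<lambda>b. polar (f b))"
  unfolding out_section_def
  by (rule exI[of _ 1], rule exI[of _ "\<lambda>_. H1 N"], rule exI[of _ "\<lambda>_. f"], rule exI[of _ "\<lambda>_ _. 1"])
    (use assms in \<open>simp add: heis_H1 fock_section_const\<close>)

text \<open>A section of the tautological sheaf has bounded poles, so only finitely many variables occur.\<close>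

lemma fock_section_polar:
  assumes U: "openin (SpTop \<Lambda> B) U" and f: "taut_section \<Lambda> B U f"
  shows "fock_section \<Lambda> B U (\<lambda>b. polar (f b))"
proof -
  obtain M where M: "\<And>b m. b \<in> U \<Longrightarrow> m < M \<Longrightarrow> hcoeff (f b) m = 0"
    using f unfolding taut_section_def by blast
  have "fock_section \<Lambda> B U (\<lambda>b. \<Sum>n<nat (- M). PConst (hcoeff (f b) (- int (Suc n))) * PVar n)"
    using f unfolding taut_section_def by (intro fock_section_sum U fock_section_single) blast
  then show ?thesis
  proof (rule fock_section_cong)
    fix b assume b: "b \<in> U"
    have "{n. hcoeff (f b) (- int (Suc n)) \<noteq> 0} \<subseteq> {..<nat (- M)}"
    proof
      fix n assume n: "n \<in> {n. hcoeff (f b) (- int (Suc n)) \<noteq> 0}"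
      have "\<not> - int (Suc n) < M"
      proof
        assume "- int (Suc n) < M"
        from M[OF b this] n show False by simp
      qed
      then show "n \<in> {..<nat (- M)}" by simp
    qed
    then show "(\<Sum>n<nat (- M). PConst (hcoeff (f b) (- int (Suc n))) * PVar n) = polar (f b)"
      by (rule polar_superset[OF finite_lessThan, symmetric])
  qed
qed

lemma out_section_imp:
  fixes \<Lambda> :: "(complex^'n) set"
  assumes pp: "ppav \<Lambda> B" and U: "openin (SpTop \<Lambda> B) U" and "out_section N \<Lambda> B U \<tau>"
  shows "fock_section \<Lambda> B U \<tau>" "b \<in> U \<Longrightarrow> ev b (\<tau> b) = 0"
proof -
  obtain n A f \<sigma> where 1: "\<And>k. k < n \<Longrightarrow> taut_section \<Lambda> B U (f k)" "\<And>k. k < n \<Longrightarrow> fock_section \<Lambda> B U (\<sigma> k)"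
    "\<And>b. b \<in> U \<Longrightarrow> \<tau> b = (\<Sum>k<(n::nat). heis N (A k) (f k b) (\<sigma> k b))"
    using assms(3) unfolding out_section_def by blast
  have "fock_section \<Lambda> B U (\<lambda>b. \<Sum>k<n. heis N (A k) (f k b) (\<sigma> k b))"
    unfolding heis_def
    by (intro fock_section_sum fock_section_mult fock_section_const fock_section_polar U 1) simp_all
  then show "fock_section \<Lambda> B U \<tau>" by (rule fock_section_cong) (simp add: 1(3))
  assume b: "b \<in> U"
  then have "b \<in> Sp \<Lambda> B" using openin_subset[OF U] by auto
  then obtain Z \<phi> where m: "marked Z \<phi>" "b = mk_pt \<Lambda> B Z \<phi>" using Sp_cases[OF pp] by blast
  have "ev b (polar (f k b)) = 0" if "k < n" for k
  proof -
    have "f k b \<in> zker Z \<phi>"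
    proof -
      have "f k b \<in> Fof (fst b)" using 1(1)[OF that] b unfolding taut_section_def by blast
      then show ?thesis by (simp add: m(2) mk_pt_def)
    qed
    then show ?thesis
      unfolding m(2) ev_polar[OF m(1)] using m(1) by (simp add: marked_def zker_def prj_same linform_0)
  qed
  then show "ev b (\<tau> b) = 0" by (simp add: 1(3) b heis_def ev_simps)
qed

section \<open>The kernel of the evaluation map\<close>

lemma SpTop_point_cases:
  fixes \<Lambda> :: "(complex^'n) set"
  assumes pp: "ppav \<Lambda> B" and U: "openin (SpTop \<Lambda> B) U" and b: "b \<in> U"
  obtains Z \<phi> where "marked Z \<phi>" "b = mk_pt \<Lambda> B Z \<phi>" "Zof (fst b) = Z" "snd b = \<phi>" "Fof (fst b) = zker Z \<phi>"
proof -
  have "b \<in> Sp \<Lambda> B" using openin_subset[OF U] b by auto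
  then obtain Z \<phi> where "marked Z \<phi>" "b = mk_pt \<Lambda> B Z \<phi>" using Sp_cases[OF pp] by blast
  then show ?thesis using that by (simp add: mk_pt_def)
qed

lemma holo_zlift:
  fixes \<Lambda> :: "(complex^'n) set"
  assumes pp: "ppav \<Lambda> B" and U: "openin (SpTop \<Lambda> B) U"
  shows "holo \<Lambda> B U (\<lambda>b. hcoeff (zlift (Zof (fst b)) n) m)"
proof (cases "m > 0")
  case True
  then have m: "m = int (Suc (nat m - 1))" by simp
  have "coord b (Inl (n, nat m - 1)) = hcoeff (zlift (Zof (fst b)) n) m" for b :: "'n pt"
    by (cases b) (simp only: coord.simps fst_conv m[symmetric])
  then show ?thesis using holo_coord[OF U, of "Inl (n, nat m - 1)"] by simp
next
  case False
  have "hcoeff (zlift (Zof (fst b)) n) m = (if m = - int (Suc n) then 1 else 0)" if b: "b \<in> U" for b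
  proof (rule SpTop_point_cases[OF pp U b])
    fix Z \<phi> assume "marked Z \<phi>" "Zof (fst b) = Z"
    then show ?thesis using False hcoeff_zlift[of Z m n] by (cases "m = 0") (auto simp: marked_def)
  qed
  then show ?thesis
    using holo_cong[OF holo_const[OF U, of "if m = - int (Suc n) then 1 else 0"]] by simp
qed

text \<open>Projections of a fixed vector vary holomorphically: they are finite combinations of the \<open>zlift Z n\<close>,
  whose coefficients and images under \<open>\<phi>\<close> are coordinates.\<close>

lemma holo_prj:
  fixes \<Lambda> :: "(complex^'n) set"
  assumes pp: "ppav \<Lambda> B" and U: "openin (SpTop \<Lambda> B) U"
  shows "holo \<Lambda> B U (\<lambda>b. hcoeff (prj (Zof (fst b)) w) m)"
    and "holo \<Lambda> B U (\<lambda>b. snd b (prj (Zof (fst b)) w) $ i)"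
proof -
  let ?c = "\<lambda>n. hcoeff w (- int (Suc n))"
  have "holo \<Lambda> B U (\<lambda>b. \<Sum>n\<in>polar_supp w. ?c n * hcoeff (zlift (Zof (fst b)) n) m)"
    by (intro holo_sum holo_mult holo_const holo_zlift pp U)
  then show "holo \<Lambda> B U (\<lambda>b. hcoeff (prj (Zof (fst b)) w) m)"
  proof (rule holo_cong)
    fix b assume b: "b \<in> U"
    show "(\<Sum>n\<in>polar_supp w. ?c n * hcoeff (zlift (Zof (fst b)) n) m) = hcoeff (prj (Zof (fst b)) w) m"
    proof (rule SpTop_point_cases[OF pp U b])
      fix Z \<phi> assume "marked Z \<phi>" and Z: "Zof (fst b) = Z"
      then have "lagrangian_complement Z" by (simp add: marked_def)
      then show ?thesis unfolding Z by (simp add: prj_expand hcoeff_sum del: of_nat_Suc)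
    qed
  qed
  have "holo \<Lambda> B U (\<lambda>b. \<Sum>n\<in>polar_supp w. ?c n * coord b (Inr (n, i)))"
    by (intro holo_sum holo_mult holo_const holo_coord U)
  then show "holo \<Lambda> B U (\<lambda>b. snd b (prj (Zof (fst b)) w) $ i)"
  proof (rule holo_cong)
    fix b assume b: "b \<in> U"
    show "(\<Sum>n\<in>polar_supp w. ?c n * coord b (Inr (n, i))) = snd b (prj (Zof (fst b)) w) $ i"
    proof (rule SpTop_point_cases[OF pp U b])
      fix Z \<phi> assume m: "marked Z \<phi>" "b = mk_pt \<Lambda> B Z \<phi>" and Z: "Zof (fst b) = Z" "snd b = \<phi>"
      then have lc: "lagrangian_complement Z" and lin: "zlin Z \<phi>" by (simp_all add: marked_def)
      note l = zlinD[OF lin lagrangian_complementD(1)[OF lc]]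
      have "\<phi> (prj Z w) = (\<Sum>n\<in>polar_supp w. \<phi> (hscale (?c n) (zlift Z n)))"
        unfolding prj_expand[OF lc]
        by (intro l H'.subspace_scale lagrangian_complementD(1)[OF lc] zlift lc)
      also have "\<dots> = (\<Sum>n\<in>polar_supp w. ?c n *s \<phi> (zlift Z n))"
        by (simp add: l zlift[OF lc])
      finally show ?thesis unfolding Z unfolding m(2) coord_mk_pt by simp
    qed
  qed
qed

text \<open>Near a point, \<open>Z/F\<close> has a holomorphic frame that consists of holomorphic combinations of
  the vectors \<open>prj Z w\<^sub>j\<close>, for fixed \<open>w\<^sub>j\<close> whose classes form the standard basis at the given point:
  the matrix of their values under \<open>\<phi>\<close> stays invertible, and Cramer's rule inverts it
  holomorphically. The frame splits the evaluation map, and the kernel of the evaluation map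
  is generated by sections of \<open>F\<close>.\<close>

lemma local_frame:
  fixes \<Lambda> :: "(complex^'n) set"
  assumes pp: "ppav \<Lambda> B" and N: "N \<ge> 1" and p: "p \<in> Sp \<Lambda> B"
  shows "\<exists>U \<theta>. openin (SpTop \<Lambda> B) U \<and> p \<in> U \<and> (\<forall>i. fock_section \<Lambda> B U (\<lambda>b. \<theta> b i)) \<and>
    (\<forall>b\<in>U. \<forall>i. ev b (\<theta> b i) = (PVar i :: 'n mpoly)) \<and>
    (\<forall>n. out_section N \<Lambda> B U (\<lambda>b. PVar n - psubst (\<theta> b) (ev b (PVar n))))"
proof -
  obtain Zp \<phi>p where mp: "marked Zp \<phi>p" "p = mk_pt \<Lambda> B Zp \<phi>p" using Sp_cases[OF pp p] by blast
  have surj: "\<phi>p ` Zp = UNIV" using mp(1) by (simp add: marked_def)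
  obtain s where s: "\<And>v. s v \<in> Zp" "\<And>v. \<phi>p (s v) = v" using ex_section[OF surj] by blast
  define w where "w i = s (axis i 1)" for i
  have w: "\<And>i. w i \<in> Zp" "\<And>i. \<phi>p (w i) = axis i 1" by (simp_all add: w_def s)
  define M :: "'n pt \<Rightarrow> complex^'n^'n" where "M b = (\<chi> i j. snd b (prj (Zof (fst b)) (w j)) $ i)" for b
  have S: "openin (SpTop \<Lambda> B) (Sp \<Lambda> B)" by (metis openin_topspace topspace_SpTop)
  have holoM: "holo \<Lambda> B U (\<lambda>b. M b $ i $ j)" if "openin (SpTop \<Lambda> B) U" for U i j
    unfolding M_def using holo_prj(2)[OF pp that] by simp
  have Mp: "M p = mat 1"
  proof -
    have "snd p (prj (Zof (fst p)) (w j)) = axis j 1" for j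
      using mp(1) w by (simp add: mp(2) mk_pt_def marked_def prj_same)
    then show ?thesis by (simp add: M_def vec_eq_iff mat_def axis_def)
  qed
  define U where "U = {b \<in> Sp \<Lambda> B. det (M b) \<noteq> 0}"
  have U: "openin (SpTop \<Lambda> B) U"
  proof -
    have "holo \<Lambda> B (Sp \<Lambda> B) (\<lambda>b. det (M b))" by (intro holo_det S holoM)
    then have "continuous_map (SpTop \<Lambda> B) euclidean (\<lambda>b. det (M b))"
      unfolding holo_def by (metis subtopology_topspace topspace_SpTop)
    from openin_continuous_map_preimage[OF this, of "- {0}"] show ?thesis
      by (simp add: U_def open_Compl)
  qed
  have nz: "det (M b) \<noteq> 0" if "b \<in> U" for b using that by (simp add: U_def)
  have pU: "p \<in> U" using p by (simp add: U_def Mp)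
  \<comment> \<open>The solution of \<open>M(b) x = y\<close> by Cramer's rule.\<close>
  define x where "x b y k = det (\<chi> i j. if j = k then y $ i else M b $ i $ j) * inverse (det (M b))" for b y k
  have solve: "(\<Sum>k\<in>UNIV. x b y k *s snd b (prj (Zof (fst b)) (w k))) = y" if b: "b \<in> U" for b y
  proof -
    have "M b *v (\<chi> k. x b y k) = y"
      using b cramer[of "M b" "\<chi> k. x b y k" y] by (simp add: U_def x_def divide_inverse)
    then show ?thesis
      by (simp add: vec_eq_iff matrix_vector_mult_def M_def mult.commute)
  qed
  have holo_x: "holo \<Lambda> B U (\<lambda>b. x b (y b) k)" if "\<And>i. holo \<Lambda> B U (\<lambda>b. y b $ i)" for y :: "'n pt \<Rightarrow> complex^'n" and k
  proof -
    have "holo \<Lambda> B U (\<lambda>b. (\<chi> i j. if j = k then y b $ i else M b $ i $ j) $ i $ j)" for i j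
      using that holoM[OF U] by (cases "j = k") simp_all
    then have "holo \<Lambda> B U (\<lambda>b. det (\<chi> i j. if j = k then y b $ i else M b $ i $ j))"
      by (rule holo_det[OF U])
    moreover have "holo \<Lambda> B U (\<lambda>b. inverse (det (M b)))"
      by (intro holo_inverse holo_det U holoM nz)
    ultimately show ?thesis unfolding x_def by (rule holo_mult)
  qed
  define \<theta> where "\<theta> b i = (\<Sum>k\<in>UNIV. PConst (x b (axis i 1) k) * polar (w k))" for b and i :: 'n
  have "fock_section \<Lambda> B U (\<lambda>b. \<theta> b i)" for i
    unfolding \<theta>_def by (intro fock_section_sum fock_section_single holo_x holo_const U)
  moreover have "ev b (\<theta> b i) = PVar i" if b: "b \<in> U" for b i
  proof (rule SpTop_point_cases[OF pp U b])
    fix Z \<phi> assume m: "marked Z \<phi>" "b = mk_pt \<Lambda> B Z \<phi>" and Z: "Zof (fst b) = Z" "snd b = \<phi>"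
    have "ev b (\<theta> b i) = (\<Sum>k\<in>UNIV. PConst (x b (axis i 1) k) * linform (\<phi> (prj Z (w k))))"
      by (simp add: \<theta>_def ev_simps m(2) ev_polar[OF m(1)])
    also have "\<dots> = linform (\<Sum>k\<in>UNIV. x b (axis i 1) k *s \<phi> (prj Z (w k)))"
      by (simp add: linform_sum linform_scale)
    also have "\<dots> = PVar i" using solve[OF b, of "axis i 1"] by (simp add: Z linform_axis)
    finally show ?thesis .
  qed
  moreover have "out_section N \<Lambda> B U (\<lambda>b. PVar n - psubst (\<theta> b) (ev b (PVar n)))" for n
  proof -
    define y where "y b = (\<chi> i. coord b (Inr (n, i)))" for b :: "'n pt"
    define f where "f b = zlift (Zof (fst b)) n -
      (\<Sum>i\<in>UNIV. \<Sum>k\<in>UNIV. hscale (y b $ i * x b (axis i 1) k) (prj (Zof (fst b)) (w k)))" for b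
    have "taut_section \<Lambda> B U f"
      unfolding taut_section_def
    proof (intro conjI ballI allI)
      fix m
      have "holo \<Lambda> B U (\<lambda>b. hcoeff (zlift (Zof (fst b)) n) m +
          (-1) * (\<Sum>i\<in>UNIV. \<Sum>k\<in>UNIV. coord b (Inr (n, i)) * x b (axis i 1) k * hcoeff (prj (Zof (fst b)) (w k)) m))"
        by (intro holo_add holo_mult holo_sum holo_const holo_coord holo_zlift holo_prj holo_x pp U)
      then show "holo \<Lambda> B U (\<lambda>b. hcoeff (f b) m)"
        by (rule holo_cong) (simp add: f_def y_def hcoeff_sum)
    next
      fix b assume b: "b \<in> U"
      show "f b \<in> Fof (fst b)"
      proof (rule SpTop_point_cases[OF pp U b])
        fix Z \<phi> assume m: "marked Z \<phi>" "b = mk_pt \<Lambda> B Z \<phi>" and Z: "Zof (fst b) = Z" "snd b = \<phi>" "Fof (fst b) = zker Z \<phi>"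
        then have lc: "lagrangian_complement Z" and lin: "zlin Z \<phi>" by (simp_all add: marked_def)
        note Zs = lagrangian_complementD(1)[OF lc]
        note l = zlinD[OF lin Zs]
        have yb: "y b = \<phi> (zlift Z n)" unfolding y_def m(2) coord_mk_pt by (simp add: vec_eq_iff)
        let ?s = "\<Sum>i\<in>UNIV. \<Sum>k\<in>UNIV. hscale (y b $ i * x b (axis i 1) k) (prj Z (w k))"
        have "\<phi> ?s = (\<Sum>i\<in>UNIV. \<phi> (\<Sum>k\<in>UNIV. hscale (y b $ i * x b (axis i 1) k) (prj Z (w k))))"
          by (intro l H'.subspace_sum H'.subspace_scale Zs prj lc)
        also have "\<dots> = (\<Sum>i\<in>UNIV. \<Sum>k\<in>UNIV. \<phi> (hscale (y b $ i * x b (axis i 1) k) (prj Z (w k))))"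
          by (intro sum.cong refl l H'.subspace_scale Zs prj lc)
        also have "\<dots> = (\<Sum>i\<in>UNIV. y b $ i *s (\<Sum>k\<in>UNIV. x b (axis i 1) k *s \<phi> (prj Z (w k))))"
          by (simp add: l prj[OF lc] vec.scale_sum_right)
        also have "\<dots> = (\<Sum>i\<in>UNIV. y b $ i *s axis i 1)"
          using solve[OF b] by (simp add: Z)
        also have "\<dots> = \<phi> (zlift Z n)" by (simp add: basis_expansion yb)
        finally have "\<phi> ?s = \<phi> (zlift Z n)" .
        moreover have "?s \<in> Z" by (intro H'.subspace_sum H'.subspace_scale Zs prj lc)
        ultimately show ?thesis
          unfolding Z f_def zker_def by (simp add: l zlift[OF lc] H'.subspace_diff[OF Zs])
      qed
    next
      obtain K where K: "\<And>k. w k \<in> hord (K k)" using hord_exists_family[of w] by blast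
      define M0 where "M0 = Min (insert (- int (Suc n)) (range K))"
      have M0: "M0 \<le> - int (Suc n)" "\<And>k. M0 \<le> K k" 
        unfolding M0_def by (rule Min_le; simp)+
      have "hcoeff (f b) m = 0" if b: "b \<in> U" and m: "m < M0" for b m
      proof (rule SpTop_point_cases[OF pp U b])
        fix Z \<phi> assume "marked Z \<phi>" and Z: "Zof (fst b) = Z"
        then have lc: "lagrangian_complement Z" by (simp add: marked_def)
        have m0: "m < 0" "m \<noteq> - int (Suc n)" using m M0(1) by auto
        have "hcoeff (prj Z (w k)) m = 0" for k
        proof -
          have "hcoeff (w k - prj Z (w k)) m = 0"
            by (rule hordD[OF prj(2)[OF lc, unfolded Hplus_eq_hord] m0(1)])
          moreover have "hcoeff (w k) m = 0" using hordD[OF K] m M0(2)[of k] by simp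
          ultimately show ?thesis by simp
        qed
        then show ?thesis
          using hcoeff_zlift[OF lc m0(1)] m0(2) by (simp add: f_def Z hcoeff_sum del: of_nat_Suc)
      qed
      then show "\<exists>M. \<forall>b\<in>U. \<forall>m<M. hcoeff (f b) m = 0" by blast
    qed
    then have "out_section N \<Lambda> B U (\<lambda>b. polar (f b))" by (rule out_section_polar[OF N U])
    then show ?thesis
    proof (rule out_section_cong)
      fix b assume b: "b \<in> U"
      show "polar (f b) = PVar n - psubst (\<theta> b) (ev b (PVar n))"
      proof (rule SpTop_point_cases[OF pp U b])
        fix Z \<phi> assume m: "marked Z \<phi>" and Z: "Zof (fst b) = Z"
        then have lc: "lagrangian_complement Z" by (simp add: marked_def)
        have "polar (u - v) = polar u - polar v" for u v
          using polar_add[of "u - v" v] by simp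
        then have "polar (f b) = PVar n - (\<Sum>i\<in>UNIV. \<Sum>k\<in>UNIV. PConst (y b $ i * x b (axis i 1) k) * polar (w k))"
          by (simp add: f_def Z polar_zlift[OF lc] polar_sum polar_hscale polar_prj[OF lc])
        also have "(\<Sum>i\<in>UNIV. \<Sum>k\<in>UNIV. PConst (y b $ i * x b (axis i 1) k) * polar (w k)) =
          (\<Sum>i\<in>UNIV. PConst (y b $ i) * \<theta> b i)"
          by (simp add: \<theta>_def sum_distrib_left PConst_mult mult.assoc)
        also have "\<dots> = psubst (\<theta> b) (linform (y b))"
          by (simp add: linform_def psubst_sum psubst_mult psubst_PConst psubst_PVar)
        also have "linform (y b) = ev b (PVar n)" by (simp add: ev_simps y_def)
        finally show ?thesis .
      qed
    qed
  qed
  ultimately show ?thesis using U pU by blast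
qed

lemma out_section_subset:
  assumes "out_section N \<Lambda> B U \<tau>" "openin (SpTop \<Lambda> B) V" "V \<subseteq> U"
  shows "out_section N \<Lambda> B V \<tau>"
proof -
  obtain n A f \<sigma> where 1: "\<And>k. k < n \<Longrightarrow> taut_section \<Lambda> B U (f k)" "\<And>k. k < n \<Longrightarrow> fock_section \<Lambda> B U (\<sigma> k)"
    "\<And>b. b \<in> U \<Longrightarrow> \<tau> b = (\<Sum>k<(n::nat). heis N (A k) (f k b) (\<sigma> k b))"
    using assms(1) unfolding out_section_def by blast
  have "taut_section \<Lambda> B V (f k)" if "k < n" for k
    using 1(1)[OF that] holo_subset[OF _ assms(2,3)] assms(3) unfolding taut_section_def by blast
  moreover have "fock_section \<Lambda> B V (\<sigma> k)" if "k < n" for k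
    by (rule fock_section_subset[OF 1(2)[OF that] assms(2,3)])
  moreover have "\<forall>b\<in>V. \<tau> b = (\<Sum>k<n. heis N (A k) (f k b) (\<sigma> k b))" using 1(3) assms(3) by blast
  ultimately show ?thesis
    unfolding out_section_def by (intro exI[of _ n] exI[of _ A] exI[of _ f] exI[of _ \<sigma>] conjI) simp_all
qed

text \<open>The subsheaf generated by \<open>F\<close> is the kernel of the evaluation map. With a frame \<open>\<theta>\<close> as in
  \<open>local_frame\<close>, a section \<open>\<Sum>\<^sub>k f\<^sub>k v\<^sub>k\<close> in the kernel equals \<open>\<Sum>\<^sub>k f\<^sub>k (v\<^sub>k - \<theta>(ev(v\<^sub>k)))\<close>. The set of \<open>v\<close> for which
  \<open>v - \<theta>(ev(v))\<close> is generated by sections of \<open>F\<close> contains the variables and is closed under sums and products.\<close>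

proposition out_germs_iff:
  fixes \<Lambda> :: "(complex^'n) set"
  assumes pp: "ppav \<Lambda> B" and N: "N \<ge> 1" and p: "p \<in> Sp \<Lambda> B"
  shows "\<tau> \<in> out_germs N \<Lambda> B p \<longleftrightarrow>
    (\<exists>U. openin (SpTop \<Lambda> B) U \<and> p \<in> U \<and> fock_section \<Lambda> B U \<tau> \<and> (\<forall>b\<in>U. ev b (\<tau> b) = 0))"
proof
  assume "\<tau> \<in> out_germs N \<Lambda> B p"
  then obtain U where U: "openin (SpTop \<Lambda> B) U" "p \<in> U" "out_section N \<Lambda> B U \<tau>"
    unfolding out_germs_eq by blast
  then show "\<exists>U. openin (SpTop \<Lambda> B) U \<and> p \<in> U \<and> fock_section \<Lambda> B U \<tau> \<and> (\<forall>b\<in>U. ev b (\<tau> b) = 0)"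
    using U out_section_imp[OF pp U(1,3)] by (intro exI[of _ U] conjI ballI)
next
  assume "\<exists>U. openin (SpTop \<Lambda> B) U \<and> p \<in> U \<and> fock_section \<Lambda> B U \<tau> \<and> (\<forall>b\<in>U. ev b (\<tau> b) = 0)"
  then obtain U1 where U1: "openin (SpTop \<Lambda> B) U1" "p \<in> U1" "fock_section \<Lambda> B U1 \<tau>" "\<And>b. b \<in> U1 \<Longrightarrow> ev b (\<tau> b) = 0"
    by blast
  obtain U2 \<theta> where U2: "openin (SpTop \<Lambda> B) U2" "p \<in> U2" "\<And>i. fock_section \<Lambda> B U2 (\<lambda>b. \<theta> b i)"
    "\<And>n. out_section N \<Lambda> B U2 (\<lambda>b. PVar n - psubst (\<theta> b) (ev b (PVar n)))"
    using local_frame[OF pp N p] by blast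
  define U where "U = U1 \<inter> U2"
  have U: "openin (SpTop \<Lambda> B) U" "p \<in> U" "U \<subseteq> U1" "U \<subseteq> U2" using U1 U2 by (auto simp: U_def)
  have \<theta>: "fock_section \<Lambda> B U (\<lambda>b. \<theta> b i)" for i by (rule fock_section_subset[OF U2(3) U(1,4)])
  have coord: "fock_section \<Lambda> B U (\<lambda>b. psubst (\<theta> b) (ev b v))" for v
  proof -
    have "fock_section \<Lambda> B U (\<lambda>b. psubst (\<lambda>n. psubst (\<theta> b) (linform (\<chi> i. coord b (Inr (n, i))))) v)"
    proof (rule fock_section_psubst[OF U(1)])
      fix n
      have "fock_section \<Lambda> B U (\<lambda>b. \<Sum>i\<in>UNIV. PConst (coord b (Inr (n, i))) * 1 * \<theta> b i)"
        by (intro fock_section_sum fock_section_scale holo_coord \<theta> U)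
      then show "fock_section \<Lambda> B U (\<lambda>b. psubst (\<theta> b) (linform (\<chi> i. coord b (Inr (n, i)))))"
        by (simp add: linform_def psubst_sum psubst_mult psubst_PConst psubst_PVar)
    qed
    then show ?thesis by (simp add: ev_def psubst_psubst)
  qed
  have diff: "out_section N \<Lambda> B U (\<lambda>b. v - psubst (\<theta> b) (ev b v))" for v
  proof (induction v rule: mpoly_induct)
    case (const c)
    then show ?case by (simp add: ev_simps psubst_PConst out_section_0)
  next
    case (var n)
    show ?case by (rule out_section_subset[OF U2(4) U(1,4)])
  next
    case (add v w)
    then have "out_section N \<Lambda> B U (\<lambda>b. (v - psubst (\<theta> b) (ev b v)) + (w - psubst (\<theta> b) (ev b w)))"
      by (rule out_section_add)
    then show ?case by (simp add: ev_simps psubst_add algebra_simps)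
  next
    case (mult v w)
    have "out_section N \<Lambda> B U (\<lambda>b. (v - psubst (\<theta> b) (ev b v)) * w +
        (w - psubst (\<theta> b) (ev b w)) * psubst (\<theta> b) (ev b v))"
      by (intro out_section_add out_section_mult mult fock_section_const coord U)
    then show ?case by (simp add: ev_simps psubst_mult algebra_simps)
  qed
  obtain n v f where f: "\<forall>k<n. holo \<Lambda> B U1 (f k)" "\<forall>b\<in>U1. \<tau> b = (\<Sum>k<(n::nat). PConst (f k b) * v k)"
    using U1(3) unfolding fock_section_def by blast
  have "out_section N \<Lambda> B U (\<lambda>b. \<Sum>k<n. (v k - psubst (\<theta> b) (ev b (v k))) * (PConst (f k b) * 1))"
    by (intro out_section_sum out_section_mult diff fock_section_single U holo_subset[OF _ U(1,3)])
      (use f(1) in auto)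
  then have "out_section N \<Lambda> B U \<tau>"
  proof (rule out_section_cong)
    fix b assume b: "b \<in> U"
    have "(\<Sum>k<n. PConst (f k b) * psubst (\<theta> b) (ev b (v k))) = psubst (\<theta> b) (ev b (\<Sum>k<n. PConst (f k b) * v k))"
      by (simp add: ev_simps psubst_sum psubst_mult psubst_PConst)
    also have "\<dots> = psubst (\<theta> b) (ev b (\<tau> b))" using f(2) b U(3) by auto
    also have "\<dots> = 0" using U1(4)[of b] b U(3) by (simp add: psubst_0 subsetD)
    finally have "(\<Sum>k<n. PConst (f k b) * psubst (\<theta> b) (ev b (v k))) = 0" .
    moreover have "\<tau> b = (\<Sum>k<n. PConst (f k b) * v k)" using f(2) b U(3) by blast
    ultimately show "(\<Sum>k<n. (v k - psubst (\<theta> b) (ev b (v k))) * (PConst (f k b) * 1)) = \<tau> b"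
      by (simp add: algebra_simps sum_subtractf)
  qed
  then show "\<tau> \<in> out_germs N \<Lambda> B p" unfolding out_germs_eq using U(1,2) by blast
qed

text \<open>Substituting the frame into \<open>P\<close> lifts it.\<close>

lemma local_lift:
  fixes \<Lambda> :: "(complex^'n) set" and P :: "'n mpoly" and N :: nat
  assumes "ppav \<Lambda> B" "N \<ge> 1" "p \<in> Sp \<Lambda> B"
  shows "\<exists>U \<sigma>. openin (SpTop \<Lambda> B) U \<and> p \<in> U \<and> fock_section \<Lambda> B U \<sigma> \<and> (\<forall>b\<in>U. ev b (\<sigma> b) = P)"
proof -
  obtain U \<theta> where U: "openin (SpTop \<Lambda> B) U" "p \<in> U" "\<And>i. fock_section \<Lambda> B U (\<lambda>b. \<theta> b i)"
    "\<And>b i. b \<in> U \<Longrightarrow> ev b (\<theta> b i) = (PVar i :: 'n mpoly)"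
    using local_frame[OF assms] by blast
  have "fock_section \<Lambda> B U (\<lambda>b. psubst (\<theta> b) P)" by (rule fock_section_psubst[OF U(1,3)])
  moreover have "ev b (psubst (\<theta> b) P) = P" if "b \<in> U" for b
    using U(4)[OF that] by (simp add: ev_def psubst_psubst psubst_PVar_id)
  ultimately show ?thesis using U(1,2) by blast
qed

section \<open>Invariant sections\<close>

text \<open>An element of the stalk at \<open>p\<close> is a coset of \<open>out_germs\<close>. These sets are the cosets of the sections
  whose evaluation is constant near \<open>p\<close> (\<open>germs_with_value_coset\<close>).\<close>

definition germs_with_value :: "(complex^'n) set \<Rightarrow> (complex^'n \<Rightarrow> complex^'n \<Rightarrow> complex)
    \<Rightarrow> 'n mpoly \<Rightarrow> 'n pt \<Rightarrow> ('n pt \<Rightarrow> fock) set" where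
  "germs_with_value \<Lambda> B P p = {\<sigma>. \<exists>U. openin (SpTop \<Lambda> B) U \<and> p \<in> U \<and> fock_section \<Lambda> B U \<sigma> \<and> (\<forall>b\<in>U. ev b (\<sigma> b) = P)}"

lemma germs_with_valueI:
  "openin (SpTop \<Lambda> B) U \<Longrightarrow> p \<in> U \<Longrightarrow> fock_section \<Lambda> B U \<sigma> \<Longrightarrow> (\<And>b. b \<in> U \<Longrightarrow> ev b (\<sigma> b) = P) \<Longrightarrow>
    \<sigma> \<in> germs_with_value \<Lambda> B P p"
  unfolding germs_with_value_def by blast

lemma germs_with_valueE:
  assumes "\<sigma> \<in> germs_with_value \<Lambda> B P p"
  obtains U where "openin (SpTop \<Lambda> B) U" "p \<in> U" "fock_section \<Lambda> B U \<sigma>" "\<And>b. b \<in> U \<Longrightarrow> ev b (\<sigma> b) = P"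
  using assms unfolding germs_with_value_def by blast

lemma germs_with_value_ev: "\<sigma> \<in> germs_with_value \<Lambda> B P p \<Longrightarrow> ev p (\<sigma> p) = P"
  by (erule germs_with_valueE) blast

lemma germs_with_value_add:
  assumes "\<sigma> \<in> germs_with_value \<Lambda> B P p" "\<tau> \<in> germs_with_value \<Lambda> B Q p"
  shows "\<sigma> + \<tau> \<in> germs_with_value \<Lambda> B (P + Q) p"
proof -
  obtain U where U: "openin (SpTop \<Lambda> B) U" "p \<in> U" "fock_section \<Lambda> B U \<sigma>" "\<And>b. b \<in> U \<Longrightarrow> ev b (\<sigma> b) = P"
    using assms(1) unfolding germs_with_value_def by blast
  obtain V where V: "openin (SpTop \<Lambda> B) V" "p \<in> V" "fock_section \<Lambda> B V \<tau>" "\<And>b. b \<in> V \<Longrightarrow> ev b (\<tau> b) = Q"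
    using assms(2) unfolding germs_with_value_def by blast
  have UV: "openin (SpTop \<Lambda> B) (U \<inter> V)" using U V by blast
  have "fock_section \<Lambda> B (U \<inter> V) (\<lambda>b. \<sigma> b + \<tau> b)"
    by (rule fock_section_add[OF fock_section_subset[OF U(3) UV] fock_section_subset[OF V(3) UV]]) auto
  then show ?thesis
    by (intro germs_with_valueI[OF UV]) (use U V in \<open>auto simp: plus_fun_def ev_simps\<close>)
qed

lemma germs_with_value_scale:
  assumes "\<sigma> \<in> germs_with_value \<Lambda> B P p"
  shows "(\<lambda>b. PConst c * \<sigma> b) \<in> germs_with_value \<Lambda> B (PConst c * P) p"
proof -
  obtain U where U: "openin (SpTop \<Lambda> B) U" "p \<in> U" "fock_section \<Lambda> B U \<sigma>" "\<And>b. b \<in> U \<Longrightarrow> ev b (\<sigma> b) = P"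
    using assms(1) unfolding germs_with_value_def by blast
  have "fock_section \<Lambda> B U (\<lambda>b. PConst c * \<sigma> b)"
    by (intro fock_section_mult fock_section_const U)
  then show ?thesis by (intro germs_with_valueI[OF U(1,2)]) (use U in \<open>auto simp: ev_simps\<close>)
qed

lemma germs_with_value_coset:
  fixes \<Lambda> :: "(complex^'n) set"
  assumes pp: "ppav \<Lambda> B" and N: "N \<ge> 1" and p: "p \<in> Sp \<Lambda> B" and \<sigma>: "\<sigma> \<in> germs_with_value \<Lambda> B P p"
  shows "\<sigma> +o out_germs N \<Lambda> B p = germs_with_value \<Lambda> B P p"
proof -
  have O: "out_germs N \<Lambda> B p = germs_with_value \<Lambda> B 0 p"
    using out_germs_iff[OF pp N p] by (auto simp: germs_with_value_def)
  show ?thesis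
  proof (rule set_eqI, rule iffI)
    fix \<tau> assume "\<tau> \<in> \<sigma> +o out_germs N \<Lambda> B p"
    then obtain \<rho> where "\<rho> \<in> germs_with_value \<Lambda> B 0 p" "\<tau> = \<sigma> + \<rho>" by (auto simp: elt_set_plus_def O)
    then show "\<tau> \<in> germs_with_value \<Lambda> B P p" using germs_with_value_add[OF \<sigma>, of \<rho> 0] by simp
  next
    fix \<tau> assume "\<tau> \<in> germs_with_value \<Lambda> B P p"
    from germs_with_value_add[OF this germs_with_value_scale[OF \<sigma>, of "-1"]]
    have "\<tau> + (\<lambda>b. PConst (-1) * \<sigma> b) \<in> out_germs N \<Lambda> B p"
      by (simp add: O PConst_uminus PConst_1)
    moreover have "\<tau> = \<sigma> + (\<tau> + (\<lambda>b. PConst (-1) * \<sigma> b))"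
      by (simp add: fun_eq_iff plus_fun_def PConst_uminus PConst_1)
    ultimately show "\<tau> \<in> \<sigma> +o out_germs N \<Lambda> B p" by (metis set_plus_intro2)
  qed
qed

lemma germs_with_value_nonempty:
  fixes \<Lambda> :: "(complex^'n) set" and N :: nat
  assumes "ppav \<Lambda> B" "p \<in> Sp \<Lambda> B"
  shows "\<exists>\<sigma>. \<sigma> \<in> germs_with_value \<Lambda> B P p"
  using local_lift[OF assms(1) le_refl assms(2), of P] unfolding germs_with_value_def by blast

text \<open>The action on points pulls holomorphic functions back to holomorphic functions, so a translated section is
  again a section; its value does not change by \<open>ev_equivariant\<close>.\<close>

lemma germs_with_value_act:
  fixes \<Lambda> :: "(complex^'n) set"
  assumes pp: "ppav \<Lambda> B" and g: "g \<in> SpPlus_full" and p: "p \<in> Sp \<Lambda> B" and \<sigma>: "\<sigma> \<in> germs_with_value \<Lambda> B P p"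
  shows "section_act g \<sigma> \<in> germs_with_value \<Lambda> B P (pt_act g p)"
proof -
  note ig = inv_SpPlus_full[OF g]
  obtain U where U: "openin (SpTop \<Lambda> B) U" "p \<in> U" "fock_section \<Lambda> B U \<sigma>" "\<And>b. b \<in> U \<Longrightarrow> ev b (\<sigma> b) = P"
    using \<sigma> unfolding germs_with_value_def by blast
  define V where "V = {b \<in> Sp \<Lambda> B. pt_act (inv g) b \<in> U}"
  have V: "openin (SpTop \<Lambda> B) V"
    using holo_openin[OF holo_pullback[OF pp ig holo_const[OF U(1)]]] by (simp add: V_def)
  obtain n v f where f: "\<forall>k<n. holo \<Lambda> B U (f k)" "\<forall>b\<in>U. \<sigma> b = (\<Sum>k<(n::nat). PConst (f k b) * v k)"
    using U(3) unfolding fock_section_def by blast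
  have "fock_section \<Lambda> B V (\<lambda>b. \<Sum>k<n. PConst (f k (pt_act (inv g) b)) * fock_act g (v k))"
    using f(1) holo_pullback[OF pp ig] by (intro fock_section_sum V fock_section_single) (simp add: V_def)
  then have "fock_section \<Lambda> B V (section_act g \<sigma>)"
    by (rule fock_section_cong)
      (use f(2) in \<open>simp add: V_def section_act_def fock_act_def psubst_sum psubst_mult psubst_PConst\<close>)
  moreover have "ev b (section_act g \<sigma> b) = P" if "b \<in> V" for b
  proof -
    have b: "b \<in> Sp \<Lambda> B" "pt_act (inv g) b \<in> U" using that by (auto simp: V_def)
    have "ev (pt_act g (pt_act (inv g) b)) (fock_act g (\<sigma> (pt_act (inv g) b))) = P"
      unfolding ev_equivariant[OF pp g pt_act_in_Sp[OF pp ig b(1)]] by (rule U(4)[OF b(2)])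
    then show ?thesis by (simp add: section_act_def pt_act_inv'[OF pp g b(1)])
  qed
  moreover have "pt_act g p \<in> V"
    using U(2) by (simp add: V_def pt_act_in_Sp[OF pp g p] pt_act_inv[OF pp g p])
  ultimately show ?thesis by (intro germs_with_valueI[OF V])
qed

definition poly_space :: "'n mpoly cspace" where
  "poly_space = \<lparr>carr = UNIV, vadd = (+), vscale = (\<lambda>c P. PConst c * P)\<rparr>"

definition poly_section :: "(complex^'n) set \<Rightarrow> (complex^'n \<Rightarrow> complex^'n \<Rightarrow> complex)
    \<Rightarrow> 'n mpoly \<Rightarrow> ('n pt \<Rightarrow> ('n pt \<Rightarrow> fock) set)" where
  "poly_section \<Lambda> B P = restrict (germs_with_value \<Lambda> B P) (Sp \<Lambda> B)"

text \<open>Invariant sections are constant after evaluation: transitivity moves every point to a fixed one,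
  and the evaluation map is equivariant.\<close>

proposition carr_coinvariants:
  fixes \<Lambda> :: "(complex^'n) set"
  assumes pp: "ppav \<Lambda> B" and N: "N \<ge> 1"
  shows "carr (coinvariants N \<Lambda> B) = range (poly_section \<Lambda> B)"
proof
  show "range (poly_section \<Lambda> B) \<subseteq> carr (coinvariants N \<Lambda> B)"
  proof
    fix s assume "s \<in> range (poly_section \<Lambda> B)"
    then obtain P where s: "s = poly_section \<Lambda> B P" by blast
    have sp: "s p = germs_with_value \<Lambda> B P p" if "p \<in> Sp \<Lambda> B" for p
      using that by (simp add: s poly_section_def)
    have "\<exists>U \<sigma>. openin (SpTop \<Lambda> B) U \<and> p \<in> U \<and> fock_section \<Lambda> B U \<sigma> \<and>
       (\<forall>b\<in>U. s b = \<sigma> +o out_germs N \<Lambda> B b)" if p: "p \<in> Sp \<Lambda> B" for p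
    proof -
      obtain U \<sigma> where U: "openin (SpTop \<Lambda> B) U" "p \<in> U" "fock_section \<Lambda> B U \<sigma>" "\<And>b. b \<in> U \<Longrightarrow> ev b (\<sigma> b) = P"
        using local_lift[OF pp N p, of P] by blast
      have "s b = \<sigma> +o out_germs N \<Lambda> B b" if b: "b \<in> U" for b
      proof -
        have bS: "b \<in> Sp \<Lambda> B" using openin_subset[OF U(1)] b by auto
        have "\<sigma> \<in> germs_with_value \<Lambda> B P b" by (rule germs_with_valueI[OF U(1) b U(3,4)])
        then show ?thesis unfolding sp[OF bS] by (rule germs_with_value_coset[OF pp N bS, symmetric])
      qed
      with U show ?thesis by blast
    qed
    moreover have "s \<in> extensional (Sp \<Lambda> B)" by (simp add: s poly_section_def)
    ultimately have "s \<in> coinv_sections N \<Lambda> B" unfolding coinv_sections_def by blast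
    moreover have "s (pt_act g p) = section_act g \<sigma> +o out_germs N \<Lambda> B (pt_act g p)"
      if g: "g \<in> SpPlus" and p: "p \<in> Sp \<Lambda> B" and \<sigma>: "\<sigma> \<in> s p" for g p \<sigma>
    proof -
      have gf: "g \<in> SpPlus_full" using g SpPlus_subset by blast
      note gp = pt_act_in_Sp[OF pp gf p]
      show ?thesis
        unfolding sp[OF gp] using \<sigma> unfolding sp[OF p]
        by (intro germs_with_value_coset[OF pp N gp, symmetric] germs_with_value_act[OF pp gf p])
    qed
    ultimately show "s \<in> carr (coinvariants N \<Lambda> B)" by (simp add: coinvariants_def)
  qed
next
  show "carr (coinvariants N \<Lambda> B) \<subseteq> range (poly_section \<Lambda> B)"
  proof
    fix s assume s: "s \<in> carr (coinvariants N \<Lambda> B)"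
    have ext: "s \<in> extensional (Sp \<Lambda> B)"
      and loc: "\<And>p. p \<in> Sp \<Lambda> B \<Longrightarrow> \<exists>U \<sigma>. openin (SpTop \<Lambda> B) U \<and> p \<in> U \<and> fock_section \<Lambda> B U \<sigma> \<and>
       (\<forall>b\<in>U. s b = \<sigma> +o out_germs N \<Lambda> B b)"
      and inv: "\<And>g p \<sigma>. g \<in> SpPlus \<Longrightarrow> p \<in> Sp \<Lambda> B \<Longrightarrow> \<sigma> \<in> s p \<Longrightarrow>
        s (pt_act g p) = section_act g \<sigma> +o out_germs N \<Lambda> B (pt_act g p)"
      using s by (auto simp: coinvariants_def coinv_sections_def)
    obtain p0 where p0: "p0 \<in> Sp \<Lambda> B" using Sp_nonempty[OF pp] by blast
    have zero: "0 \<in> out_germs N \<Lambda> B p" if "p \<in> Sp \<Lambda> B" for p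
    proof -
      have "openin (SpTop \<Lambda> B) (Sp \<Lambda> B)" by (metis openin_topspace topspace_SpTop)
      then have "fock_section \<Lambda> B (Sp \<Lambda> B) 0"
        using fock_section_const[of \<Lambda> B "Sp \<Lambda> B" 0] by (simp add: zero_fun_def)
      then show ?thesis
        unfolding out_germs_iff[OF pp N that] using that \<open>openin _ _\<close> by (auto simp: ev_simps zero_fun_def)
    qed
    have out_ev: "ev p (\<tau> p) = 0" if "p \<in> Sp \<Lambda> B" "\<tau> \<in> out_germs N \<Lambda> B p" for p \<tau>
      using that out_germs_iff[OF pp N that(1)] by blast
    have mem: "\<sigma> \<in> \<sigma> +o out_germs N \<Lambda> B p" if "p \<in> Sp \<Lambda> B" for p \<sigma>
      using zero[OF that] by (metis add.right_neutral set_plus_intro2)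
    obtain \<sigma>0 where \<sigma>0: "\<sigma>0 \<in> s p0" using loc[OF p0] mem[OF p0] by blast
    define P where "P = ev p0 (\<sigma>0 p0)"
    have val: "ev b (\<sigma> b) = P" if b: "b \<in> Sp \<Lambda> B" and sb: "s b = \<sigma> +o out_germs N \<Lambda> B b" for b \<sigma>
    proof -
      obtain g where g: "g \<in> SpPlus" "pt_act g p0 = b" using Sp_transitive[OF pp p0 b] by blast
      have gf: "g \<in> SpPlus_full" using g SpPlus_subset by blast
      have "section_act g \<sigma>0 +o out_germs N \<Lambda> B b = \<sigma> +o out_germs N \<Lambda> B b"
        using inv[OF g(1) p0 \<sigma>0] g(2) sb by simp
      then have "section_act g \<sigma>0 \<in> \<sigma> +o out_germs N \<Lambda> B b" using mem[OF b] by blast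
      then obtain \<rho> where "\<rho> \<in> out_germs N \<Lambda> B b" "section_act g \<sigma>0 = \<sigma> + \<rho>" by (auto simp: elt_set_plus_def)
      then have "ev b (section_act g \<sigma>0 b) = ev b (\<sigma> b)" using out_ev[OF b] by (simp add: ev_simps)
      moreover have "section_act g \<sigma>0 b = fock_act g (\<sigma>0 p0)"
        using pt_act_inv[OF pp gf p0] g(2) by (simp add: section_act_def)
      moreover have "ev b (fock_act g (\<sigma>0 p0)) = P"
        using ev_equivariant[OF pp gf p0] g(2) by (simp add: P_def)
      ultimately show ?thesis by simp
    qed
    have "s = poly_section \<Lambda> B P"
    proof (rule extensionalityI[OF ext])
      show "poly_section \<Lambda> B P \<in> extensional (Sp \<Lambda> B)" by (simp add: poly_section_def)
      fix p assume p: "p \<in> Sp \<Lambda> B"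
      obtain U \<sigma> where U: "openin (SpTop \<Lambda> B) U" "p \<in> U" "fock_section \<Lambda> B U \<sigma>"
        "\<And>b. b \<in> U \<Longrightarrow> s b = \<sigma> +o out_germs N \<Lambda> B b" using loc[OF p] by blast
      have "\<sigma> \<in> germs_with_value \<Lambda> B P p"
      proof (rule germs_with_valueI[OF U(1,2,3)])
        fix b assume b: "b \<in> U"
        then have "b \<in> Sp \<Lambda> B" using openin_subset[OF U(1)] by auto
        then show "ev b (\<sigma> b) = P" using U(4)[OF b] by (rule val)
      qed
      then show "s p = poly_section \<Lambda> B P p"
        unfolding U(4)[OF U(2)] germs_with_value_coset[OF pp N p] using p
        by (simp add: poly_section_def germs_with_value_coset[OF pp N p])
    qed
    then show "s \<in> range (poly_section \<Lambda> B)" by blast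
  qed
qed

lemma lin_iso_poly_section:
  fixes \<Lambda> :: "(complex^'n) set"
  assumes pp: "ppav \<Lambda> B" and N: "N \<ge> 1"
  shows "lin_iso poly_space (coinvariants N \<Lambda> B) (poly_section \<Lambda> B)"
proof -
  note ne = germs_with_value_nonempty[OF pp]
  note cos = germs_with_value_coset[OF pp N]
  have OO: "out_germs N \<Lambda> B p + out_germs N \<Lambda> B p = out_germs N \<Lambda> B p"
    "0 +o out_germs N \<Lambda> B p = out_germs N \<Lambda> B p" if p: "p \<in> Sp \<Lambda> B" for p
  proof -
    have O: "out_germs N \<Lambda> B p = germs_with_value \<Lambda> B 0 p"
      using out_germs_iff[OF pp N p] by (auto simp: germs_with_value_def)
    show "0 +o out_germs N \<Lambda> B p = out_germs N \<Lambda> B p" by simp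
    show "out_germs N \<Lambda> B p + out_germs N \<Lambda> B p = out_germs N \<Lambda> B p"
    proof
      show "out_germs N \<Lambda> B p + out_germs N \<Lambda> B p \<subseteq> out_germs N \<Lambda> B p"
        using germs_with_value_add[of _ \<Lambda> B 0 p _ 0] by (auto simp: O set_plus_def)
      obtain \<tau> where "\<tau> \<in> germs_with_value \<Lambda> B 0 p" using ne[OF p] by blast
      then have z: "0 \<in> out_germs N \<Lambda> B p"
        using germs_with_value_scale[of \<tau> \<Lambda> B 0 p 0] by (simp add: O PConst_0 zero_fun_def)
      show "out_germs N \<Lambda> B p \<subseteq> out_germs N \<Lambda> B p + out_germs N \<Lambda> B p"
      proof
        fix x assume "x \<in> out_germs N \<Lambda> B p"
        then have "x + 0 \<in> out_germs N \<Lambda> B p + out_germs N \<Lambda> B p" using z by (rule set_plus_intro)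
        then show "x \<in> out_germs N \<Lambda> B p + out_germs N \<Lambda> B p" by simp
      qed
    qed
  qed
  have "inj (poly_section \<Lambda> B)"
  proof (rule injI)
    fix P Q assume eq: "poly_section \<Lambda> B P = poly_section \<Lambda> B Q"
    obtain p where p: "p \<in> Sp \<Lambda> B" using Sp_nonempty[OF pp] by blast
    obtain \<sigma> where \<sigma>: "\<sigma> \<in> germs_with_value \<Lambda> B P p" using ne[OF p] by blast
    then have "\<sigma> \<in> germs_with_value \<Lambda> B Q p" using fun_cong[OF eq, of p] p by (simp add: poly_section_def)
    with \<sigma> show "P = Q" using germs_with_value_ev by metis
  qed
  then have "bij_betw (poly_section \<Lambda> B) (carr poly_space) (carr (coinvariants N \<Lambda> B))"
    by (simp add: poly_space_def carr_coinvariants[OF pp N] bij_betw_def)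
  moreover have "poly_section \<Lambda> B (P + Q) = vadd (coinvariants N \<Lambda> B) (poly_section \<Lambda> B P) (poly_section \<Lambda> B Q)" for P Q
  proof
    fix p
    show "poly_section \<Lambda> B (P + Q) p = vadd (coinvariants N \<Lambda> B) (poly_section \<Lambda> B P) (poly_section \<Lambda> B Q) p"
    proof (cases "p \<in> Sp \<Lambda> B")
      case True
      obtain \<sigma> \<tau> where \<sigma>: "\<sigma> \<in> germs_with_value \<Lambda> B P p" and \<tau>: "\<tau> \<in> germs_with_value \<Lambda> B Q p"
        using ne[OF True] by metis
      have "germs_with_value \<Lambda> B (P + Q) p = (\<sigma> + \<tau>) +o out_germs N \<Lambda> B p"
        by (rule cos[OF True germs_with_value_add[OF \<sigma> \<tau>], symmetric])
      also have "\<dots> = (\<sigma> +o out_germs N \<Lambda> B p) + (\<tau> +o out_germs N \<Lambda> B p)"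
        by (simp add: set_plus_rearrange OO[OF True])
      also have "\<dots> = germs_with_value \<Lambda> B P p + germs_with_value \<Lambda> B Q p"
        by (simp only: cos[OF True \<sigma>] cos[OF True \<tau>])
      finally show ?thesis using True by (simp add: poly_section_def coinvariants_def)
    qed (simp add: poly_section_def coinvariants_def)
  qed
  moreover have "poly_section \<Lambda> B (PConst c * P) = vscale (coinvariants N \<Lambda> B) c (poly_section \<Lambda> B P)" for c P
  proof
    fix p
    show "poly_section \<Lambda> B (PConst c * P) p = vscale (coinvariants N \<Lambda> B) c (poly_section \<Lambda> B P) p"
    proof (cases "p \<in> Sp \<Lambda> B")
      case True
      let ?m = "\<lambda>\<sigma> b. PConst c * \<sigma> b"
      have "?m ` germs_with_value \<Lambda> B P p + out_germs N \<Lambda> B p = germs_with_value \<Lambda> B (PConst c * P) p"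
      proof
        show "?m ` germs_with_value \<Lambda> B P p + out_germs N \<Lambda> B p \<subseteq> germs_with_value \<Lambda> B (PConst c * P) p"
        proof
          fix x assume "x \<in> ?m ` germs_with_value \<Lambda> B P p + out_germs N \<Lambda> B p"
          then obtain \<sigma> \<rho> where \<sigma>: "\<sigma> \<in> germs_with_value \<Lambda> B P p" "\<rho> \<in> out_germs N \<Lambda> B p" "x = ?m \<sigma> + \<rho>"
            by (auto simp: set_plus_def)
          then have "x \<in> ?m \<sigma> +o out_germs N \<Lambda> B p" by blast
          then show "x \<in> germs_with_value \<Lambda> B (PConst c * P) p"
            by (simp only: cos[OF True germs_with_value_scale[OF \<sigma>(1)]])
        qed
        obtain \<sigma> where \<sigma>: "\<sigma> \<in> germs_with_value \<Lambda> B P p" using ne[OF True] by blast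
        have "?m \<sigma> +o out_germs N \<Lambda> B p \<subseteq> ?m ` germs_with_value \<Lambda> B P p + out_germs N \<Lambda> B p"
          using \<sigma> by (intro set_plus_mono3 imageI)
        then show "germs_with_value \<Lambda> B (PConst c * P) p \<subseteq> ?m ` germs_with_value \<Lambda> B P p + out_germs N \<Lambda> B p"
          by (simp only: cos[OF True germs_with_value_scale[OF \<sigma>]])
      qed
      then show ?thesis using True by (simp add: poly_section_def coinvariants_def)
    qed (simp add: poly_section_def coinvariants_def)
  qed
  ultimately show ?thesis by (simp add: lin_iso_def poly_space_def)
qed

text \<open>The value of a section determines the corresponding polynomial, since evaluation kills
  \<open>(\<h>\<^sub>\<Gamma> \<otimes> F) \<pi>\<^sup>0\<close>.\<close>

lemma fibre_value_poly_section:
  fixes \<Lambda> :: "(complex^'n) set"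
  assumes pp: "ppav \<Lambda> B" and p: "p \<in> Sp \<Lambda> B" and v: "fibre_value N (poly_section \<Lambda> B P) p v"
  shows "ev p v = P"
proof -
  obtain Z \<phi> where m: "marked Z \<phi>" "p = mk_pt \<Lambda> B Z \<phi>" using Sp_cases[OF pp p] by blast
  obtain \<sigma> where \<sigma>: "\<sigma> \<in> germs_with_value \<Lambda> B P p" using germs_with_value_nonempty[OF pp p] by blast
  then have "\<sigma> p - v \<in> out_span N (Fof (fst p))"
    using v p by (simp add: fibre_value_def poly_section_def)
  then obtain n A f w where "\<sigma> p - v = (\<Sum>k<(n::nat). heis N (A k) (f k) (w k))" "\<And>k. k < n \<Longrightarrow> f k \<in> zker Z \<phi>"
    by (auto simp: out_span_def m(2) mk_pt_def)
  moreover have "ev p (polar z) = 0" if "z \<in> zker Z \<phi>" for z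
    unfolding m(2) ev_polar[OF m(1)] using that m(1) by (simp add: marked_def zker_def prj_same linform_0)
  ultimately have "ev p (\<sigma> p - v) = 0" by (simp add: heis_def ev_simps)
  then show ?thesis using germs_with_value_ev[OF \<sigma>] by (simp add: ev_simps)
qed

lemma ev_foldr_heis:
  fixes \<Lambda> :: "(complex^'n) set"
  assumes pp: "ppav \<Lambda> B" and p: "(a, \<phi>) \<in> Sp \<Lambda> B" and N: "N \<ge> 1" and zs: "set zs \<subseteq> Zof a"
  shows "ev (a, \<phi>) (foldr (heis N (H1 N)) zs 1) = (\<Prod>z\<leftarrow>zs. linform (\<phi> z))"
proof -
  obtain Z \<phi>' where m: "marked Z \<phi>'" "(a, \<phi>) = mk_pt \<Lambda> B Z \<phi>'" using Sp_cases[OF pp p] by blast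
  then have *: "\<phi>' = \<phi>" "Zof a = Z" by (auto simp: mk_pt_def)
  have "ev (a, \<phi>) (polar z) = linform (\<phi> z)" if "z \<in> Z" for z
    using that m(1) unfolding m(2) ev_polar[OF m(1)] by (simp add: marked_def prj_same *)
  then show ?thesis
    using zs by (induction zs) (simp_all add: heis_H1[OF N] ev_simps *)
qed

section \<open>Holomorphic one-forms\<close>

text \<open>Liouville's theorem on complex lines: a \<open>\<Lambda>\<close>-periodic form is bounded by its values on a
  fundamental domain.\<close>

lemma H0_Omega_eq:
  fixes \<Lambda> :: "(complex^'n) set"
  assumes pp: "ppav \<Lambda> B"
  shows "H0_Omega \<Lambda> = range (\<lambda>c _. c)"
proof
  show "range (\<lambda>c _. c) \<subseteq> H0_Omega \<Lambda>"
  proof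
    fix \<omega> :: "complex^'n \<Rightarrow> complex^'n" assume "\<omega> \<in> range (\<lambda>c _. c)"
    then obtain c where \<omega>: "\<omega> = (\<lambda>_. c)" by blast
    have "\<exists>D. (\<omega> has_derivative D) (at z) \<and> (\<forall>k v. D (k *s v) = k *s D v)" for z
      unfolding \<omega> by (rule exI[of _ "\<lambda>_. 0"]) simp
    then show "\<omega> \<in> H0_Omega \<Lambda>"
      unfolding H0_Omega_def by (simp add: \<omega>)
  qed
  show "H0_Omega \<Lambda> \<subseteq> range (\<lambda>c _. c)"
  proof
    fix \<omega> assume "\<omega> \<in> H0_Omega \<Lambda>"
    then have der: "\<And>z. \<exists>D. (\<omega> has_derivative D) (at z) \<and> (\<forall>c v. D (c *s v) = c *s D v)"
      and per: "\<And>z l. l \<in> \<Lambda> \<Longrightarrow> \<omega> (z + l) = \<omega> z" by (auto simp: H0_Omega_def)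
    let ?r = "2 * CARD('n)"
    obtain E where E: "\<forall>v. \<exists>c. v = (\<Sum>i<?r. c i *\<^sub>R E i)"
      "\<Lambda> = {\<Sum>i<?r. of_int (k i) *\<^sub>R E i | k :: nat \<Rightarrow> int. True}"
      using ppav_basis[OF pp] by (elim exE conjE)
    define R where "R = (\<Sum>i<?r. norm (E i))"
    have "\<omega> z \<in> \<omega> ` cball 0 R" for z
    proof -
      obtain c where c: "z = (\<Sum>i<?r. c i *\<^sub>R E i)" using E(1) by blast
      define l where "l = (\<Sum>i<?r. of_int \<lfloor>c i\<rfloor> *\<^sub>R E i)"
      have l: "l \<in> \<Lambda>" unfolding l_def E(2)
        by (intro CollectI exI[of _ "\<lambda>i. \<lfloor>c i\<rfloor>"] conjI TrueI refl)
      have "z - l = (\<Sum>i<?r. frac (c i) *\<^sub>R E i)"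
        by (simp add: c l_def frac_def scaleR_left_diff_distrib sum_subtractf)
      then have "norm (z - l) \<le> (\<Sum>i<?r. norm (frac (c i) *\<^sub>R E i))" by (simp only: norm_sum)
      also have "\<dots> \<le> R" unfolding R_def
      proof (rule sum_mono)
        fix i
        have "frac (c i) * norm (E i) \<le> 1 * norm (E i)"
          by (rule mult_right_mono) (simp_all add: frac_lt_1 less_imp_le)
        then show "norm (frac (c i) *\<^sub>R E i) \<le> norm (E i)" by (simp add: frac_ge_0)
      qed
      finally have "z - l \<in> cball 0 R" by simp
      moreover have "\<omega> z = \<omega> (z - l)" using per[OF l, of "z - l"] by simp
      ultimately show ?thesis by blast
    qed
    then have sub: "range \<omega> \<subseteq> \<omega> ` cball 0 R" by blast
    have "continuous_on (cball 0 R) \<omega>"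
    proof (rule continuous_at_imp_continuous_on, rule ballI)
      fix z show "isCont \<omega> z" using der[of z] has_derivative_continuous by blast
    qed
    then have "bounded (\<omega> ` cball 0 R)" by (intro compact_imp_bounded compact_continuous_image compact_cball)
    then have bdd: "bounded (range \<omega>)" using sub by (rule bounded_subset)
    have "\<omega> v $ i = \<omega> 0 $ i" for v i
    proof -
      let ?f = "\<lambda>t. \<omega> (t *s v) $ i"
      have "?f holomorphic_on UNIV"
      proof (rule holomorphic_onI)
        fix t
        obtain D where D: "(\<omega> has_derivative D) (at (t *s v))" "\<And>c v. D (c *s v) = c *s D v" using der by blast
        have "bounded_linear (\<lambda>t. t *s v)"
          unfolding linear_conv_bounded_linear[symmetric]
          by (rule linearI) (simp_all add: vec.scale_left_distrib scaleR_eq_scalar scaleR_conv_of_real)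
        then have "((\<lambda>t. t *s v) has_derivative (\<lambda>t. t *s v)) (at t)"
          by (rule bounded_linear_imp_has_derivative)
        from has_derivative_compose[OF this D(1)]
        have "((\<lambda>t. \<omega> (t *s v)) has_derivative (\<lambda>h. D (h *s v))) (at t)" .
        then have "(?f has_derivative (\<lambda>h. D (h *s v) $ i)) (at t)"
          by (rule bounded_linear.has_derivative[OF bounded_linear_vec_nth])
        moreover have "(\<lambda>h. D (h *s v) $ i) = (*) (D v $ i)"
          by (simp add: fun_eq_iff D(2) mult.commute)
        ultimately have "(?f has_field_derivative (D v $ i)) (at t)"
          unfolding has_field_derivative_def by (simp only:)
        then show "?f field_differentiable (at t within UNIV)"
          unfolding field_differentiable_def by blast
      qed
      moreover have "bounded (range ?f)"
      proof -
        obtain K where "\<And>z. norm (\<omega> z) \<le> K" using bdd unfolding bounded_iff by blast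
        then have "norm (?f t) \<le> K" for t by (meson component_le_norm_cart Finite_Cartesian_Product.norm_nth_le order_trans)
        then show ?thesis unfolding bounded_iff by blast
      qed
      ultimately obtain c where "\<And>t. ?f t = c"
        using Liouville_theorem[of ?f] by (auto simp: constant_on_def)
      from this[of 1] this[of 0] show ?thesis by simp
    qed
    then have "\<omega> = (\<lambda>_. \<omega> 0)" by (simp add: fun_eq_iff vec_eq_iff)
    then show "\<omega> \<in> range (\<lambda>c _. c)" by (metis rangeI)
  qed
qed

section \<open>Polynomial functions and the symmetric algebra\<close>

definition peval :: "('v \<Rightarrow> complex) \<Rightarrow> 'v mpoly \<Rightarrow> complex" where
  "peval f P = (\<Sum>m\<in>Poly_Mapping.keys P. Poly_Mapping.lookup P m *
     (\<Prod>v\<in>Poly_Mapping.keys m. f v ^ Poly_Mapping.lookup m v))"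

lemma PConst_power: "PConst c ^ n = PConst (c ^ n)"
  by (induction n) (simp_all add: PConst_1 PConst_mult)

lemma PConst_prod: "PConst (prod f A) = (\<Prod>i\<in>A. PConst (f i))"
  by (induction A rule: infinite_finite_induct) (simp_all add: PConst_1 PConst_mult)

lemma PConst_inject: "PConst a = PConst b \<longleftrightarrow> a = b"
  by (metis PConst_def lookup_single_eq)

lemma psubst_eq_peval: "psubst (\<lambda>i. PConst (f i)) P = PConst (peval f P)"
  by (simp add: psubst_def peval_def PConst_sum PConst_mult PConst_prod PConst_power)

lemma peval_simps:
  "peval f (P + Q) = peval f P + peval f Q" "peval f (P * Q) = peval f P * peval f Q"
  "peval f (PConst c) = c" "peval f (PVar v) = f v" "peval f (P - Q) = peval f P - peval f Q"
  "peval f 1 = 1" "peval f (sum h A) = (\<Sum>i\<in>A. peval f (h i))"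
proof -
  have 0: "peval f 0 = 0" by (simp add: peval_def)
  show add: "peval f (P + Q) = peval f P + peval f Q" for P Q
    using psubst_add[of "\<lambda>i. PConst (f i)" P Q, unfolded psubst_eq_peval PConst_add[symmetric]] by (simp add: PConst_inject)
  show "peval f (P * Q) = peval f P * peval f Q"
    using psubst_mult[of "\<lambda>i. PConst (f i)" P Q, unfolded psubst_eq_peval PConst_mult[symmetric]] by (simp add: PConst_inject)
  show c: "peval f (PConst c) = c" for c
    using psubst_PConst[of "\<lambda>i. PConst (f i)" c, unfolded psubst_eq_peval] by (simp add: PConst_inject)
  show "peval f (PVar v) = f v"
    using psubst_PVar[of "\<lambda>i. PConst (f i)" v, unfolded psubst_eq_peval] by (simp add: PConst_inject)
  show "peval f (P - Q) = peval f P - peval f Q" using add[of "P - Q" Q] by simp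
  show "peval f 1 = 1" using c[of 1] by (simp add: PConst_1)
  show "peval f (sum h A) = (\<Sum>i\<in>A. peval f (h i))"
    by (induction A rule: infinite_finite_induct) (simp_all add: 0 add)
qed

text \<open>Monomials are distinct characters of the multiplicative monoid of points, hence linearly
  independent functions, by Dedekind's argument.\<close>

lemma monomials_independent:
  fixes c :: "('v \<Rightarrow>\<^sub>0 nat) \<Rightarrow> complex"
  assumes "finite S" "\<And>f :: 'v \<Rightarrow> complex.
    (\<Sum>m\<in>S. c m * (\<Prod>v\<in>Poly_Mapping.keys m. f v ^ Poly_Mapping.lookup m v)) = 0" "m \<in> S"
  shows "c m = 0"
  using assms
proof (induction S arbitrary: c m rule: finite_induct)
  case (insert m0 S)
  define X :: "('v \<Rightarrow>\<^sub>0 nat) \<Rightarrow> ('v \<Rightarrow> complex) \<Rightarrow> complex"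
    where "X m f = (\<Prod>v\<in>Poly_Mapping.keys m. f v ^ Poly_Mapping.lookup m v)" for m f
  have mult: "X m (\<lambda>v. f v * g v) = X m f * X m g" for m f g
    by (simp add: X_def power_mult_distrib prod.distrib)
  have IH: "d m1 = 0" if "\<And>f. (\<Sum>m\<in>S. d m * X m f) = 0" "m1 \<in> S" for d m1
    using insert.IH[of d m1] that by (simp add: X_def)
  have eq: "c m0 * X m0 f + (\<Sum>m\<in>S. c m * X m f) = 0" for f
    using insert.prems(1)[of f] insert.hyps by (simp add: X_def)
  have S0: "c m1 = 0" if m1: "m1 \<in> S" for m1
  proof -
    have "m0 \<noteq> m1" using m1 insert.hyps by blast
    then obtain w where w: "Poly_Mapping.lookup m0 w \<noteq> Poly_Mapping.lookup m1 w"
      by (metis poly_mapping_eqI)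
    define g :: "'v \<Rightarrow> complex" where "g v = (if v = w then 2 else 1)" for v
    have Xg: "X m g = 2 ^ Poly_Mapping.lookup m w" for m
    proof -
      have "X m g = (\<Prod>v\<in>Poly_Mapping.keys m. if v = w then 2 ^ Poly_Mapping.lookup m w else 1)"
        unfolding X_def by (intro prod.cong) (auto simp: g_def)
      then show ?thesis by (simp add: in_keys_iff)
    qed
    have "(\<Sum>m\<in>S. (c m * (X m g - X m0 g)) * X m f) = 0" for f
    proof -
      have "(\<Sum>m\<in>S. (c m * (X m g - X m0 g)) * X m f) =
          (c m0 * X m0 (\<lambda>v. f v * g v) + (\<Sum>m\<in>S. c m * X m (\<lambda>v. f v * g v))) -
          X m0 g * (c m0 * X m0 f + (\<Sum>m\<in>S. c m * X m f))"
        unfolding mult distrib_left right_diff_distrib left_diff_distrib sum_subtractf sum_distrib_left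
        by (simp add: mult.assoc mult.commute mult.left_commute)
      then show ?thesis by (simp only: eq) simp
    qed
    then have "c m1 * (X m1 g - X m0 g) = 0" using m1 by (rule IH)
    moreover have "(2::nat) ^ Poly_Mapping.lookup m1 w \<noteq> 2 ^ Poly_Mapping.lookup m0 w"
      using w by simp
    then have "complex_of_nat (2 ^ Poly_Mapping.lookup m1 w) \<noteq> of_nat (2 ^ Poly_Mapping.lookup m0 w)"
      unfolding of_nat_eq_iff .
    then have "(2::complex) ^ Poly_Mapping.lookup m1 w \<noteq> 2 ^ Poly_Mapping.lookup m0 w"
      unfolding of_nat_power of_nat_numeral .
    ultimately show ?thesis by (simp add: Xg)
  qed
  have "c m0 * X m0 (\<lambda>_. 1) = 0" using eq[of "\<lambda>_. 1"] S0 by simp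
  then have "c m0 = 0" by (simp add: X_def)
  with S0 insert.prems(2) show ?case by blast
qed simp

lemma peval_inject:
  assumes "\<And>f. peval f P = peval f Q"
  shows "P = Q"
proof -
  have "peval f (P - Q) = 0" for f by (simp add: peval_simps assms)
  then have "Poly_Mapping.lookup (P - Q) m = 0" if "m \<in> Poly_Mapping.keys (P - Q)" for m
    using monomials_independent[of "Poly_Mapping.keys (P - Q)" "Poly_Mapping.lookup (P - Q)" m] that
    by (simp add: peval_def)
  then have "P - Q = 0" by (metis in_keys_iff poly_mapping_eqI lookup_zero)
  then show ?thesis by simp
qed

lemma vars_in_PConst: "vars_in W (PConst c)"
  by (simp add: vars_in_def PConst_def)

lemma vars_in_PVar: "v \<in> W \<Longrightarrow> vars_in W (PVar v)"
  by (simp add: vars_in_def PVar_def)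

lemma vars_in_add: "vars_in W p \<Longrightarrow> vars_in W q \<Longrightarrow> vars_in W (p + q)"
  using keys_add[of p q] unfolding vars_in_def by blast

lemma vars_in_mult:
  assumes "vars_in W p" "vars_in W q"
  shows "vars_in W (p * q)"
  unfolding vars_in_def
proof
  fix m assume "m \<in> Poly_Mapping.keys (p * q)"
  then obtain a b where "m = a + b" "a \<in> Poly_Mapping.keys p" "b \<in> Poly_Mapping.keys q"
    using keys_mult[of p q] by blast
  then show "Poly_Mapping.keys m \<subseteq> W"
    using assms keys_add[of a b] unfolding vars_in_def by blast
qed

lemma sym_polys_eq: "sym_polys W = {p. vars_in W p}"
  by (simp add: sym_polys_def vars_in_def)

lemma add_coset_eq:
  fixes I :: "'a::ab_group_add set"
  assumes "0 \<in> I" "\<And>x y. x \<in> I \<Longrightarrow> y \<in> I \<Longrightarrow> x - y \<in> I"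
  shows "x +o I = y +o I \<longleftrightarrow> x - y \<in> I"
proof
  assume "x +o I = y +o I"
  moreover have "x \<in> x +o I" using assms(1) set_zero_plus2 by (metis add.right_neutral set_plus_intro2)
  ultimately show "x - y \<in> I" by (simp add: set_plus_imp_minus)
next
  assume xy: "x - y \<in> I"
  have neg: "- z \<in> I" if "z \<in> I" for z using assms(2)[OF assms(1) that] by simp
  have "z - x \<in> I \<longleftrightarrow> z - y \<in> I" for z
  proof
    assume "z - x \<in> I"
    from assms(2)[OF this neg[OF xy]] show "z - y \<in> I" by simp
  next
    assume "z - y \<in> I"
    from assms(2)[OF this xy] show "z - x \<in> I" by simp
  qed
  then show "x +o I = y +o I" by (auto simp: set_minus_plus[symmetric])
qed

lemma sym_ideal_0: "0 \<in> sym_ideal W"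
  unfolding sym_ideal_def by (rule CollectI, rule exI[of _ 0]) simp

lemma sym_ideal_add:
  assumes "x \<in> sym_ideal W" "y \<in> sym_ideal W"
  shows "x + y \<in> sym_ideal W"
proof -
  obtain n q r where 1: "x = (\<Sum>k<(n::nat). q k * r k)" "\<forall>k<n. q k \<in> sym_polys W \<and> r k \<in> sym_rels W"
    using assms(1) unfolding sym_ideal_def by blast
  obtain n' q' r' where 2: "y = (\<Sum>k<(n'::nat). q' k * r' k)" "\<forall>k<n'. q' k \<in> sym_polys W \<and> r' k \<in> sym_rels W"
    using assms(2) unfolding sym_ideal_def by blast
  let ?q = "\<lambda>k. if k < n then q k else q' (k - n)" and ?r = "\<lambda>k. if k < n then r k else r' (k - n)"
  have "x + y = (\<Sum>k<n + n'. ?q k * ?r k)"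
    unfolding 1 2 sum_lessThan_append by (rule sum.cong) simp_all
  moreover have "\<forall>k<n + n'. ?q k \<in> sym_polys W \<and> ?r k \<in> sym_rels W" using 1(2) 2(2) by auto
  ultimately show ?thesis
    unfolding sym_ideal_def by (intro CollectI exI[of _ "n + n'"] exI[of _ ?q] exI[of _ ?r] conjI)
qed

lemma sym_ideal_mult:
  assumes "x \<in> sym_ideal W" "p \<in> sym_polys W"
  shows "p * x \<in> sym_ideal W"
proof -
  obtain n q r where 1: "x = (\<Sum>k<(n::nat). q k * r k)" "\<forall>k<n. q k \<in> sym_polys W \<and> r k \<in> sym_rels W"
    using assms(1) unfolding sym_ideal_def by blast
  have "p * x = (\<Sum>k<n. (p * q k) * r k)" by (simp add: 1 sum_distrib_left mult.assoc)
  moreover have "\<forall>k<n. p * q k \<in> sym_polys W \<and> r k \<in> sym_rels W"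
    using 1(2) assms(2) by (simp add: sym_polys_eq vars_in_mult)
  ultimately show ?thesis
    unfolding sym_ideal_def by (intro CollectI exI[of _ n] exI[of _ "\<lambda>k. p * q k"] exI[of _ r] conjI)
qed

lemma sym_ideal_rel: "r \<in> sym_rels W \<Longrightarrow> r \<in> sym_ideal W"
  unfolding sym_ideal_def
  by (rule CollectI, rule exI[of _ 1], rule exI[of _ "\<lambda>_. 1"], rule exI[of _ "\<lambda>_. r"])
    (simp add: sym_polys_eq vars_in_PConst[of W 1, unfolded PConst_1])

lemma sym_ideal_uminus: "x \<in> sym_ideal W \<Longrightarrow> - x \<in> sym_ideal W"
  using sym_ideal_mult[of x W "PConst (-1)"] by (simp add: sym_polys_eq vars_in_PConst) (simp add: PConst_uminus PConst_1)

lemma sym_ideal_diff: "x \<in> sym_ideal W \<Longrightarrow> y \<in> sym_ideal W \<Longrightarrow> x - y \<in> sym_ideal W"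
  using sym_ideal_add[of x W "- y"] sym_ideal_uminus[of y W] by simp

lemmas sym_coset_eq = add_coset_eq[OF sym_ideal_0 sym_ideal_diff]

section \<open>Comparison with \<open>Sym\<close> and \<open>Fun\<close>\<close>

text \<open>The dual of the space of constant forms is \<open>\<complex>\<^sup>g\<close>; the coordinates of a functional are its values on
  the forms \<open>dz\<^sub>i\<close>.\<close>

definition dual_coords :: "(('a \<Rightarrow> complex^'n) \<Rightarrow> complex) \<Rightarrow> complex^'n" where
  "dual_coords w = (\<chi> i. w (\<lambda>_. axis i 1))"

locale torus_forms =
  fixes \<Lambda> :: "(complex^'n) set"
  assumes forms: "H0_Omega \<Lambda> = range (\<lambda>c _. c)"
begin

abbreviation "T \<equiv> tangent_eval \<Lambda>"
abbreviation "W \<equiv> dual_space (H0_Omega \<Lambda>)"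

lemma T_apply: "T v (\<lambda>_. c) = (\<Sum>i\<in>UNIV. c $ i * v $ i)"
  by (simp add: tangent_eval_def forms)

lemma T_outside: "\<omega> \<notin> H0_Omega \<Lambda> \<Longrightarrow> T v \<omega> = 0"
  by (simp add: tangent_eval_def)

lemma T_add: "T (u + v) = T u + T v"
  by (auto simp: tangent_eval_def fun_eq_iff distrib_left sum.distrib)

lemma T_scale: "T (c *s v) = (\<lambda>\<omega>. c * T v \<omega>)"
  by (auto simp: tangent_eval_def fun_eq_iff sum_distrib_left mult_ac)

lemma T_in_W: "T v \<in> W"
  unfolding dual_space_def
proof (intro CollectI conjI ballI allI impI)
  fix x y assume "x \<in> H0_Omega \<Lambda>" "y \<in> H0_Omega \<Lambda>"
  then obtain c d where "x = (\<lambda>_. c)" "y = (\<lambda>_. d)" unfolding forms by blast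
  then have "x + y = (\<lambda>_. c + d)" by (simp add: plus_fun_def)
  then show "T v (x + y) = T v x + T v y"
    by (simp add: T_apply \<open>x = _\<close> \<open>y = _\<close> distrib_right sum.distrib)
next
  fix k x assume "x \<in> H0_Omega \<Lambda>"
  then obtain c where "x = (\<lambda>_. c)" unfolding forms by blast
  then show "T v (\<lambda>a. k *s x a) = k * T v x" by (simp add: T_apply sum_distrib_left mult.assoc)
qed (rule T_outside)

lemma coords_T: "dual_coords (T v) = v"
proof -
  have "(\<Sum>j\<in>UNIV. axis i (1::complex) $ j * v $ j) = v $ i" for i
  proof -
    have "(\<Sum>j\<in>UNIV. axis i (1::complex) $ j * v $ j) = (\<Sum>j\<in>UNIV. if j = i then v $ i else 0)"
      by (intro sum.cong) (auto simp: axis_def)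
    then show ?thesis by simp
  qed
  then show ?thesis by (simp add: dual_coords_def T_apply)
qed

lemma T_coords:
  assumes "w \<in> W"
  shows "T (dual_coords w) = w"
proof
  have out: "\<And>x. x \<notin> H0_Omega \<Lambda> \<Longrightarrow> w x = 0"
    and add: "\<And>c d. w (\<lambda>_. c + d) = w (\<lambda>_. c) + w (\<lambda>_. d)"
    and scale: "\<And>k c. w (\<lambda>_. k *s c) = k * w (\<lambda>_. c)"
  proof -
    show "\<And>x. x \<notin> H0_Omega \<Lambda> \<Longrightarrow> w x = 0" using assms by (simp add: dual_space_def)
    have a: "\<And>x y. x \<in> H0_Omega \<Lambda> \<Longrightarrow> y \<in> H0_Omega \<Lambda> \<Longrightarrow> w (x + y) = w x + w y"
      and s: "\<And>c x. x \<in> H0_Omega \<Lambda> \<Longrightarrow> w (\<lambda>a. c *s x a) = c * w x"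
      using assms by (auto simp: dual_space_def)
    have "(\<lambda>_. c) \<in> H0_Omega \<Lambda>" for c unfolding forms by blast
    then show "w (\<lambda>_. c + d) = w (\<lambda>_. c) + w (\<lambda>_. d)" "w (\<lambda>_. k *s c) = k * w (\<lambda>_. c)" for c d k
      using a[of "\<lambda>_. c" "\<lambda>_. d"] s[of "\<lambda>_. c" k] by (simp_all add: plus_fun_def)
  qed
  have sum: "w (\<lambda>_. \<Sum>i\<in>A. c $ i *s axis i 1) = (\<Sum>i\<in>A. c $ i * w (\<lambda>_. axis i 1))" for c and A :: "'n set"
    using scale[of 0 0] by (induction A rule: infinite_finite_induct) (simp_all add: add scale)
  fix \<omega>
  show "T (dual_coords w) \<omega> = w \<omega>"
  proof (cases "\<omega> \<in> H0_Omega \<Lambda>")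
    case True
    then obtain c where \<omega>: "\<omega> = (\<lambda>_. c)" unfolding forms by blast
    show ?thesis
      using sum[of c UNIV] by (simp add: \<omega> T_apply dual_coords_def basis_expansion)
  qed (simp add: T_outside out)
qed

definition from_poly :: "'n mpoly \<Rightarrow> ((complex^'n \<Rightarrow> complex^'n) \<Rightarrow> complex) mpoly" where
  "from_poly = psubst (\<lambda>i. PVar (T (axis i 1)))"

definition to_poly :: "((complex^'n \<Rightarrow> complex^'n) \<Rightarrow> complex) mpoly \<Rightarrow> 'n mpoly" where
  "to_poly = psubst (\<lambda>w. linform (dual_coords w))"

lemma to_from_poly: "to_poly (from_poly P) = P"
  by (simp add: to_poly_def from_poly_def psubst_psubst psubst_PVar coords_T linform_axis psubst_PVar_id)

lemma from_poly_sym_polys: "from_poly P \<in> sym_polys W"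
  unfolding sym_polys_eq from_poly_def
  by (induction P rule: mpoly_induct)
    (simp_all add: psubst_PConst psubst_PVar psubst_add psubst_mult vars_in_PConst vars_in_PVar vars_in_add vars_in_mult T_in_W)

lemma to_poly_ideal: "x \<in> sym_ideal W \<Longrightarrow> to_poly x = 0"
proof -
  assume "x \<in> sym_ideal W"
  then obtain n q r where x: "x = (\<Sum>k<(n::nat). q k * r k)" "\<forall>k<n. q k \<in> sym_polys W \<and> r k \<in> sym_rels W"
    unfolding sym_ideal_def by blast
  have "dual_coords (a + b) = dual_coords a + dual_coords b" for a b :: "(complex^'n \<Rightarrow> complex^'n) \<Rightarrow> complex"
    by (simp add: dual_coords_def vec_eq_iff)
  moreover have "dual_coords (\<lambda>z. c * a z) = c *s dual_coords a" for c and a :: "(complex^'n \<Rightarrow> complex^'n) \<Rightarrow> complex"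
    by (simp add: dual_coords_def vec_eq_iff)
  ultimately have "to_poly r = 0" if "r \<in> sym_rels W" for r
    using that
    by (auto simp: sym_rels_def to_poly_def psubst_diff psubst_mult psubst_PVar psubst_PConst linform_add linform_scale)
  with x(2) show ?thesis by (simp add: x(1) to_poly_def psubst_sum psubst_mult)
qed

text \<open>Modulo the relations of \<open>Sym\<close>, the variable of a functional depends linearly on the functional.\<close>

lemma PVar_T_congruent: "PVar (T v) - from_poly (linform v) \<in> sym_ideal W"
proof -
  have "PVar (T (\<Sum>i\<in>A. v $ i *s axis i 1)) - (\<Sum>i\<in>A. PConst (v $ i) * PVar (T (axis i 1))) \<in> sym_ideal W"
    for A :: "'n set"
  proof (induction A rule: infinite_finite_induct)
    case empty
    have "PVar (\<lambda>a. 0 * T 0 a) - PConst 0 * PVar (T 0) \<in> sym_rels W"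
      unfolding sym_rels_def using T_in_W[of 0] by blast
    moreover have "(\<lambda>a. 0 * T 0 a) = T 0" using T_scale[of 0 0] by simp
    ultimately show ?case by (auto intro!: sym_ideal_rel simp: PConst_0)
  next
    case (insert i A)
    let ?u = "v $ i *s axis i 1 :: complex^'n" and ?s = "\<Sum>i\<in>A. v $ i *s axis i 1 :: complex^'n"
    have "PVar (T ?u + T ?s) - PVar (T ?u) - PVar (T ?s) \<in> sym_rels W"
      unfolding sym_rels_def using T_in_W by blast
    then have 1: "PVar (T (?u + ?s)) - PVar (T ?u) - PVar (T ?s) \<in> sym_ideal W"
      by (intro sym_ideal_rel) (simp add: T_add)
    have "PVar (\<lambda>a. v $ i * T (axis i 1) a) - PConst (v $ i) * PVar (T (axis i 1)) \<in> sym_rels W"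
      unfolding sym_rels_def using T_in_W by blast
    then have 2: "PVar (T ?u) - PConst (v $ i) * PVar (T (axis i 1)) \<in> sym_ideal W"
      by (intro sym_ideal_rel) (simp add: T_scale)
    show ?case
      using sym_ideal_add[OF sym_ideal_add[OF 1 2] insert.IH] insert.hyps by (simp add: algebra_simps)
  qed simp
  from this[of UNIV] show ?thesis
    by (simp add: basis_expansion from_poly_def linform_def psubst_sum psubst_mult psubst_PConst psubst_PVar)
qed

text \<open>Surjectivity: modulo the ideal every variable is a linear combination of the variables of the \<open>T(e\<^sub>i)\<close>.\<close>

lemma from_to_poly:
  assumes "p \<in> sym_polys W"
  shows "p - from_poly (to_poly p) \<in> sym_ideal W"
proof -
  have "vars_in W p" using assms by (simp add: sym_polys_eq)
  then have "p \<in> sym_polys W \<and> p - from_poly (to_poly p) \<in> sym_ideal W"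
  proof (induction p rule: mpoly_induct_in)
    case (const c)
    then show ?case
      by (simp add: to_poly_def from_poly_def psubst_PConst sym_ideal_0 sym_polys_eq vars_in_PConst)
  next
    case (var w)
    then have "PVar w - from_poly (to_poly (PVar w)) \<in> sym_ideal W"
      using PVar_T_congruent[of "dual_coords w"] by (simp add: T_coords to_poly_def psubst_PVar)
    with var show ?case by (simp add: sym_polys_eq vars_in_PVar)
  next
    case (add p q)
    then have "(p - from_poly (to_poly p)) + (q - from_poly (to_poly q)) \<in> sym_ideal W"
      by (intro sym_ideal_add) auto
    with add show ?case
      by (simp add: sym_polys_eq vars_in_add to_poly_def from_poly_def psubst_add algebra_simps)
  next
    case (mult p q)
    then have "q * (p - from_poly (to_poly p)) + from_poly (to_poly p) * (q - from_poly (to_poly q)) \<in> sym_ideal W"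
      by (intro sym_ideal_add sym_ideal_mult from_poly_sym_polys) auto
    with mult show ?case
      by (simp add: sym_polys_eq vars_in_mult to_poly_def from_poly_def psubst_mult algebra_simps)
  qed
  then show ?thesis ..
qed

lemma sym_ideal_plus: "sym_ideal W + sym_ideal W = sym_ideal W"
proof
  show "sym_ideal W + sym_ideal W \<subseteq> sym_ideal W" by (auto simp: set_plus_def intro: sym_ideal_add)
  show "sym_ideal W \<subseteq> sym_ideal W + sym_ideal W"
    using set_plus_intro[OF _ sym_ideal_0, of _ "sym_ideal W" W] by force
qed

lemma lin_iso_Sym: "lin_iso poly_space (Sym W) (\<lambda>P. from_poly P +o sym_ideal W)"
proof -
  have "inj (\<lambda>P. from_poly P +o sym_ideal W)"
  proof (rule injI)
    fix P Q assume "from_poly P +o sym_ideal W = from_poly Q +o sym_ideal W"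
    then have "from_poly P - from_poly Q \<in> sym_ideal W" by (simp add: sym_coset_eq)
    then have "to_poly (from_poly P - from_poly Q) = 0" by (rule to_poly_ideal)
    then have "to_poly (from_poly P) = to_poly (from_poly Q)" by (simp add: to_poly_def psubst_diff)
    then show "P = Q" by (simp add: to_from_poly)
  qed
  moreover have "range (\<lambda>P. from_poly P +o sym_ideal W) = {p +o sym_ideal W | p. p \<in> sym_polys W}"
  proof
    show "{p +o sym_ideal W | p. p \<in> sym_polys W} \<subseteq> range (\<lambda>P. from_poly P +o sym_ideal W)"
    proof
      fix A assume "A \<in> {p +o sym_ideal W | p. p \<in> sym_polys W}"
      then obtain p where p: "p \<in> sym_polys W" "A = p +o sym_ideal W" by blast
      then have "A = from_poly (to_poly p) +o sym_ideal W" by (simp add: sym_coset_eq from_to_poly)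
      then show "A \<in> range (\<lambda>P. from_poly P +o sym_ideal W)" by blast
    qed
  qed (use from_poly_sym_polys in blast)
  moreover have "from_poly (P + Q) +o sym_ideal W = (from_poly P +o sym_ideal W) + (from_poly Q +o sym_ideal W)" for P Q
    by (simp add: set_plus_rearrange sym_ideal_plus from_poly_def psubst_add)
  moreover have "from_poly (PConst c * P) +o sym_ideal W =
    (\<lambda>p. PConst c * p) ` (from_poly P +o sym_ideal W) + sym_ideal W" for c P
  proof -
    have c: "PConst c \<in> sym_polys W" by (simp add: sym_polys_eq vars_in_PConst)
    have "(\<lambda>p. PConst c * p) ` (from_poly P +o sym_ideal W) + sym_ideal W = PConst c * from_poly P +o sym_ideal W"
    proof
      show "(\<lambda>p. PConst c * p) ` (from_poly P +o sym_ideal W) + sym_ideal W \<subseteq> PConst c * from_poly P +o sym_ideal W"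
      proof
        fix x assume "x \<in> (\<lambda>p. PConst c * p) ` (from_poly P +o sym_ideal W) + sym_ideal W"
        then obtain y z where "y \<in> sym_ideal W" "z \<in> sym_ideal W" "x = PConst c * (from_poly P + y) + z"
          by (auto simp: set_plus_def elt_set_plus_def)
        then show "x \<in> PConst c * from_poly P +o sym_ideal W"
          using sym_ideal_add[OF sym_ideal_mult[OF _ c]] by (force simp: elt_set_plus_def algebra_simps)
      qed
      have "from_poly P \<in> from_poly P +o sym_ideal W"
        using sym_ideal_0 by (metis add.right_neutral set_plus_intro2)
      then show "PConst c * from_poly P +o sym_ideal W \<subseteq> (\<lambda>p. PConst c * p) ` (from_poly P +o sym_ideal W) + sym_ideal W"
        by (intro set_plus_mono3 imageI)
    qed
    then show ?thesis by (simp add: from_poly_def psubst_mult psubst_PConst)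
  qed
  ultimately show ?thesis
    by (simp add: lin_iso_def poly_space_def Sym_def bij_betw_def)
qed

text \<open>The right-hand side maps to the product of linear forms under \<open>to_poly\<close>, so \<open>from_to_poly\<close> applies.\<close>

lemma from_poly_prod: "from_poly (\<Prod>v\<leftarrow>vs. linform v) +o sym_ideal W = (\<Prod>v\<leftarrow>vs. PVar (T v)) +o sym_ideal W"
proof -
  have "(\<Prod>v\<leftarrow>vs. PVar (T v)) \<in> sym_polys W"
    unfolding sym_polys_eq
    by (induction vs) (simp_all add: vars_in_mult vars_in_PVar T_in_W vars_in_PConst[of W 1, unfolded PConst_1])
  moreover have "to_poly (\<Prod>v\<leftarrow>vs. PVar (T v)) = (\<Prod>v\<leftarrow>vs. linform v)"
    unfolding to_poly_def by (induction vs) (simp_all add: psubst_1 psubst_mult psubst_PVar coords_T)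
  ultimately have "(\<Prod>v\<leftarrow>vs. PVar (T v)) - from_poly (\<Prod>v\<leftarrow>vs. linform v) \<in> sym_ideal W"
    using from_to_poly by metis
  then show ?thesis by (simp add: sym_coset_eq[symmetric])
qed

definition poly_function :: "'n mpoly \<Rightarrow> (complex^'n \<Rightarrow> complex^'n) \<Rightarrow> complex" where
  "poly_function P \<omega> = (if \<omega> \<in> H0_Omega \<Lambda> then peval (vec_nth (\<omega> 0)) P else 0)"

lemma poly_function_linform: "poly_function (linform v) = T v"
  by (auto simp: fun_eq_iff poly_function_def tangent_eval_def linform_def peval_simps mult.commute)

lemma range_poly_function: "range poly_function = polynomial_functions (H0_Omega \<Lambda>)"
proof
  show "range poly_function \<subseteq> polynomial_functions (H0_Omega \<Lambda>)"
  proof clarify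
    fix P show "poly_function P \<in> polynomial_functions (H0_Omega \<Lambda>)"
    proof (induction P rule: mpoly_induct)
      case (const c)
      have "poly_function (PConst c) = (\<lambda>x. if x \<in> H0_Omega \<Lambda> then c else 0)"
        by (simp add: fun_eq_iff poly_function_def peval_simps)
      then show ?case by (simp add: polynomial_functions.const)
    next
      case (var i)
      have "poly_function (PVar i) = T (axis i 1)"
        by (simp add: linform_axis[symmetric] poly_function_linform)
      then show ?case by (simp add: polynomial_functions.lin T_in_W)
    next
      case (add P Q)
      have "poly_function (P + Q) = (\<lambda>x. poly_function P x + poly_function Q x)"
        by (simp add: fun_eq_iff poly_function_def peval_simps)
      with add show ?case by (simp add: polynomial_functions.add)
    next
      case (mult P Q)
      have "poly_function (P * Q) = (\<lambda>x. poly_function P x * poly_function Q x)"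
        by (simp add: fun_eq_iff poly_function_def peval_simps)
      with mult show ?case by (simp add: polynomial_functions.mult)
    qed
  qed
  show "polynomial_functions (H0_Omega \<Lambda>) \<subseteq> range poly_function"
  proof
    fix f assume "f \<in> polynomial_functions (H0_Omega \<Lambda>)"
    then show "f \<in> range poly_function"
    proof induction
      case (const c)
      show ?case
        by (rule range_eqI[of _ _ "PConst c"]) (simp add: fun_eq_iff poly_function_def peval_simps)
    next
      case (lin \<xi>)
      then show ?case
        by (intro range_eqI[of _ _ "linform (dual_coords \<xi>)"]) (simp add: poly_function_linform T_coords)
    next
      case (add f h)
      then obtain P Q where "f = poly_function P" "h = poly_function Q" by blast
      then show ?case
        by (intro range_eqI[of _ _ "P + Q"]) (simp add: fun_eq_iff poly_function_def peval_simps)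
    next
      case (mult f h)
      then obtain P Q where "f = poly_function P" "h = poly_function Q" by blast
      then show ?case
        by (intro range_eqI[of _ _ "P * Q"]) (simp add: fun_eq_iff poly_function_def peval_simps)
    qed
  qed
qed

lemma lin_iso_Fun: "lin_iso poly_space (Fun (H0_Omega \<Lambda>)) poly_function"
proof -
  have "inj poly_function"
  proof (rule injI)
    fix P Q assume eq: "poly_function P = poly_function Q"
    have "peval f P = peval f Q" for f
    proof -
      have "(\<lambda>_. vec_lambda f) \<in> H0_Omega \<Lambda>" unfolding forms by blast
      then show ?thesis
        using fun_cong[OF eq, of "\<lambda>_. vec_lambda f"] by (simp add: poly_function_def vec_lambda_inverse)
    qed
    then show "P = Q" by (rule peval_inject)
  qed
  then show ?thesis
    unfolding lin_iso_def poly_space_def Fun_def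
    by (simp add: bij_betw_def range_poly_function fun_eq_iff poly_function_def peval_simps)
qed

lemma poly_function_prod:
  "poly_function (\<Prod>v\<leftarrow>vs. linform v) = (\<lambda>\<omega>. if \<omega> \<in> H0_Omega \<Lambda> then \<Prod>v\<leftarrow>vs. T v \<omega> else 0)"
proof
  fix \<omega>
  have lin: "peval (vec_nth (\<omega> 0)) (linform v) = T v \<omega>" if "\<omega> \<in> H0_Omega \<Lambda>" for v
    using fun_cong[OF poly_function_linform[of v], of \<omega>] that by (simp add: poly_function_def)
  show "poly_function (\<Prod>v\<leftarrow>vs. linform v) \<omega> = (if \<omega> \<in> H0_Omega \<Lambda> then \<Prod>v\<leftarrow>vs. T v \<omega> else 0)"
  proof (cases "\<omega> \<in> H0_Omega \<Lambda>")
    case True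
    have "peval (vec_nth (\<omega> 0)) (\<Prod>v\<leftarrow>vs. linform v) = (\<Prod>v\<leftarrow>vs. T v \<omega>)"
      by (induction vs) (simp_all add: peval_simps lin[OF True])
    with True show ?thesis by (simp add: poly_function_def)
  qed (simp add: poly_function_def)
qed

end

section \<open>The canonical isomorphisms\<close>

lemma lin_iso_comp_inv:
  assumes f: "lin_iso S S' f" and h: "lin_iso S S'' h"
    and closed: "\<And>x y. x \<in> carr S \<Longrightarrow> y \<in> carr S \<Longrightarrow> vadd S x y \<in> carr S"
      "\<And>c x. x \<in> carr S \<Longrightarrow> vscale S c x \<in> carr S"
  shows "lin_iso S' S'' (h \<circ> the_inv_into (carr S) f)"
proof -
  let ?i = "the_inv_into (carr S) f"
  have bf: "bij_betw f (carr S) (carr S')" and bh: "bij_betw h (carr S) (carr S'')"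
    using f h by (auto simp: lin_iso_def)
  have i: "?i (f x) = x" if "x \<in> carr S" for x
    using that bf by (auto simp: bij_betw_def the_inv_into_f_f)
  have surj: "\<exists>x\<in>carr S. y = f x" if "y \<in> carr S'" for y
    using that bf by (auto simp: bij_betw_def)
  have fadd: "vadd S' (f x) (f y) = f (vadd S x y)" and hadd: "h (vadd S x y) = vadd S'' (h x) (h y)"
    if "x \<in> carr S" "y \<in> carr S" for x y
    using f h that by (simp_all add: lin_iso_def)
  have fscale: "vscale S' c (f x) = f (vscale S c x)" and hscale: "h (vscale S c x) = vscale S'' c (h x)"
    if "x \<in> carr S" for c x
    using f h that by (simp_all add: lin_iso_def)
  show ?thesis
    unfolding lin_iso_def
  proof (intro conjI ballI allI)
    show "bij_betw (h \<circ> ?i) (carr S') (carr S'')"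
      by (rule bij_betw_trans[OF bij_betw_the_inv_into[OF bf] bh])
  next
    fix u v assume "u \<in> carr S'" "v \<in> carr S'"
    then obtain x y where x: "x \<in> carr S" "u = f x" and y: "y \<in> carr S" "v = f y" using surj by meson
    show "(h \<circ> ?i) (vadd S' u v) = vadd S'' ((h \<circ> ?i) u) ((h \<circ> ?i) v)"
      using x(1) y(1) by (simp add: x(2) y(2) fadd hadd i closed)
  next
    fix c u assume "u \<in> carr S'"
    then obtain x where x: "x \<in> carr S" "u = f x" using surj by meson
    show "(h \<circ> ?i) (vscale S' c u) = vscale S'' c ((h \<circ> ?i) u)"
      using x(1) by (simp add: x(2) fscale hscale i closed)
  qed
qed

theorem theorem3:
  fixes \<Lambda> :: "(complex^'n) set"
    and B :: "complex^'n \<Rightarrow> complex^'n \<Rightarrow> complex"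
    and N :: nat
  assumes "ppav \<Lambda> B" and "N \<ge> 1"
  shows "\<exists>\<Phi> \<Psi>.
    lin_iso (coinvariants N \<Lambda> B) (Sym (dual_space (H0_Omega \<Lambda>))) \<Phi> \<and>
    lin_iso (coinvariants N \<Lambda> B) (Fun (H0_Omega \<Lambda>)) \<Psi> \<and>
    (\<forall>s\<in>carr (coinvariants N \<Lambda> B). \<forall>(a, \<phi>)\<in>Sp \<Lambda> B. \<forall>zs.
       set zs \<subseteq> Zof a \<and> fibre_value N s (a, \<phi>) (foldr (heis N (H1 N)) zs 1) \<longrightarrow>
         \<Phi> s = (\<Prod>z\<leftarrow>zs. PVar (tangent_eval \<Lambda> (\<phi> z))) +o sym_ideal (dual_space (H0_Omega \<Lambda>)) \<and>
         \<Psi> s = (\<lambda>\<omega>. if \<omega> \<in> H0_Omega \<Lambda> then \<Prod>z\<leftarrow>zs. tangent_eval \<Lambda> (\<phi> z) \<omega> else 0))"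
proof -
  interpret torus_forms \<Lambda> by unfold_locales (rule H0_Omega_eq[OF assms(1)])
  note sec = lin_iso_poly_section[OF assms]
  define coord where "coord = the_inv_into (carr poly_space) (poly_section \<Lambda> B)"
  let ?\<Phi> = "(\<lambda>P. from_poly P +o sym_ideal W) \<circ> coord" and ?\<Psi> = "poly_function \<circ> coord"
  have \<Phi>: "lin_iso (coinvariants N \<Lambda> B) (Sym W) ?\<Phi>" and \<Psi>: "lin_iso (coinvariants N \<Lambda> B) (Fun (H0_Omega \<Lambda>)) ?\<Psi>"
    unfolding coord_def
    by (rule lin_iso_comp_inv[OF sec lin_iso_Sym] lin_iso_comp_inv[OF sec lin_iso_Fun]; simp add: poly_space_def)+
  have val: "?\<Phi> s = (\<Prod>z\<leftarrow>zs. PVar (T (\<phi> z))) +o sym_ideal W \<and>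
      ?\<Psi> s = (\<lambda>\<omega>. if \<omega> \<in> H0_Omega \<Lambda> then \<Prod>z\<leftarrow>zs. T (\<phi> z) \<omega> else 0)"
    if s: "s \<in> carr (coinvariants N \<Lambda> B)" and p: "(a, \<phi>) \<in> Sp \<Lambda> B" and zs: "set zs \<subseteq> Zof a"
      and v: "fibre_value N s (a, \<phi>) (foldr (heis N (H1 N)) zs 1)" for s a \<phi> zs
  proof -
    obtain P where P: "s = poly_section \<Lambda> B P" using s carr_coinvariants[OF assms] by blast
    have "coord s = P"
      unfolding coord_def P using sec
      by (intro the_inv_into_f_f) (auto simp: lin_iso_def bij_betw_def poly_space_def)
    moreover have "P = (\<Prod>v\<leftarrow>map \<phi> zs. linform v)"
      using fibre_value_poly_section[OF assms(1) p v[unfolded P]] ev_foldr_heis[OF assms(1) p assms(2) zs]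
      by (simp add: o_def)
    ultimately show ?thesis
      using from_poly_prod[of "map \<phi> zs"] poly_function_prod[of "map \<phi> zs"]
      unfolding map_map o_def by simp
  qed
  show ?thesis
  proof (rule exI[of _ ?\<Phi>], rule exI[of _ ?\<Psi>], intro conjI)
    show "\<forall>s\<in>carr (coinvariants N \<Lambda> B). \<forall>(a, \<phi>)\<in>Sp \<Lambda> B. \<forall>zs.
       set zs \<subseteq> Zof a \<and> fibre_value N s (a, \<phi>) (foldr (heis N (H1 N)) zs 1) \<longrightarrow>
         ?\<Phi> s = (\<Prod>z\<leftarrow>zs. PVar (tangent_eval \<Lambda> (\<phi> z))) +o sym_ideal (dual_space (H0_Omega \<Lambda>)) \<and>
         ?\<Psi> s = (\<lambda>\<omega>. if \<omega> \<in> H0_Omega \<Lambda> then \<Prod>z\<leftarrow>zs. tangent_eval \<Lambda> (\<phi> z) \<omega> else 0)"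
      using val by blast
  qed (rule \<Phi> \<Psi>)+
qed

end
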